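(* Let $n$ be a finite ordinal with $n>2$. (1) There exists a $\mathsf{PEA}_n$ atom structure $\mathbf{At}$ such that the term algebra $\mathfrak{Tm}\mathbf{At}$ is representable as a $\mathsf{PEA}_n$, but $\mathbf{At}$ is not strongly representable. In fact, for every signature $t$ between that of $\mathsf{Df}_n$ and that of $\mathsf{PEA}_n$, the $t$-reduct of the complex algebra $\mathfrak{Cm}\mathbf{At}$ is not representable. (2) Furthermore, there exists an atomic relation algebra $\mathfrak{R}$ such that the set $\mathsf{Mat}_n\mathrm{At}\mathfrak{R}$ of all $n$-dimensional basic matrices over $\mathfrak{R}$ forms an $n$-dimensional polyadic equality basis, the term algebra $\mathfrak{Tm}\,\mathsf{Mat}_n\mathrm{At}\mathfrak{R}$ is representable as a polyadic equality algebra of dimension $n$, while the diagonal-free reduct of $\mathfrak{Cm}\,\mathsf{Mat}_n\mathrm{At}\mathfrak{R}$ is not representable (as a diagonal-free cylindric algebra of dimension $n$). In particular, the relation algebra atom structure $\mathrm{At}\mathfrak{R}$ is weakly but not strongly representable.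
   Context: Signatures. $\mathsf{Df}_n$ has the Boolean operations and cylindrifiers $c_i$ ($i<n$); $\mathsf{PEA}_n$ (polyadic equality algebras of finite dimension $n$) has in addition the diagonal constants $d_{ij}$, replacement operators $s^i_j$ and transposition operators $s_{ij}$ ($i,j<n$). A signature is between them if it is obtained from that of $\mathsf{Df}_n$ by adding some of the families $d_{ij}$, $s^i_j$, $s_{ij}$ (for instance $\mathsf{Df}$, $\mathsf{Sc}$ = substitution algebras with $c_i,s^i_j$; $\mathsf{CA}$ = cylindric algebras with $c_i,d_{ij}$; $\mathsf{PA}$ with $c_i,s^i_j,s_{ij}$; $\mathsf{PEA}$). Representability. In a set algebra with unit ${}^nU$: $c_iX=\{s:\exists t\in X,\ t_j=s_j\ \forall j\ne i\}$, $d_{ij}=\{s:s_i=s_j\}$, $s^i_jX=\{s:s\circ[i|j]\in X\}$, $s_{ij}X=\{s: s\circ[i,j]\in X\}$, where $[i|j]$ sends $i$ to $j$ and fixes everything else and $[i,j]$ swaps $i$ and $j$. An algebra is representable if it is isomorphic to a subalgebra of a direct product of set algebras of the same type. Atom structures. The atom structure $\mathrm{At}\mathfrak A$ of an atomic algebra (Boolean algebra with operators) $\mathfrak A$ has as universe the atoms, with a relation $R_\Omega(a_0,\dots,a_r)\iff \Omega(a_1,\dots,a_r)\ge a_0$ for every extra-Boolean operator $\Omega$. $\mathfrak{Cm}\,S$ is the complex algebra of $S$ (all subsets of $S$, with $\Omega(X_1,\dots,X_r)=\{s:\exists s_i\in X_i,\ R_\Omega(s,s_1,\dots,s_r)\}$),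 and $\mathfrak{Tm}\,S$ is the subalgebra of $\mathfrak{Cm}\,S$ generated by the singletons. An atom structure is weakly representable if at least one atomic algebra having it as atom structure is representable (equivalently, its term algebra is representable), and strongly representable if all atomic algebras having it as atom structure are representable (equivalently its complex algebra is). Basic matrices. For an atomic relation algebra $\mathfrak R$, an $n$-dimensional basic matrix is a map $f:n\times n\to\mathrm{At}\mathfrak R$ with $f(x,x)\le 1'$, $f(y,x)=f(x,y)^{\smile}$ and $f(x,z)\le f(x,y);f(y,z)$ for all $x,y,z<n$. $\mathsf{Mat}_n\mathrm{At}\mathfrak R$, the set of all of them, is regarded as an atom structure with $R_{c_i}(f,g)$ iff $f(x,y)=g(x,y)$ for all $x,y\neq i$, $R_{d_{ij}}(f)$ iff $f(i,j)\le 1'$, $R_{s_{ij}}(f,g)$ iff $f\circ[i,j]=g$, and $R_{s^i_j}(f,g)$ iff $f\circ[i|j]=g$ (here $(f\circ\tau)(x,y)=f(\tau(x),\tau(y))$). A set $\mathcal M$ of basic matrices is an $n$-dimensional cylindric basis if: every atom is $f(0,1)$ for some $f\in\mathcal M$; if $f\in\mathcal M$, $f(x,y)\le a;b$ with $a,b$ atoms and $z\ne x,y$, there is $g\in\mathcal M$ agreeing with $f$ off $z$ with $g(x,z)=a$, $g(z,y)=b$; and if $f,g\in\mathcal M$ agree off $\{x,y\}$ there is $h\in\mathcal M$ agreeing with $f$ off $x$ and with $g$ off $y$. It is a polyadic equality basis if it is moreover closed under $f\mapsto f\circ\tau$ for all $\tau:n\to n$. *)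

theory Defs
  imports "HOL-Library.FuncSet" "HOL-Library.Equipollence" "HOL-Combinatorics.Transposition"
begin

section \<open>Algebras with Boolean and extra-Boolean operations\<close>

text \<open>
  A signature is a set of pairs (operation symbol, arity), for the extra-Boolean symbols only.
  Algebras and atom structures interpret every symbol of the type \<open>'f\<close>; each notion below
  takes a signature and looks only at the symbols in it.  So the reduct of an algebra to a smaller
  signature is the same record, used with the smaller signature.
\<close>

type_synonym 'f signature = "('f \<times> nat) set"

record ('f, 'a) algebra =
  elems :: "'a set"
  join :: "'a \<Rightarrow> 'a \<Rightarrow> 'a"
  meet :: "'a \<Rightarrow> 'a \<Rightarrow> 'a"
  neg :: "'a \<Rightarrow> 'a"
  bzero :: 'a
  bone :: 'a
  oper :: "'f \<Rightarrow> 'a list \<Rightarrow> 'a"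

definition closed_under :: "'f signature \<Rightarrow> ('f, 'a) algebra \<Rightarrow> 'a set \<Rightarrow> bool" where
  "closed_under sig A X \<longleftrightarrow>
     X \<subseteq> elems A \<and> bzero A \<in> X \<and> bone A \<in> X \<and>
     (\<forall>x\<in>X. \<forall>y\<in>X. join A x y \<in> X) \<and>
     (\<forall>x\<in>X. \<forall>y\<in>X. meet A x y \<in> X) \<and>
     (\<forall>x\<in>X. neg A x \<in> X) \<and>
     (\<forall>(f, r)\<in>sig. \<forall>xs. length xs = r \<and> set xs \<subseteq> X \<longrightarrow> oper A f xs \<in> X)"

definition subalgebra :: "'f signature \<Rightarrow> ('f, 'a) algebra \<Rightarrow> ('f, 'a) algebra \<Rightarrow> bool" where
  "subalgebra sig B A \<longleftrightarrow> (\<exists>X. closed_under sig A X \<and> B = A\<lparr>elems := X\<rparr>)"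

definition generated_subalgebra :: "'f signature \<Rightarrow> ('f, 'a) algebra \<Rightarrow> 'a set \<Rightarrow> ('f, 'a) algebra" where
  "generated_subalgebra sig A G = A\<lparr>elems := \<Inter>{X. closed_under sig A X \<and> G \<subseteq> X}\<rparr>"

definition homomorphism :: "'f signature \<Rightarrow> ('a \<Rightarrow> 'b) \<Rightarrow> ('f, 'a) algebra \<Rightarrow> ('f, 'b) algebra \<Rightarrow> bool" where
  "homomorphism sig h A B \<longleftrightarrow>
     h \<in> elems A \<rightarrow> elems B \<and> h (bzero A) = bzero B \<and> h (bone A) = bone B \<and>
     (\<forall>x\<in>elems A. \<forall>y\<in>elems A. h (join A x y) = join B (h x) (h y)) \<and>
     (\<forall>x\<in>elems A. \<forall>y\<in>elems A. h (meet A x y) = meet B (h x) (h y)) \<and>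
     (\<forall>x\<in>elems A. h (neg A x) = neg B (h x)) \<and>
     (\<forall>(f, r)\<in>sig. \<forall>xs. length xs = r \<and> set xs \<subseteq> elems A \<longrightarrow>
        h (oper A f xs) = oper B f (map h xs))"

definition isomorphic :: "'f signature \<Rightarrow> ('f, 'a) algebra \<Rightarrow> ('f, 'b) algebra \<Rightarrow> bool" where
  "isomorphic sig A B \<longleftrightarrow> (\<exists>h. homomorphism sig h A B \<and> bij_betw h (elems A) (elems B))"

definition direct_product :: "'i set \<Rightarrow> ('i \<Rightarrow> ('f, 'a) algebra) \<Rightarrow> ('f, 'i \<Rightarrow> 'a) algebra" where
  "direct_product I B =
     \<lparr> elems = (\<Pi>\<^sub>E i\<in>I. elems (B i)),
       join = (\<lambda>x y. \<lambda>i\<in>I. join (B i) (x i) (y i)),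
       meet = (\<lambda>x y. \<lambda>i\<in>I. meet (B i) (x i) (y i)),
       neg = (\<lambda>x. \<lambda>i\<in>I. neg (B i) (x i)),
       bzero = (\<lambda>i\<in>I. bzero (B i)),
       bone = (\<lambda>i\<in>I. bone (B i)),
       oper = (\<lambda>f xs. \<lambda>i\<in>I. oper (B i) f (map (\<lambda>x. x i) xs)) \<rparr>"

definition boolean_alg :: "('f, 'a) algebra \<Rightarrow> bool" where
  "boolean_alg A \<longleftrightarrow> closed_under {} A (elems A) \<and>
     (\<forall>x\<in>elems A. \<forall>y\<in>elems A.
        join A x y = join A y x \<and> meet A x y = meet A y x) \<and>
     (\<forall>x\<in>elems A. \<forall>y\<in>elems A. \<forall>z\<in>elems A.
        join A (join A x y) z = join A x (join A y z) \<and>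
        meet A (meet A x y) z = meet A x (meet A y z) \<and>
        meet A x (join A y z) = join A (meet A x y) (meet A x z) \<and>
        join A x (meet A y z) = meet A (join A x y) (join A x z)) \<and>
     (\<forall>x\<in>elems A. join A x (bzero A) = x \<and> meet A x (bone A) = x \<and>
        join A x (neg A x) = bone A \<and> meet A x (neg A x) = bzero A)"

definition below :: "('f, 'a) algebra \<Rightarrow> 'a \<Rightarrow> 'a \<Rightarrow> bool" where
  "below A x y \<longleftrightarrow> join A x y = y"

definition atoms :: "('f, 'a) algebra \<Rightarrow> 'a set" where
  "atoms A = {a\<in>elems A. a \<noteq> bzero A \<and> (\<forall>x\<in>elems A. below A x a \<longrightarrow> x = bzero A \<or> x = a)}"

definition atomic :: "('f, 'a) algebra \<Rightarrow> bool" where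
  "atomic A \<longleftrightarrow> (\<forall>x\<in>elems A. x \<noteq> bzero A \<longrightarrow> (\<exists>a\<in>atoms A. below A a x))"


section \<open>Atom structures, complex algebras and term algebras\<close>

record ('f, 'a) atom_structure =
  points :: "'a set"
  rel :: "'f \<Rightarrow> 'a \<Rightarrow> 'a list \<Rightarrow> bool"

definition At :: "('f, 'a) algebra \<Rightarrow> ('f, 'a) atom_structure" where
  "At A = \<lparr> points = atoms A, rel = (\<lambda>f a as. below A a (oper A f as)) \<rparr>"

definition Cm :: "('f, 'a) atom_structure \<Rightarrow> ('f, 'a set) algebra" where
  "Cm S =
     \<lparr> elems = Pow (points S), join = (\<union>), meet = (\<inter>), neg = (\<lambda>X. points S - X),
       bzero = {}, bone = points S,
       oper = (\<lambda>f Xs. {s\<in>points S. \<exists>ss. list_all2 (\<in>) ss Xs \<and> rel S f s ss}) \<rparr>"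

definition Tm :: "'f signature \<Rightarrow> ('f, 'a) atom_structure \<Rightarrow> ('f, 'a set) algebra" where
  "Tm sig S = generated_subalgebra sig (Cm S) {{s} | s. s \<in> points S}"

definition isomorphic_as :: "'f signature \<Rightarrow> ('f, 'a) atom_structure \<Rightarrow> ('f, 'b) atom_structure \<Rightarrow> bool" where
  "isomorphic_as sig S T \<longleftrightarrow>
     (\<exists>h. bij_betw h (points S) (points T) \<and>
       (\<forall>(f, r)\<in>sig. \<forall>a\<in>points S. \<forall>as. length as = r \<and> set as \<subseteq> points S \<longrightarrow>
          (rel S f a as \<longleftrightarrow> rel T f (h a) (map h as))))"

text \<open>
  \<open>K\<close> is a class of algebras.  The algebras in it are taken on subsets of the type \<open>'a set\<close>, where
  \<open>'a\<close> is the type of the points of \<open>S\<close>.  Up to isomorphism this is no restriction: in an atomic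
  algebra, an element is determined by the set of atoms below it.
\<close>

definition has_atom_structure ::
  "'f signature \<Rightarrow> (('f, 'a set) algebra \<Rightarrow> bool) \<Rightarrow> ('f, 'a) atom_structure \<Rightarrow> ('f, 'a set) algebra \<Rightarrow> bool" where
  "has_atom_structure sig K S A \<longleftrightarrow> K A \<and> atomic A \<and> isomorphic_as sig (At A) S"

definition is_atom_structure ::
  "'f signature \<Rightarrow> (('f, 'a set) algebra \<Rightarrow> bool) \<Rightarrow> ('f, 'a) atom_structure \<Rightarrow> bool" where
  "is_atom_structure sig K S \<longleftrightarrow> (\<exists>A. has_atom_structure sig K S A)"


section \<open>Representability\<close>

text \<open>
  \<open>F U\<close> is the concrete algebra of the given type on the base \<open>U\<close> (below: the full set algebra with
  unit \<open>\<^sup>nU\<close>, or the algebra of all binary relations on \<open>U\<close>).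
\<close>

definition in_product ::
  "'f signature \<Rightarrow> ('u set \<Rightarrow> ('f, 'b) algebra) \<Rightarrow> ('f, 'a) algebra \<Rightarrow> 'i set \<Rightarrow> ('i \<Rightarrow> 'u set) \<Rightarrow> bool" where
  "in_product sig F A I U \<longleftrightarrow>
     (\<exists>B. subalgebra sig B (direct_product I (\<lambda>i. F (U i))) \<and> isomorphic sig A B)"

text \<open>
  HOL cannot quantify over the types of the index set and of the bases.  The index type \<open>'a\<close> and the
  base type \<open>'a list\<close>, of cardinality \<open>max |'a| \<aleph>\<^sub>0\<close>, are large enough; see the lemmas
  \<open>representable_set_algebraI\<close> and \<open>representable_rel_algebraI\<close> at the end of this theory.
\<close>

definition representable ::
  "'f signature \<Rightarrow> ('a list set \<Rightarrow> ('f, 'b) algebra) \<Rightarrow> ('f, 'a) algebra \<Rightarrow> bool" where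
  "representable sig F A \<longleftrightarrow> (\<exists>(I :: 'a set) (U :: 'a \<Rightarrow> 'a list set). in_product sig F A I U)"

definition weakly_representable ::
  "'f signature \<Rightarrow> (('f, 'a set) algebra \<Rightarrow> bool) \<Rightarrow> ('a set list set \<Rightarrow> ('f, 'b) algebra) \<Rightarrow>
     ('f, 'a) atom_structure \<Rightarrow> bool" where
  "weakly_representable sig K F S \<longleftrightarrow> (\<exists>A. has_atom_structure sig K S A \<and> representable sig F A)"

definition strongly_representable ::
  "'f signature \<Rightarrow> (('f, 'a set) algebra \<Rightarrow> bool) \<Rightarrow> ('a set list set \<Rightarrow> ('f, 'b) algebra) \<Rightarrow>
     ('f, 'a) atom_structure \<Rightarrow> bool" where
  "strongly_representable sig K F S \<longleftrightarrow> (\<forall>A. has_atom_structure sig K S A \<longrightarrow> representable sig F A)"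


section \<open>Polyadic equality algebras and their reducts\<close>

datatype pea_op = Cyl nat | Diag nat nat | Repl nat nat | Transp nat nat

definition Df_sig :: "nat \<Rightarrow> pea_op signature" where
  "Df_sig n = {(Cyl i, 1) | i. i < n}"

definition diag_sig :: "nat \<Rightarrow> pea_op signature" where
  "diag_sig n = {(Diag i j, 0) | i j. i < n \<and> j < n}"

definition repl_sig :: "nat \<Rightarrow> pea_op signature" where
  "repl_sig n = {(Repl i j, 1) | i j. i < n \<and> j < n}"

definition transp_sig :: "nat \<Rightarrow> pea_op signature" where
  "transp_sig n = {(Transp i j, 1) | i j. i < n \<and> j < n}"

definition PEA_sig :: "nat \<Rightarrow> pea_op signature" where
  "PEA_sig n = Df_sig n \<union> diag_sig n \<union> repl_sig n \<union> transp_sig n"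

definition between_Df_PEA :: "nat \<Rightarrow> pea_op signature \<Rightarrow> bool" where
  "between_Df_PEA n t \<longleftrightarrow> (\<exists>Fs \<subseteq> {diag_sig n, repl_sig n, transp_sig n}. t = Df_sig n \<union> \<Union>Fs)"

abbreviation cyl :: "(pea_op, 'a) algebra \<Rightarrow> nat \<Rightarrow> 'a \<Rightarrow> 'a" where
  "cyl A i x \<equiv> oper A (Cyl i) [x]"

abbreviation diag :: "(pea_op, 'a) algebra \<Rightarrow> nat \<Rightarrow> nat \<Rightarrow> 'a" where
  "diag A i j \<equiv> oper A (Diag i j) []"

abbreviation repl :: "(pea_op, 'a) algebra \<Rightarrow> nat \<Rightarrow> nat \<Rightarrow> 'a \<Rightarrow> 'a" where
  "repl A i j x \<equiv> oper A (Repl i j) [x]"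

abbreviation transp :: "(pea_op, 'a) algebra \<Rightarrow> nat \<Rightarrow> nat \<Rightarrow> 'a \<Rightarrow> 'a" where
  "transp A i j x \<equiv> oper A (Transp i j) [x]"

text \<open>
  The axioms of Sain and Thompson for finitary polyadic equality algebras, in dimension \<open>n\<close>
  (for finite \<open>n\<close> these are the polyadic equality algebras of dimension \<open>n\<close>).
\<close>

definition PEA :: "nat \<Rightarrow> (pea_op, 'a) algebra \<Rightarrow> bool" where
  "PEA n A \<longleftrightarrow> boolean_alg A \<and> closed_under (PEA_sig n) A (elems A) \<and>
     (\<forall>x\<in>elems A. \<forall>y\<in>elems A. \<forall>i<n.
        below A x (cyl A i x) \<and>
        cyl A i (join A x y) = join A (cyl A i x) (cyl A i y) \<and>
        repl A i i x = x \<and> transp A i i x = x) \<and>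
     (\<forall>x\<in>elems A. \<forall>y\<in>elems A. \<forall>i<n. \<forall>j<n.
        transp A i j x = transp A j i x \<and>
        repl A i j (cyl A i x) = cyl A i x \<and>
        (i \<noteq> j \<longrightarrow> cyl A i (repl A i j x) = repl A i j x) \<and>
        repl A i j (join A x y) = join A (repl A i j x) (repl A i j y) \<and>
        repl A i j (neg A x) = neg A (repl A i j x) \<and>
        transp A i j (join A x y) = join A (transp A i j x) (transp A i j y) \<and>
        transp A i j (neg A x) = neg A (transp A i j x) \<and>
        transp A i j (transp A i j x) = x \<and>
        transp A i j (repl A i j x) = repl A j i x \<and>
        repl A i j (diag A i j) = bone A \<and>
        below A (meet A x (diag A i j)) (repl A i j x)) \<and>
     (\<forall>x\<in>elems A. \<forall>i<n. \<forall>j<n. \<forall>k<n. k \<noteq> i \<and> k \<noteq> j \<longrightarrow>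
        repl A i j (cyl A k x) = cyl A k (repl A i j x) \<and>
        (i \<noteq> j \<longrightarrow> transp A i j (transp A i k x) = transp A j k (transp A i j x)))"

text \<open>
  Sequences of length \<open>n\<close> over \<open>U\<close> are extensional functions on \<open>{..<n}\<close>.  For \<open>i, j < n\<close> the maps
  \<open>id(i := j)\<close> and \<open>transpose i j\<close> fix everything outside \<open>{..<n}\<close>, so composing with them
  preserves extensionality.
\<close>

abbreviation seqs :: "nat \<Rightarrow> 'u set \<Rightarrow> (nat \<Rightarrow> 'u) set" where
  "seqs n U \<equiv> {..<n} \<rightarrow>\<^sub>E U"

fun set_oper :: "nat \<Rightarrow> 'u set \<Rightarrow> pea_op \<Rightarrow> (nat \<Rightarrow> 'u) set list \<Rightarrow> (nat \<Rightarrow> 'u) set" where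
  "set_oper n U (Cyl i) [X] = {s\<in>seqs n U. \<exists>t\<in>X. \<forall>j<n. j \<noteq> i \<longrightarrow> t j = s j}"
| "set_oper n U (Diag i j) [] = {s\<in>seqs n U. s i = s j}"
| "set_oper n U (Repl i j) [X] = {s\<in>seqs n U. s \<circ> id(i := j) \<in> X}"
| "set_oper n U (Transp i j) [X] = {s\<in>seqs n U. s \<circ> Transposition.transpose i j \<in> X}"
| "set_oper n U _ _ = {}"

definition set_algebra :: "nat \<Rightarrow> 'u set \<Rightarrow> (pea_op, (nat \<Rightarrow> 'u) set) algebra" where
  "set_algebra n U =
     \<lparr> elems = Pow (seqs n U), join = (\<union>), meet = (\<inter>), neg = (\<lambda>X. seqs n U - X),
       bzero = {}, bone = seqs n U, oper = set_oper n U \<rparr>"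


section \<open>Relation algebras\<close>

datatype ra_op = Ident | Conv | Comp

definition RA_sig :: "ra_op signature" where
  "RA_sig = {(Ident, 0), (Conv, 1), (Comp, 2)}"

abbreviation ident :: "(ra_op, 'a) algebra \<Rightarrow> 'a" where
  "ident A \<equiv> oper A Ident []"

abbreviation rconv :: "(ra_op, 'a) algebra \<Rightarrow> 'a \<Rightarrow> 'a" where
  "rconv A x \<equiv> oper A Conv [x]"

abbreviation rcomp :: "(ra_op, 'a) algebra \<Rightarrow> 'a \<Rightarrow> 'a \<Rightarrow> 'a" where
  "rcomp A x y \<equiv> oper A Comp [x, y]"

definition RA :: "(ra_op, 'a) algebra \<Rightarrow> bool" where
  "RA A \<longleftrightarrow> boolean_alg A \<and> closed_under RA_sig A (elems A) \<and>
     (\<forall>x\<in>elems A. \<forall>y\<in>elems A. \<forall>z\<in>elems A.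
        rcomp A (rcomp A x y) z = rcomp A x (rcomp A y z) \<and>
        rcomp A (join A x y) z = join A (rcomp A x z) (rcomp A y z)) \<and>
     (\<forall>x\<in>elems A. \<forall>y\<in>elems A.
        rcomp A x (ident A) = x \<and>
        rconv A (rconv A x) = x \<and>
        rconv A (join A x y) = join A (rconv A x) (rconv A y) \<and>
        rconv A (rcomp A x y) = rcomp A (rconv A y) (rconv A x) \<and>
        below A (rcomp A (rconv A x) (neg A (rcomp A x y))) (neg A y))"

fun rel_oper :: "'u set \<Rightarrow> ra_op \<Rightarrow> 'u rel list \<Rightarrow> 'u rel" where
  "rel_oper U Ident [] = Id_on U"
| "rel_oper U Conv [X] = X\<inverse>"
| "rel_oper U Comp [X, Y] = X O Y"
| "rel_oper U _ _ = {}"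

definition rel_algebra :: "'u set \<Rightarrow> (ra_op, 'u rel) algebra" where
  "rel_algebra U =
     \<lparr> elems = Pow (U \<times> U), join = (\<union>), meet = (\<inter>), neg = (\<lambda>X. U \<times> U - X),
       bzero = {}, bone = U \<times> U, oper = rel_oper U \<rparr>"


section \<open>Basic matrices\<close>

definition basic_matrices :: "nat \<Rightarrow> (ra_op, 'a) algebra \<Rightarrow> (nat \<times> nat \<Rightarrow> 'a) set" where
  "basic_matrices n R =
     {f \<in> {..<n} \<times> {..<n} \<rightarrow>\<^sub>E atoms R.
        (\<forall>x<n. below R (f (x, x)) (ident R)) \<and>
        (\<forall>x<n. \<forall>y<n. f (y, x) = rconv R (f (x, y))) \<and>
        (\<forall>x<n. \<forall>y<n. \<forall>z<n. below R (f (x, z)) (rcomp R (f (x, y)) (f (y, z))))}"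

definition mat_comp :: "nat \<Rightarrow> (nat \<times> nat \<Rightarrow> 'a) \<Rightarrow> (nat \<Rightarrow> nat) \<Rightarrow> (nat \<times> nat \<Rightarrow> 'a)" where
  "mat_comp n f \<tau> = (\<lambda>(x, y) \<in> {..<n} \<times> {..<n}. f (\<tau> x, \<tau> y))"

definition agree_off :: "nat \<Rightarrow> nat set \<Rightarrow> (nat \<times> nat \<Rightarrow> 'a) \<Rightarrow> (nat \<times> nat \<Rightarrow> 'a) \<Rightarrow> bool" where
  "agree_off n Z f g \<longleftrightarrow> (\<forall>x<n. \<forall>y<n. x \<notin> Z \<and> y \<notin> Z \<longrightarrow> f (x, y) = g (x, y))"

fun mat_rel :: "nat \<Rightarrow> (ra_op, 'a) algebra \<Rightarrow> pea_op \<Rightarrow> (nat \<times> nat \<Rightarrow> 'a) \<Rightarrow> (nat \<times> nat \<Rightarrow> 'a) list \<Rightarrow> bool" where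
  "mat_rel n R (Cyl i) f [g] \<longleftrightarrow> agree_off n {i} f g"
| "mat_rel n R (Diag i j) f [] \<longleftrightarrow> below R (f (i, j)) (ident R)"
| "mat_rel n R (Repl i j) f [g] \<longleftrightarrow> mat_comp n f (id(i := j)) = g"
| "mat_rel n R (Transp i j) f [g] \<longleftrightarrow> mat_comp n f (Transposition.transpose i j) = g"
| "mat_rel n R _ f _ \<longleftrightarrow> False"

definition Mat :: "nat \<Rightarrow> (ra_op, 'a) algebra \<Rightarrow> (pea_op, nat \<times> nat \<Rightarrow> 'a) atom_structure" where
  "Mat n R = \<lparr> points = basic_matrices n R, rel = mat_rel n R \<rparr>"

definition cylindric_basis :: "nat \<Rightarrow> (ra_op, 'a) algebra \<Rightarrow> (nat \<times> nat \<Rightarrow> 'a) set \<Rightarrow> bool" where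
  "cylindric_basis n R M \<longleftrightarrow> M \<subseteq> basic_matrices n R \<and>
     (\<forall>a\<in>atoms R. \<exists>f\<in>M. f (0, 1) = a) \<and>
     (\<forall>f\<in>M. \<forall>x<n. \<forall>y<n. \<forall>z<n. \<forall>a\<in>atoms R. \<forall>b\<in>atoms R.
        below R (f (x, y)) (rcomp R a b) \<and> z \<noteq> x \<and> z \<noteq> y \<longrightarrow>
        (\<exists>g\<in>M. agree_off n {z} f g \<and> g (x, z) = a \<and> g (z, y) = b)) \<and>
     (\<forall>f\<in>M. \<forall>g\<in>M. \<forall>x<n. \<forall>y<n. agree_off n {x, y} f g \<longrightarrow>
        (\<exists>h\<in>M. agree_off n {x} h f \<and> agree_off n {y} h g))"

definition polyadic_equality_basis :: "nat \<Rightarrow> (ra_op, 'a) algebra \<Rightarrow> (nat \<times> nat \<Rightarrow> 'a) set \<Rightarrow> bool" where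
  "polyadic_equality_basis n R M \<longleftrightarrow> cylindric_basis n R M \<and>
     (\<forall>f\<in>M. \<forall>\<tau> \<in> {..<n} \<rightarrow> {..<n}. mat_comp n f \<tau> \<in> M)"


section \<open>The index and base types of a representation\<close>

lemma skolem_closure:
  fixes w :: "'p \<Rightarrow> 'u list \<Rightarrow> 'u" and P :: "'p set" and V0 :: "'u set" and L :: "'l set"
  assumes inf: "infinite L" and P: "P \<lesssim> L" and V0: "V0 \<lesssim> L"
  obtains V where "V0 \<subseteq> V" "V \<lesssim> L" "\<And>p us. p \<in> P \<Longrightarrow> us \<in> lists V \<Longrightarrow> w p us \<in> V"
proof -
  have LL: "L \<times> L \<lesssim> L"
    using card_of_Times_same_infinite[OF inf] eqpoll_iff_card_of_ordIso eqpoll_imp_lepoll by blast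
  have natL: "(UNIV :: nat set) \<lesssim> L" using inf infinite_le_lepoll by blast
  have prod: "A \<times> B \<lesssim> L" if "A \<lesssim> L" "B \<lesssim> L" for A :: "'x set" and B :: "'y set"
    using times_lepoll_mono[OF that] LL lepoll_trans by blast
  have UN: "(\<Union>k. A k) \<lesssim> L" if A: "\<And>k :: nat. A k \<lesssim> L" for A :: "nat \<Rightarrow> 'x set"
  proof -
    have "(\<Union>k. A k) \<lesssim> Sigma UNIV A" using subset_image_lepoll[of "\<Union>k. A k" snd "Sigma UNIV A"] by force
    also have "\<dots> \<lesssim> (UNIV :: nat set) \<times> L" by (intro Sigma_lepoll_mono) (use A in auto)
    also have "\<dots> \<lesssim> L" by (intro prod natL) simp
    finally show ?thesis .
  qed
  have lists_n: "{xs \<in> lists V. length xs = k} \<lesssim> L" if "V \<lesssim> L" for V :: "'u set" and k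
  proof (induction k)
    case 0
    have "{xs \<in> lists V. length xs = 0} = {[]}" by auto
    then show ?case using inf by (metis finite_lepoll_infinite finite.intros)
  next
    case (Suc k)
    have "{xs \<in> lists V. length xs = Suc k} \<subseteq> (\<lambda>(x, xs). x # xs) ` (V \<times> {xs \<in> lists V. length xs = k})"
      by (auto simp: length_Suc_conv image_iff)
    then have "{xs \<in> lists V. length xs = Suc k} \<lesssim> V \<times> {xs \<in> lists V. length xs = k}"
      by (rule subset_image_lepoll)
    then show ?case using prod[OF that Suc] lepoll_trans by blast
  qed
  have lists: "lists V \<lesssim> L" if "V \<lesssim> L" for V :: "'u set"
  proof -
    have "lists V = (\<Union>k. {xs \<in> lists V. length xs = k})" by auto
    also have "\<dots> \<lesssim> L" by (intro UN lists_n that)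
    finally show ?thesis .
  qed
  define step where "step V = V \<union> (\<lambda>(p, us). w p us) ` (P \<times> lists V)" for V
  have step: "step V \<lesssim> L" if V: "V \<lesssim> L" for V
  proof -
    have "step V \<subseteq> (\<Union>k :: nat. if k = 0 then V else (\<lambda>(p, us). w p us) ` (P \<times> lists V))"
      unfolding step_def by (auto intro!: exI[of _ "1::nat"] split: if_splits)
    moreover have "(\<Union>k :: nat. if k = 0 then V else (\<lambda>(p, us). w p us) ` (P \<times> lists V)) \<lesssim> L"
    proof (rule UN)
      fix k :: nat
      have "(\<lambda>(p, us). w p us) ` (P \<times> lists V) \<lesssim> L"
        by (rule lepoll_trans[OF image_lepoll prod[OF P lists[OF V]]])
      then show "(if k = 0 then V else (\<lambda>(p, us). w p us) ` (P \<times> lists V)) \<lesssim> L" using V by simp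
    qed
    ultimately show ?thesis using subset_imp_lepoll lepoll_trans by blast
  qed
  define W where "W k = (step ^^ k) V0" for k
  have W: "W k \<lesssim> L" for k unfolding W_def by (induction k) (auto simp: V0 step)
  have mono: "W k \<subseteq> W m" if "k \<le> m" for k m
    by (rule lift_Suc_mono_le[of W, OF _ that]) (auto simp: W_def step_def)
  show thesis
  proof
    show "V0 \<subseteq> (\<Union>k. W k)" using W_def[of 0] by auto
    show "(\<Union>k. W k) \<lesssim> L" by (rule UN) (rule W)
    fix p us assume p: "p \<in> P" and "us \<in> lists (\<Union>k. W k)"
    then have "\<exists>k. us \<in> lists (W k)"
    proof (induction us)
      case (Cons u us)
      then obtain k m where "us \<in> lists (W k)" "u \<in> W m" by auto
      then have "u # us \<in> lists (W (max k m))"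
        using mono[of k "max k m"] mono[of m "max k m"] by auto
      then show ?case by blast
    qed auto
    then obtain k where "us \<in> lists (W k)" ..
    then have "w p us \<in> W (Suc k)" using p by (auto simp: W_def step_def)
    then show "w p us \<in> (\<Union>k. W k)" by blast
  qed
qed


lemma homomorphism_image:
  assumes X: "closed_under sig P X" and g: "homomorphism sig g (P\<lparr>elems := X\<rparr>) Q"
  shows "closed_under sig Q (g ` X)" "homomorphism sig g (P\<lparr>elems := X\<rparr>) (Q\<lparr>elems := g ` X\<rparr>)"
proof -
  have g': "\<And>x. x \<in> X \<Longrightarrow> g x \<in> elems Q" "bzero Q = g (bzero P)" "bone Q = g (bone P)"
    "\<And>x y. x \<in> X \<Longrightarrow> y \<in> X \<Longrightarrow> join Q (g x) (g y) = g (join P x y)"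
    "\<And>x y. x \<in> X \<Longrightarrow> y \<in> X \<Longrightarrow> meet Q (g x) (g y) = g (meet P x y)"
    "\<And>x. x \<in> X \<Longrightarrow> neg Q (g x) = g (neg P x)"
    "\<And>f xs. (f, length xs) \<in> sig \<Longrightarrow> set xs \<subseteq> X \<Longrightarrow> oper Q f (map g xs) = g (oper P f xs)"
    using g by (auto simp: homomorphism_def)
  have X': "bzero P \<in> X" "bone P \<in> X" "\<And>x y. x \<in> X \<Longrightarrow> y \<in> X \<Longrightarrow> join P x y \<in> X"
    "\<And>x y. x \<in> X \<Longrightarrow> y \<in> X \<Longrightarrow> meet P x y \<in> X" "\<And>x. x \<in> X \<Longrightarrow> neg P x \<in> X"
    "\<And>f xs. (f, length xs) \<in> sig \<Longrightarrow> set xs \<subseteq> X \<Longrightarrow> oper P f xs \<in> X"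
    using X by (auto simp: closed_under_def)
  have op: "oper Q f xs \<in> g ` X" if "(f, length xs) \<in> sig" "set xs \<subseteq> g ` X" for f xs
  proof -
    have "xs \<in> map g ` lists X" using that(2) by (simp add: lists_image[symmetric] in_lists_conv_set subset_iff)
    then obtain ys where ys: "xs = map g ys" "set ys \<subseteq> X" by auto
    then show ?thesis using \<open>(f, length xs) \<in> sig\<close> g'(7)[of f ys] X'(6)[of f ys] by auto
  qed
  show "closed_under sig Q (g ` X)"
    unfolding closed_under_def using op by (auto simp: g' X')
  show "homomorphism sig g (P\<lparr>elems := X\<rparr>) (Q\<lparr>elems := g ` X\<rparr>)"
    using g unfolding homomorphism_def by simp
qed

lemma representable_transfer:
  fixes F :: "'u set \<Rightarrow> ('f, 'b) algebra" and F' :: "'a list set \<Rightarrow> ('f, 'c) algebra"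
    and A :: "('f, 'a) algebra" and I :: "'i set"
  assumes A: "in_product sig F A I U"
    and sep: "\<And>U x y. x \<in> elems (F U) \<Longrightarrow> y \<in> elems (F U) \<Longrightarrow> x \<noteq> y \<Longrightarrow>
      meet (F U) x (neg (F U) y) \<noteq> bzero (F U) \<or> meet (F U) y (neg (F U) x) \<noteq> bzero (F U)"
    and sep': "\<And>U x. x \<in> elems (F' U) \<Longrightarrow> meet (F' U) x (neg (F' U) x) = bzero (F' U)"
    and red: "\<And>U Y z. closed_under sig (F U) Y \<Longrightarrow> Y \<lesssim> (UNIV :: 'a set) \<Longrightarrow> z \<in> Y \<Longrightarrow> z \<noteq> bzero (F U) \<Longrightarrow>
      \<exists>U' g. homomorphism sig g ((F U)\<lparr>elems := Y\<rparr>) (F' U') \<and> g z \<noteq> bzero (F' U')"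
  shows "representable sig F' A"
proof -
  define P where "P = direct_product I (\<lambda>i. F (U i))"
  obtain X h where X: "closed_under sig P X" and h: "homomorphism sig h A (P\<lparr>elems := X\<rparr>)"
    and bij: "bij_betw h (elems A) X"
    using A by (auto simp: in_product_def subalgebra_def isomorphic_def P_def)
  have hX: "h ` elems A = X" using bij by (simp add: bij_betw_def)
  have XP: "x i \<in> elems (F (U i))" if "x \<in> X" "i \<in> I" for x i
    using X that by (auto simp: closed_under_def P_def direct_product_def)
  define J where "J = {a \<in> elems A. \<exists>i\<in>I. h a i \<noteq> bzero (F (U i))}"
  define ii where "ii a = (SOME i. i \<in> I \<and> h a i \<noteq> bzero (F (U i)))" for a
  have ii: "ii a \<in> I" "h a (ii a) \<noteq> bzero (F (U (ii a)))" if "a \<in> J" for a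
    using that someI_ex[of "\<lambda>i. i \<in> I \<and> h a i \<noteq> bzero (F (U i))"] by (auto simp: J_def ii_def)
  define Y where "Y a = (\<lambda>x. x (ii a)) ` X" for a
  have "\<exists>U' g. homomorphism sig g ((F (U (ii a)))\<lparr>elems := Y a\<rparr>) (F' U') \<and> g (h a (ii a)) \<noteq> bzero (F' U')"
    if a: "a \<in> J" for a
  proof (rule red)
    have "homomorphism sig (\<lambda>x. x (ii a)) (P\<lparr>elems := X\<rparr>) (F (U (ii a)))"
      using ii[OF a] XP by (auto simp: homomorphism_def P_def direct_product_def)
    then show "closed_under sig (F (U (ii a))) (Y a)"
      unfolding Y_def by (rule homomorphism_image[OF X])
    have "Y a \<subseteq> (\<lambda>b. h b (ii a)) ` UNIV" unfolding Y_def hX[symmetric] by auto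
    then show "Y a \<lesssim> (UNIV :: 'a set)" by (rule subset_image_lepoll)
    show "h a (ii a) \<in> Y a" using a hX by (auto simp: Y_def J_def)
  qed (use ii a in auto)
  then obtain U' g where g: "\<And>a. a \<in> J \<Longrightarrow> homomorphism sig (g a) ((F (U (ii a)))\<lparr>elems := Y a\<rparr>) (F' (U' a))"
    and gz: "\<And>a. a \<in> J \<Longrightarrow> g a (h a (ii a)) \<noteq> bzero (F' (U' a))"
    by metis
  define Q where "Q = direct_product J (\<lambda>a. F' (U' a))"
  define G where "G x = (\<lambda>a\<in>J. g a (x (ii a)))" for x
  have G: "homomorphism sig G (P\<lparr>elems := X\<rparr>) Q"
  proof -
    have *: "x (ii a) \<in> Y a" if "x \<in> X" for x a using that by (auto simp: Y_def)
    have op: "G (oper P f xs) = oper Q f (map G xs)" if fx: "(f, length xs) \<in> sig" "set xs \<subseteq> X" for f xs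
    proof -
      have "g a (oper P f xs (ii a)) = oper (F' (U' a)) f (map (\<lambda>x. x a) (map G xs))" if a: "a \<in> J" for a
      proof -
        let ?ys = "map (\<lambda>x. x (ii a)) xs"
        have ys: "set ?ys \<subseteq> Y a" "(f, length ?ys) \<in> sig" using fx * by auto
        have "g a (oper P f xs (ii a)) = g a (oper (F (U (ii a))) f ?ys)"
          using ii[OF a] by (simp add: P_def direct_product_def)
        also have "\<dots> = oper (F' (U' a)) f (map (g a) ?ys)"
          using g[OF a] ys unfolding homomorphism_def by fastforce
        also have "map (g a) ?ys = map (\<lambda>x. x a) (map G xs)" using a by (simp add: G_def)
        finally show ?thesis .
      qed
      then show ?thesis unfolding G_def Q_def direct_product_def by auto
    qed
    show ?thesis
      unfolding homomorphism_def
    proof (intro conjI ballI)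
      show "G \<in> elems (P\<lparr>elems := X\<rparr>) \<rightarrow> elems Q"
        using g * by (auto simp: G_def Q_def direct_product_def homomorphism_def Pi_iff)
      show "G (bzero (P\<lparr>elems := X\<rparr>)) = bzero Q" "G (bone (P\<lparr>elems := X\<rparr>)) = bone Q"
        using g ii by (auto simp: G_def P_def Q_def direct_product_def homomorphism_def intro!: restrict_ext)
      fix x y assume "x \<in> elems (P\<lparr>elems := X\<rparr>)" "y \<in> elems (P\<lparr>elems := X\<rparr>)"
      then show "G (join (P\<lparr>elems := X\<rparr>) x y) = join Q (G x) (G y)"
        "G (meet (P\<lparr>elems := X\<rparr>) x y) = meet Q (G x) (G y)"
        using g ii * by (auto simp: G_def P_def Q_def direct_product_def homomorphism_def intro!: restrict_ext)
    next
      fix x assume "x \<in> elems (P\<lparr>elems := X\<rparr>)"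
      then show "G (neg (P\<lparr>elems := X\<rparr>) x) = neg Q (G x)"
        using g ii * by (auto simp: G_def P_def Q_def direct_product_def homomorphism_def intro!: restrict_ext)
    qed (use op in auto)
  qed
  have X': "meet P x y \<in> X" "neg P x \<in> X" if "x \<in> X" "y \<in> X" for x y
    using X that by (auto simp: closed_under_def)
  have inj1: "G x \<noteq> G y" if x: "x \<in> X" and y: "y \<in> X" and i: "i \<in> I"
    and xy: "meet (F (U i)) (x i) (neg (F (U i)) (y i)) \<noteq> bzero (F (U i))" for x y i
  proof
    assume eq: "G x = G y"
    define w where "w = meet P x (neg P y)"
    have w: "w \<in> X" unfolding w_def using x y X' by blast
    then obtain a where a: "a \<in> elems A" "h a = w" using hX by auto
    have "w i \<noteq> bzero (F (U i))" using i xy by (simp add: w_def P_def direct_product_def)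
    then have "a \<in> J" using a i by (auto simp: J_def)
    then have "G w a \<noteq> bzero (F' (U' a))" using gz[of a] a by (simp add: G_def)
    moreover have "G w = meet Q (G y) (neg Q (G y))"
      using G x y X' eq unfolding w_def homomorphism_def by simp
    then have "G w a = bzero (F' (U' a))"
      using G y \<open>a \<in> J\<close> sep' by (auto simp: homomorphism_def Q_def direct_product_def Pi_iff)
    ultimately show False by simp
  qed
  have inj: "inj_on G X"
  proof (rule inj_onI, rule ccontr)
    fix x y assume xy: "x \<in> X" "y \<in> X" "G x = G y" "x \<noteq> y"
    have "X \<subseteq> (\<Pi>\<^sub>E i\<in>I. elems (F (U i)))"
      using X unfolding closed_under_def P_def direct_product_def by simp
    then have "x \<in> (\<Pi>\<^sub>E i\<in>I. elems (F (U i)))" "y \<in> (\<Pi>\<^sub>E i\<in>I. elems (F (U i)))"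
      using xy by blast+
    then obtain i where i: "i \<in> I" "x i \<noteq> y i" using \<open>x \<noteq> y\<close> PiE_ext by blast
    then show False
      using sep[OF XP[OF xy(1)] XP[OF xy(2)]] inj1 xy by metis
  qed
  have hom2: "closed_under sig Q (G ` X)" "homomorphism sig G (P\<lparr>elems := X\<rparr>) (Q\<lparr>elems := G ` X\<rparr>)"
    using homomorphism_image[OF X G] by auto
  have "homomorphism sig (G \<circ> h) A (Q\<lparr>elems := G ` X\<rparr>)"
  proof -
    have "G (h (oper A f xs)) = oper Q f (map (G \<circ> h) xs)"
      if "(f, length xs) \<in> sig" "set xs \<subseteq> elems A" for f xs
    proof -
      have "set (map h xs) \<subseteq> X" using that hX by auto
      then have "G (oper P f (map h xs)) = oper Q f (map G (map h xs))"
        using G that(1) unfolding homomorphism_def by auto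
      moreover have "h (oper A f xs) = oper P f (map h xs)"
        using h that unfolding homomorphism_def by auto
      ultimately show ?thesis by simp
    qed
    moreover have "h x \<in> X" if "x \<in> elems A" for x using that hX by blast
    ultimately show ?thesis using h G unfolding homomorphism_def by (auto simp: Pi_iff)
  qed
  moreover have "bij_betw (G \<circ> h) (elems A) (elems (Q\<lparr>elems := G ` X\<rparr>))"
    using bij_betw_trans[OF bij inj_on_imp_bij_betw[OF inj]] by simp
  ultimately have "in_product sig F' A J U'"
    unfolding in_product_def isomorphic_def subalgebra_def Q_def[symmetric]
    using hom2 by blast
  then show ?thesis unfolding representable_def by blast
qed

text \<open>Representations over arbitrary index sets and bases give representations in the sense of
  \<open>representable\<close>, by a downward Loewenheim-Skolem argument.\<close>

theorem representable_set_algebraI: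
  fixes A :: "(pea_op, 'a) algebra" and I :: "'i set" and U :: "'i \<Rightarrow> 'u set"
  assumes sig: "sig \<subseteq> PEA_sig n" and A: "in_product sig (set_algebra n) A I U"
  shows "representable sig (set_algebra n) A"
proof (rule representable_transfer[OF A])
  fix U :: "'u set" and Y z
  assume Y: "closed_under sig (set_algebra n U) Y" "Y \<lesssim> (UNIV :: 'a set)"
    and z: "z \<in> Y" "z \<noteq> bzero (set_algebra n U)"
  have YU: "X \<subseteq> seqs n U" if "X \<in> Y" for X
    using Y that by (auto simp: closed_under_def set_algebra_def)
  obtain s0 where s0: "s0 \<in> z" using z by (auto simp: set_algebra_def)
  have s0U: "s0 \<in> seqs n U" using YU z s0 by auto
  define w where "w = (\<lambda>(X :: (nat \<Rightarrow> 'u) set, i :: nat) us. SOME u. (\<lambda>k\<in>{..<n}. if k = i then u else us ! k) \<in> X)"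
  have inf: "infinite (UNIV :: 'a list set)" by (rule infinite_UNIV_listI)
  have "Y \<lesssim> (UNIV :: 'a list set)"
    using Y(2) by (rule lepoll_trans) (auto simp: lepoll_def inj_on_def intro!: exI[of _ "\<lambda>x. [x]"])
  moreover have "{..<n} \<lesssim> (UNIV :: 'a list set)" using inf by (simp add: finite_lepoll_infinite)
  moreover have "(UNIV :: 'a list set) \<times> (UNIV :: 'a list set) \<lesssim> (UNIV :: 'a list set)"
    using card_of_Times_same_infinite[OF inf] eqpoll_iff_card_of_ordIso eqpoll_imp_lepoll by blast
  ultimately have "Y \<times> {..<n} \<lesssim> (UNIV :: 'a list set)"
    using times_lepoll_mono lepoll_trans by blast
  moreover have "s0 ` {..<n} \<lesssim> (UNIV :: 'a list set)" using inf by (simp add: finite_lepoll_infinite)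
  ultimately obtain V where V: "s0 ` {..<n} \<subseteq> V" "V \<lesssim> (UNIV :: 'a list set)"
    "\<And>p us. p \<in> Y \<times> {..<n} \<Longrightarrow> us \<in> lists V \<Longrightarrow> w p us \<in> V"
    using skolem_closure[OF inf, of "Y \<times> {..<n}" "s0 ` {..<n}" w] by blast
  define V' where "V' = V \<inter> U"
  have V': "s0 \<in> seqs n V'" using V(1) s0U by (auto simp: V'_def PiE_iff)
  have wit: "\<exists>u\<in>V'. s(i := u) \<in> X"
    if X: "X \<in> Y" and s: "s \<in> seqs n V'" and i: "i < n" and t: "t \<in> X" "\<And>j. j < n \<Longrightarrow> j \<noteq> i \<Longrightarrow> t j = s j"
    for X s i t
  proof -
    let ?us = "map s [0..<n]"
    have upd: "(\<lambda>k\<in>{..<n}. if k = i then u else ?us ! k) = s(i := u)" for u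
      using s i by (auto simp: fun_eq_iff PiE_iff extensional_def restrict_def)
    have "s(i := t i) = t"
    proof
      fix k
      have "t \<in> seqs n U" using t(1) YU[OF X] by blast
      then show "(s(i := t i)) k = t k" using t(2)[of k] s i
        by (cases "k < n") (auto simp: PiE_iff extensional_def)
    qed
    then have "s(i := t i) \<in> X" using t by simp
    then have "s(i := w (X, i) ?us) \<in> X"
      unfolding w_def prod.case upd by (rule someI)
    moreover from this have "w (X, i) ?us \<in> U"
      using YU[OF X] i by (force simp: PiE_iff subset_iff)
    moreover have "w (X, i) ?us \<in> V"
      using X i s by (intro V(3)) (auto simp: V'_def PiE_iff)
    ultimately show ?thesis by (auto simp: V'_def)
  qed
  have "V' \<lesssim> (UNIV :: 'a list set)"
    using V(2) lepoll_trans subset_imp_lepoll[of V' V] by (auto simp: V'_def)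
  then obtain e :: "'u \<Rightarrow> 'a list" where e: "inj_on e V'" by (auto simp: lepoll_def)
  define d where "d = inv_into V' e"
  define U' where "U' = e ` V'"
  have d: "d \<in> U' \<rightarrow> V'" "\<And>v. v \<in> V' \<Longrightarrow> d (e v) = v" "\<And>x. x \<in> U' \<Longrightarrow> e (d x) = x"
    "\<And>v. v \<in> V' \<Longrightarrow> e v \<in> U'"
    using e by (auto simp: d_def U'_def)
  define D where "D s = (\<lambda>k\<in>{..<n}. d (s k))" for s
  define g where "g X = {s \<in> seqs n U'. D s \<in> X}" for X
  have D: "D s \<in> seqs n V'" "D s \<in> seqs n U" if "s \<in> seqs n U'" for s
    using that d(1) by (auto simp: D_def PiE_iff V'_def)
  have D_upd: "D (s \<circ> \<tau>) = D s \<circ> \<tau>" if "\<And>k. k < n \<Longrightarrow> \<tau> k < n" "\<And>k. \<not> k < n \<Longrightarrow> \<tau> k = k" for s \<tau>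
    using that by (auto simp: D_def fun_eq_iff restrict_def)
  have comp: "s \<circ> \<tau> \<in> seqs n U'" if "s \<in> seqs n U'" "\<And>k. k < n \<Longrightarrow> \<tau> k < n" "\<And>k. \<not> k < n \<Longrightarrow> \<tau> k = k" for s \<tau>
    using that by (auto simp: PiE_iff extensional_def)
  have op: "g (set_oper n U f Xs) = set_oper n U' f (map g Xs)"
    if f: "(f, length Xs) \<in> sig" "set Xs \<subseteq> Y" for f Xs
  proof -
    have "(f, length Xs) \<in> PEA_sig n" using f sig by auto
    then consider (c) i X where "f = Cyl i" "Xs = [X]" "i < n"
      | (d) i j where "f = Diag i j" "Xs = []" "i < n" "j < n"
      | (r) i j X where "f = Repl i j" "Xs = [X]" "i < n" "j < n"
      | (t) i j X where "f = Transp i j" "Xs = [X]" "i < n" "j < n"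
      by (auto simp: PEA_sig_def Df_sig_def diag_sig_def repl_sig_def transp_sig_def length_Suc_conv)
    then show ?thesis
    proof cases
      case c
      have "X \<in> Y" using c f by auto
      have "(\<exists>t\<in>X. \<forall>j<n. j \<noteq> i \<longrightarrow> t j = D s j) \<longleftrightarrow> (\<exists>t\<in>g X. \<forall>j<n. j \<noteq> i \<longrightarrow> t j = s j)"
        (is "?l \<longleftrightarrow> ?r") if s: "s \<in> seqs n U'" for s
      proof
        assume ?l
        then obtain u where u: "u \<in> V'" "(D s)(i := u) \<in> X"
          using wit[OF \<open>X \<in> Y\<close> D(1)[OF s] \<open>i < n\<close>] by blast
        have "D (s(i := e u)) = (D s)(i := u)"
          using u(1) d c by (auto simp: D_def fun_eq_iff restrict_def)
        moreover have "s(i := e u) \<in> seqs n U'"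
          using s u(1) d c by (auto simp: PiE_iff extensional_def)
        ultimately have "s(i := e u) \<in> g X" using u by (simp add: g_def)
        then show ?r by (intro bexI[of _ "s(i := e u)"]) auto
      next
        assume ?r
        then obtain t where "t \<in> g X" "\<forall>j<n. j \<noteq> i \<longrightarrow> t j = s j" by blast
        then show ?l by (intro bexI[of _ "D t"]) (auto simp: g_def D_def)
      qed
      then show ?thesis
        unfolding c g_def[of "set_oper n U (Cyl i) [X]"] using D(2)
        by (simp del: PiE_iff cong: conj_cong)
    next
      case d': d
      have "d x = d y \<longleftrightarrow> x = y" if "x \<in> U'" "y \<in> U'" for x y using d(3) that by metis
      then show ?thesis using d' D by (auto simp: g_def PiE_iff D_def)
    next
      case r
      then show ?thesis using D by (auto simp: g_def D_upd comp)
    next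
      case t
      have "\<And>k. k < n \<Longrightarrow> Transposition.transpose i j k < n" "\<And>k. \<not> k < n \<Longrightarrow> Transposition.transpose i j k = k"
        using t by (auto simp: Transposition.transpose_def)
      then have "D (s \<circ> Transposition.transpose i j) = D s \<circ> Transposition.transpose i j"
        "s \<in> seqs n U' \<Longrightarrow> s \<circ> Transposition.transpose i j \<in> seqs n U'" for s
        using D_upd[of "Transposition.transpose i j"] comp[of _ "Transposition.transpose i j"] by blast+
      then show ?thesis using t D by (auto simp: g_def del: PiE_I)
    qed
  qed
  have "homomorphism sig g ((set_algebra n U)\<lparr>elems := Y\<rparr>) (set_algebra n U')"
  proof -
    have "g X \<subseteq> seqs n U'" "g {} = {}" "g (seqs n U) = seqs n U'" "g (X \<union> X') = g X \<union> g X'"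
      "g (X \<inter> X') = g X \<inter> g X'" "g (seqs n U - X) = seqs n U' - g X" for X X'
      using D(2) by (auto simp: g_def del: PiE_I)
    then show ?thesis
      unfolding homomorphism_def using op by (auto simp: set_algebra_def del: PiE_I)
  qed
  moreover have "(\<lambda>k\<in>{..<n}. e (s0 k)) \<in> g z"
  proof -
    have "D (\<lambda>k\<in>{..<n}. e (s0 k)) = s0"
      using V' d by (auto simp: D_def fun_eq_iff restrict_def PiE_iff extensional_def)
    then show ?thesis using V' d s0 by (auto simp: g_def PiE_iff)
  qed
  ultimately show "\<exists>U' g. homomorphism sig g ((set_algebra n U)\<lparr>elems := Y\<rparr>) (set_algebra n U') \<and>
      g z \<noteq> bzero (set_algebra n (U' :: 'a list set))"
    by (intro exI[of _ U'] exI[of _ g]) (auto simp: set_algebra_def)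
qed (auto simp: set_algebra_def)

theorem representable_rel_algebraI:
  fixes A :: "(ra_op, 'a) algebra" and I :: "'i set" and U :: "'i \<Rightarrow> 'u set"
  assumes sig: "sig \<subseteq> RA_sig" and A: "in_product sig rel_algebra A I U"
  shows "representable sig rel_algebra A"
proof (rule representable_transfer[OF A])
  fix U :: "'u set" and Y z
  assume Y: "closed_under sig (rel_algebra U) Y" "Y \<lesssim> (UNIV :: 'a set)"
    and z: "z \<in> Y" "z \<noteq> bzero (rel_algebra U)"
  have YU: "X \<subseteq> U \<times> U" if "X \<in> Y" for X
    using Y that by (auto simp: closed_under_def rel_algebra_def)
  obtain x0 y0 where s0: "(x0, y0) \<in> z" using z by (auto simp: rel_algebra_def)
  define w where "w = (\<lambda>(X :: 'u rel, X' :: 'u rel) us. SOME u. (us ! 0, u) \<in> X \<and> (u, us ! 1) \<in> X')"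
  have inf: "infinite (UNIV :: 'a list set)" by (rule infinite_UNIV_listI)
  have "Y \<lesssim> (UNIV :: 'a list set)"
    using Y(2) by (rule lepoll_trans) (auto simp: lepoll_def inj_on_def intro!: exI[of _ "\<lambda>x. [x]"])
  moreover have "(UNIV :: 'a list set) \<times> (UNIV :: 'a list set) \<lesssim> (UNIV :: 'a list set)"
    using card_of_Times_same_infinite[OF inf] eqpoll_iff_card_of_ordIso eqpoll_imp_lepoll by blast
  ultimately have "Y \<times> Y \<lesssim> (UNIV :: 'a list set)"
    using times_lepoll_mono lepoll_trans by blast
  moreover have "{x0, y0} \<lesssim> (UNIV :: 'a list set)" using inf by (simp add: finite_lepoll_infinite)
  ultimately obtain V where V: "{x0, y0} \<subseteq> V" "V \<lesssim> (UNIV :: 'a list set)"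
    "\<And>p us. p \<in> Y \<times> Y \<Longrightarrow> us \<in> lists V \<Longrightarrow> w p us \<in> V"
    using skolem_closure[OF inf, of "Y \<times> Y" "{x0, y0}" w] by blast
  define V' where "V' = V \<inter> U"
  have V': "x0 \<in> V'" "y0 \<in> V'" using V(1) YU[OF z(1)] s0 by (auto simp: V'_def)
  have wit: "\<exists>u\<in>V'. (x, u) \<in> X \<and> (u, y) \<in> X'"
    if X: "X \<in> Y" "X' \<in> Y" and xy: "x \<in> V'" "y \<in> V'" and u: "(x, u) \<in> X" "(u, y) \<in> X'" for X X' x y u
  proof -
    have "(x, w (X, X') [x, y]) \<in> X \<and> (w (X, X') [x, y], y) \<in> X'"
      unfolding w_def using someI[of "\<lambda>u. (x, u) \<in> X \<and> (u, y) \<in> X'" u] u by simp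
    moreover have "w (X, X') [x, y] \<in> V"
      using V(3)[of "(X, X')" "[x, y]"] X xy by (simp add: V'_def)
    ultimately show ?thesis using YU[OF X(1)] by (auto simp: V'_def)
  qed
  have "V' \<lesssim> (UNIV :: 'a list set)"
    using V(2) lepoll_trans subset_imp_lepoll[of V' V] by (auto simp: V'_def)
  then obtain e :: "'u \<Rightarrow> 'a list" where e: "inj_on e V'" by (auto simp: lepoll_def)
  define d where "d = inv_into V' e"
  define U' where "U' = e ` V'"
  have d: "\<And>x. x \<in> U' \<Longrightarrow> d x \<in> V'" "\<And>v. v \<in> V' \<Longrightarrow> d (e v) = v" "\<And>x. x \<in> U' \<Longrightarrow> e (d x) = x"
    "\<And>v. v \<in> V' \<Longrightarrow> e v \<in> U'"
    using e by (auto simp: d_def U'_def)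
  have dU: "d x \<in> U" if "x \<in> U'" for x using d(1)[OF that] by (simp add: V'_def)
  define g where "g X = {(x, y). x \<in> U' \<and> y \<in> U' \<and> (d x, d y) \<in> X}" for X
  have op: "g (rel_oper U f Xs) = rel_oper U' f (map g Xs)"
    if f: "(f, length Xs) \<in> sig" "set Xs \<subseteq> Y" for f Xs
  proof -
    have "(f, length Xs) \<in> RA_sig" using f sig by auto
    then consider (i) "f = Ident" "Xs = []" | (c) X where "f = Conv" "Xs = [X]"
      | (m) X X' where "f = Comp" "Xs = [X, X']"
      by (auto simp: RA_sig_def length_Suc_conv numeral_2_eq_2)
    then show ?thesis
    proof cases
      case i
      have "d x = d y \<longleftrightarrow> x = y" if "x \<in> U'" "y \<in> U'" for x y using d(3) that by metis
      then show ?thesis using i dU by (auto simp: g_def)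
    next
      case c
      then show ?thesis by (auto simp: g_def)
    next
      case m
      have X: "X \<in> Y" "X' \<in> Y" using m f by auto
      have "(\<exists>u. (d x, u) \<in> X \<and> (u, d y) \<in> X') \<longleftrightarrow> (\<exists>v. (x, v) \<in> g X \<and> (v, y) \<in> g X')"
        if xy: "x \<in> U'" "y \<in> U'" for x y
      proof
        assume "\<exists>u. (d x, u) \<in> X \<and> (u, d y) \<in> X'"
        then obtain u where "u \<in> V'" "(d x, u) \<in> X" "(u, d y) \<in> X'" using wit X d(1) xy by metis
        then show "\<exists>v. (x, v) \<in> g X \<and> (v, y) \<in> g X'"
          using xy d by (intro exI[of _ "e u"]) (auto simp: g_def)
      qed (auto simp: g_def)
      moreover have "g (X O X') = {(x, y). x \<in> U' \<and> y \<in> U' \<and> (\<exists>u. (d x, u) \<in> X \<and> (u, d y) \<in> X')}"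
        by (auto simp: g_def)
      moreover have "g X O g X' = {(x, y). x \<in> U' \<and> y \<in> U' \<and> (\<exists>v. (x, v) \<in> g X \<and> (v, y) \<in> g X')}"
        by (auto simp: g_def)
      ultimately show ?thesis using m by auto
    qed
  qed
  have "homomorphism sig g ((rel_algebra U)\<lparr>elems := Y\<rparr>) (rel_algebra U')"
  proof -
    have "g X \<subseteq> U' \<times> U'" "g {} = {}" "g (U \<times> U) = U' \<times> U'" "g (X \<union> X') = g X \<union> g X'"
      "g (X \<inter> X') = g X \<inter> g X'" "g (U \<times> U - X) = U' \<times> U' - g X" for X X'
      using dU by (auto simp: g_def)
    then show ?thesis
      unfolding homomorphism_def using op by (auto simp: rel_algebra_def Pi_iff)
  qed
  moreover have "(e x0, e y0) \<in> g z" using V' d s0 by (auto simp: g_def)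
  ultimately show "\<exists>U' g. homomorphism sig g ((rel_algebra U)\<lparr>elems := Y\<rparr>) (rel_algebra U') \<and>
      g z \<noteq> bzero (rel_algebra (U' :: 'a list set))"
    by (intro exI[of _ U'] exI[of _ g]) (auto simp: rel_algebra_def)
qed (auto simp: rel_algebra_def)

end

(*
A label is the identity, or it carries one of n colours, a clique, and one of n^2 vertices of that
clique; a monochromatic triangle is consistent only if two of its labels are different vertices of
the same clique.  The labels of one colour and one vertex number are thus independent, and finitely
many such sets cover everything; in the complex algebra these sets are elements, so Ramsey's theorem
excludes a representation, whose base would be infinite.  The term algebra cannot see these sets:
its elements are preserved when all but finitely many cliques are permuted and the vertices inside
them are exchanged.  Adding a limit clique (number 0), whose labels are adjacent to themselves,
yields a countable universal homogeneous structure.  An element of the term algebra is evaluated at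
a tuple of this structure by replacing the limit labels by labels from a large unused clique.
*)
theory Submission
  imports Defs "HOL-Library.Ramsey" "HOL-Library.Countable"
begin

section \<open>Homomorphisms and representability\<close>

text \<open>One extension property serves both halves. A prescription of fewer than n labels leaves
  one of the n colours free, and new labels of this colour never form a monochromatic triangle with
  a prescribed one. A triangle with two new labels is saved by adjacency. A real clique provides
  that for boundedly many points only; a countable structure is built over arbitrarily many points,
  and there the self-adjacent labels of the limit clique take over. Matrices over the structure are
  therefore not matrices over \<open>L\<close>, and the two kinds are compared by back and forth, up
  to similarity. The obstacle is that a similar copy of a network must be extendable by a similar
  copy of each further point. Similarity keeps colours and the sharing of cliques but not vertices,
  so adjacencies can get lost. The new vertices are chosen so that each required adjacency
  reappears. One direction is enough, since additional adjacency can only make a triangle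
  consistent.\<close>

lemma homomorphism_comp:
  assumes f: "homomorphism sig f A B" and g: "homomorphism sig g B C"
  shows "homomorphism sig (g \<circ> f) A C"
proof -
  have "g (f (oper A k xs)) = oper C k (map (g \<circ> f) xs)"
    if "(k, length xs) \<in> sig" "set xs \<subseteq> elems A" for k xs
  proof -
    have "set (map f xs) \<subseteq> elems B" using f that(2) by (auto simp: homomorphism_def)
    then have "g (oper B k (map f xs)) = oper C k (map g (map f xs))"
      using g that(1) unfolding homomorphism_def by fastforce
    moreover have "f (oper A k xs) = oper B k (map f xs)"
      using f that unfolding homomorphism_def by fastforce
    ultimately show ?thesis by simp
  qed
  then show ?thesis using f g unfolding homomorphism_def by (auto simp: Pi_iff)
qed

lemma homomorphism_restrict:
  assumes "homomorphism sig h A B" "X \<subseteq> elems A" "h ` X \<subseteq> Y"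
  shows "homomorphism sig h (A\<lparr>elems := X\<rparr>) (B\<lparr>elems := Y\<rparr>)"
  using assms unfolding homomorphism_def by (auto simp: subset_iff)

lemma homomorphism_mono: "homomorphism sig h A B \<Longrightarrow> sig' \<subseteq> sig \<Longrightarrow> homomorphism sig' h A B"
  unfolding homomorphism_def by blast

lemma in_productI:
  assumes "closed_under sig A (elems A)" "homomorphism sig h A (direct_product I (\<lambda>i. F (U i)))" "inj_on h (elems A)"
  shows "in_product sig F A I U"
proof -
  let ?P = "direct_product I (\<lambda>i. F (U i))"
  have h: "homomorphism sig h (A\<lparr>elems := elems A\<rparr>) ?P" using assms(2) by simp
  have "homomorphism sig h A (?P\<lparr>elems := h ` elems A\<rparr>)"
    "closed_under sig ?P (h ` elems A)"
    using homomorphism_image[OF assms(1) h] by simp_all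
  then show ?thesis
    unfolding in_product_def subalgebra_def isomorphic_def
    using inj_on_imp_bij_betw[OF assms(3)]
    by (intro exI[of _ "?P\<lparr>elems := h ` elems A\<rparr>"] conjI exI[of _ "h ` elems A"] exI[of _ h]) simp_all
qed

lemma in_product_singleI:
  assumes "closed_under sig A (elems A)" "homomorphism sig h A (F U)" "inj_on h (elems A)"
  shows "in_product sig F A {()} (\<lambda>_. U)"
proof (rule in_productI[OF assms(1)])
  show "homomorphism sig (\<lambda>x. \<lambda>i\<in>{()}. h x) A (direct_product {()} (\<lambda>i. F U))"
    using assms(2) unfolding homomorphism_def direct_product_def
    by (auto simp: fun_eq_iff comp_def)
  show "inj_on (\<lambda>x. \<lambda>i\<in>{()}. h x) (elems A)"
    using assms(3) by (auto simp: inj_on_def fun_eq_iff)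
qed

lemma in_productE:
  assumes "in_product sig F A I U"
  obtains h where "homomorphism sig h A (direct_product I (\<lambda>i. F (U i)))" "inj_on h (elems A)"
proof -
  obtain X h where X: "X \<subseteq> elems (direct_product I (\<lambda>i. F (U i)))"
    and h: "homomorphism sig h A ((direct_product I (\<lambda>i. F (U i)))\<lparr>elems := X\<rparr>)"
    "inj_on h (elems A)"
    using assms unfolding in_product_def subalgebra_def isomorphic_def closed_under_def
    by (auto simp: bij_betw_def)
  have "homomorphism sig h A (direct_product I (\<lambda>i. F (U i)))"
    using h(1) X unfolding homomorphism_def by auto
  with h(2) show thesis using that by blast
qed

lemma in_product_embed:
  assumes "in_product sig F B I U" "homomorphism sig h A B" "inj_on h (elems A)" "closed_under sig A (elems A)"
  shows "in_product sig F A I U"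
proof -
  obtain k where k: "homomorphism sig k B (direct_product I (\<lambda>i. F (U i)))" "inj_on k (elems B)"
    using in_productE[OF assms(1)] .
  have "h ` elems A \<subseteq> elems B" using assms(2) by (auto simp: homomorphism_def)
  then have "inj_on (k \<circ> h) (elems A)"
    by (meson assms(3) comp_inj_on inj_on_subset k(2))
  with homomorphism_comp[OF assms(2) k(1)] show ?thesis by (intro in_productI[OF assms(4)])
qed

lemma closed_under_mono: "closed_under sig A X \<Longrightarrow> sig' \<subseteq> sig \<Longrightarrow> closed_under sig' A X"
  unfolding closed_under_def by blast

lemma in_product_mono:
  assumes "in_product sig F A I U" "sig' \<subseteq> sig"
  shows "in_product sig' F A I U"
proof -
  obtain X h where "closed_under sig (direct_product I (\<lambda>i. F (U i))) X"
    "homomorphism sig h A ((direct_product I (\<lambda>i. F (U i)))\<lparr>elems := X\<rparr>)" "bij_betw h (elems A) X"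
    using assms unfolding in_product_def subalgebra_def isomorphic_def by auto
  then show ?thesis
    unfolding in_product_def subalgebra_def isomorphic_def
    using closed_under_mono[OF _ assms(2)] homomorphism_mono[OF _ assms(2)]
    by (intro exI[of _ "(direct_product I (\<lambda>i. F (U i)))\<lparr>elems := X\<rparr>"] conjI exI[of _ X] exI[of _ h]) simp_all
qed

text \<open>Injectivity separates zero from one at some index, and the projection to that index is a
  non-trivial homomorphism into a single concrete algebra. Both proofs of non-representability work
  inside that algebra.\<close>

lemma in_product_component:
  assumes "in_product sig F A I U" "bzero A \<in> elems A" "bone A \<in> elems A" "bzero A \<noteq> bone A"
  obtains i g where "i \<in> I" "homomorphism sig g A (F (U i))" "g (bzero A) \<noteq> g (bone A)"
proof -
  obtain h where h: "homomorphism sig h A (direct_product I (\<lambda>i. F (U i)))" "inj_on h (elems A)"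
    using in_productE[OF assms(1)] .
  have "h (bzero A) \<noteq> h (bone A)" using h(2) assms by (meson inj_on_eq_iff)
  moreover have hel: "h x \<in> (\<Pi>\<^sub>E i\<in>I. elems (F (U i)))" if "x \<in> elems A" for x
    using h(1) that by (auto simp: homomorphism_def direct_product_def)
  ultimately obtain i where i: "i \<in> I" "h (bzero A) i \<noteq> h (bone A) i"
    using PiE_ext[OF hel[OF assms(2)] hel[OF assms(3)]] by blast
  have "homomorphism sig (\<lambda>x. x i) (direct_product I (\<lambda>i. F (U i))) (F (U i))"
    using i by (auto simp: homomorphism_def direct_product_def)
  from homomorphism_comp[OF h(1) this] have "homomorphism sig (\<lambda>x. h x i) A (F (U i))"
    by (simp add: comp_def)
  with i show thesis using that by blast
qed

lemma closed_under_vimage: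
  assumes h: "homomorphism sig h A B" and A: "closed_under sig A (elems A)" and B: "closed_under sig B Y"
  shows "closed_under sig A {x \<in> elems A. h x \<in> Y}"
proof -
  have "h (oper A f xs) \<in> Y" if "(f, length xs) \<in> sig" "set xs \<subseteq> elems A" "\<forall>x\<in>set xs. h x \<in> Y" for f xs
  proof -
    have "h (oper A f xs) = oper B f (map h xs)"
      using h that unfolding homomorphism_def by fastforce
    also have "\<dots> \<in> Y"
    proof -
      have "set (map h xs) \<subseteq> Y" "(f, length (map h xs)) \<in> sig" using that by auto
      then show ?thesis using B unfolding closed_under_def by fast
    qed
    finally show ?thesis .
  qed
  moreover have "oper A f xs \<in> elems A" if "(f, length xs) \<in> sig" "set xs \<subseteq> elems A" for f xs
    using that A unfolding closed_under_def by fast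
  ultimately have "oper A f xs \<in> {X \<in> elems A. h X \<in> Y}"
    if "(f, length xs) \<in> sig" "set xs \<subseteq> {X \<in> elems A. h X \<in> Y}" for f xs
    using that by (simp add: subset_eq)
  then have ops: "\<forall>(f, r)\<in>sig. \<forall>xs. length xs = r \<and> set xs \<subseteq> {X \<in> elems A. h X \<in> Y} \<longrightarrow>
      oper A f xs \<in> {X \<in> elems A. h X \<in> Y}"
    by auto
  have "h (bzero A) \<in> Y" "h (bone A) \<in> Y"
    "\<And>x y. x \<in> elems A \<Longrightarrow> h x \<in> Y \<Longrightarrow> y \<in> elems A \<Longrightarrow> h y \<in> Y \<Longrightarrow> h (join A x y) \<in> Y"
    "\<And>x y. x \<in> elems A \<Longrightarrow> h x \<in> Y \<Longrightarrow> y \<in> elems A \<Longrightarrow> h y \<in> Y \<Longrightarrow> h (meet A x y) \<in> Y"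
    "\<And>x. x \<in> elems A \<Longrightarrow> h x \<in> Y \<Longrightarrow> h (neg A x) \<in> Y"
    using B h unfolding closed_under_def homomorphism_def by simp_all
  moreover have "bzero A \<in> elems A" "bone A \<in> elems A"
    "\<And>x y. x \<in> elems A \<Longrightarrow> y \<in> elems A \<Longrightarrow> join A x y \<in> elems A"
    "\<And>x y. x \<in> elems A \<Longrightarrow> y \<in> elems A \<Longrightarrow> meet A x y \<in> elems A"
    "\<And>x. x \<in> elems A \<Longrightarrow> neg A x \<in> elems A"
    using A unfolding closed_under_def by simp_all
  ultimately show ?thesis
    unfolding closed_under_def by (intro conjI ops) simp_all
qed

lemma closed_under_Inter:
  assumes "XX \<noteq> {}" "\<And>X. X \<in> XX \<Longrightarrow> closed_under sig A X"
  shows "closed_under sig A (\<Inter>XX)"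
proof -
  have "oper A f xs \<in> X" if "(f, length xs) \<in> sig" "set xs \<subseteq> \<Inter>XX" "X \<in> XX" for f xs X
  proof -
    have "set xs \<subseteq> X" using that by blast
    then show ?thesis using assms(2)[OF that(3)] that(1) unfolding closed_under_def by fast
  qed
  moreover have "\<Inter>XX \<subseteq> elems A" using assms unfolding closed_under_def by blast
  moreover have "bzero A \<in> X" "bone A \<in> X" "x \<in> X \<Longrightarrow> y \<in> X \<Longrightarrow> join A x y \<in> X"
    "x \<in> X \<Longrightarrow> y \<in> X \<Longrightarrow> meet A x y \<in> X" "x \<in> X \<Longrightarrow> neg A x \<in> X" if "X \<in> XX" for X x y
    using assms(2)[OF that] unfolding closed_under_def by simp_all
  ultimately show ?thesis unfolding closed_under_def by auto
qed

lemma closed_under_self: "closed_under sig A X \<Longrightarrow> closed_under sig (A\<lparr>elems := X\<rparr>) X"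
  unfolding closed_under_def by simp

subsection \<open>Images of polyadic equality algebras and relation algebras\<close>

text \<open>The equations are oriented so that rewriting moves \<open>h\<close> outwards. An axiom
  in the image then becomes \<open>h\<close> applied to both sides of the same axiom in
  \<open>A\<close>.\<close>

lemma homomorphism_simps:
  assumes "homomorphism sig h A B"
  shows "bzero B = h (bzero A)" "bone B = h (bone A)"
    "\<And>x y. x \<in> elems A \<Longrightarrow> y \<in> elems A \<Longrightarrow> join B (h x) (h y) = h (join A x y)"
    "\<And>x y. x \<in> elems A \<Longrightarrow> y \<in> elems A \<Longrightarrow> meet B (h x) (h y) = h (meet A x y)"
    "\<And>x. x \<in> elems A \<Longrightarrow> neg B (h x) = h (neg A x)"
    "\<And>f. (f, 0) \<in> sig \<Longrightarrow> oper B f [] = h (oper A f [])"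
    "\<And>f x. (f, Suc 0) \<in> sig \<Longrightarrow> x \<in> elems A \<Longrightarrow> oper B f [h x] = h (oper A f [x])"
    "\<And>f x y. (f, 2) \<in> sig \<Longrightarrow> x \<in> elems A \<Longrightarrow> y \<in> elems A \<Longrightarrow> oper B f [h x, h y] = h (oper A f [x, y])"
proof -
  have *: "oper B f (map h xs) = h (oper A f xs)" if "(f, length xs) \<in> sig" "set xs \<subseteq> elems A" for f xs
    using assms that unfolding homomorphism_def by auto
  show "oper B f [] = h (oper A f [])" if "(f, 0) \<in> sig" for f using *[of f "[]"] that by simp
  show "oper B f [h x] = h (oper A f [x])" if "(f, Suc 0) \<in> sig" "x \<in> elems A" for f x
    using *[of f "[x]"] that by simp
  show "oper B f [h x, h y] = h (oper A f [x, y])" if "(f, 2) \<in> sig" "x \<in> elems A" "y \<in> elems A" for f x y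
    using *[of f "[x, y]"] that by (simp add: numeral_2_eq_2)
qed (use assms in \<open>simp_all add: homomorphism_def\<close>)

lemma closed_under_simps:
  assumes "closed_under sig A X"
  shows "bzero A \<in> X" "bone A \<in> X"
    "\<And>x y. x \<in> X \<Longrightarrow> y \<in> X \<Longrightarrow> join A x y \<in> X"
    "\<And>x y. x \<in> X \<Longrightarrow> y \<in> X \<Longrightarrow> meet A x y \<in> X"
    "\<And>x. x \<in> X \<Longrightarrow> neg A x \<in> X"
    "\<And>f. (f, 0) \<in> sig \<Longrightarrow> oper A f [] \<in> X"
    "\<And>f x. (f, Suc 0) \<in> sig \<Longrightarrow> x \<in> X \<Longrightarrow> oper A f [x] \<in> X"
    "\<And>f x y. (f, 2) \<in> sig \<Longrightarrow> x \<in> X \<Longrightarrow> y \<in> X \<Longrightarrow> oper A f [x, y] \<in> X"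
proof -
  have *: "oper A f xs \<in> X" if "(f, length xs) \<in> sig" "set xs \<subseteq> X" for f xs
    using assms that unfolding closed_under_def by fast
  show "oper A f [] \<in> X" if "(f, 0) \<in> sig" for f using *[of f "[]"] that by simp
  show "oper A f [x] \<in> X" if "(f, Suc 0) \<in> sig" "x \<in> X" for f x
    using *[of f "[x]"] that by simp
  show "oper A f [x, y] \<in> X" if "(f, 2) \<in> sig" "x \<in> X" "y \<in> X" for f x y
    using *[of f "[x, y]"] that by (simp add: numeral_2_eq_2)
qed (use assms in \<open>simp_all add: closed_under_def\<close>)

lemma closed_under_image:
  assumes "closed_under sig A (elems A)" "homomorphism sig h A B" "elems B = h ` elems A"
  shows "closed_under sig B (elems B)"
  using homomorphism_image(1)[of sig A "elems A" h B] assms by simp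

lemma boolean_alg_image:
  assumes h: "homomorphism sig h A B" and e: "elems B = h ` elems A" and A: "boolean_alg A"
  shows "boolean_alg B"
proof -
  have cl: "closed_under {} A (elems A)" using A by (simp add: boolean_alg_def)
  have cB: "closed_under {} B (h ` elems A)"
    using closed_under_image[OF cl homomorphism_mono[OF h] e] e by simp
  have ax:
    "\<And>x y. x \<in> elems A \<Longrightarrow> y \<in> elems A \<Longrightarrow> join A x y = join A y x"
    "\<And>x y. x \<in> elems A \<Longrightarrow> y \<in> elems A \<Longrightarrow> meet A x y = meet A y x"
    "\<And>x y z. x \<in> elems A \<Longrightarrow> y \<in> elems A \<Longrightarrow> z \<in> elems A \<Longrightarrow> join A (join A x y) z = join A x (join A y z)"
    "\<And>x y z. x \<in> elems A \<Longrightarrow> y \<in> elems A \<Longrightarrow> z \<in> elems A \<Longrightarrow> meet A (meet A x y) z = meet A x (meet A y z)"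
    "\<And>x y z. x \<in> elems A \<Longrightarrow> y \<in> elems A \<Longrightarrow> z \<in> elems A \<Longrightarrow> meet A x (join A y z) = join A (meet A x y) (meet A x z)"
    "\<And>x y z. x \<in> elems A \<Longrightarrow> y \<in> elems A \<Longrightarrow> z \<in> elems A \<Longrightarrow> join A x (meet A y z) = meet A (join A x y) (join A x z)"
    "\<And>x. x \<in> elems A \<Longrightarrow> join A x (bzero A) = x" "\<And>x. x \<in> elems A \<Longrightarrow> meet A x (bone A) = x"
    "\<And>x. x \<in> elems A \<Longrightarrow> join A x (neg A x) = bone A" "\<And>x. x \<in> elems A \<Longrightarrow> meet A x (neg A x) = bzero A"
    using A unfolding boolean_alg_def by blast+
  show ?thesis
    unfolding boolean_alg_def e
    by (intro conjI ballI cB; elim imageE;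
        simp only: homomorphism_simps(1-5)[OF h] closed_under_simps(1-5)[OF cl];
        rule arg_cong[of _ _ h]; rule ax; assumption)
qed

text \<open>With \<open>below\<close> unfolded every axiom is an equation whose side conditions
  concern the indices only, so it survives homomorphic images. The algebra of networks is moved in
  this way to an atom structure on natural numbers.\<close>

lemma PEA_image:
  assumes h: "homomorphism (PEA_sig n) h A B" and e: "elems B = h ` elems A" and A: "PEA n A"
  shows "PEA n B"
proof -
  have cl: "closed_under (PEA_sig n) A (elems A)" and b: "boolean_alg A"
    using A by (simp_all add: PEA_def)
  have sig: "i < n \<Longrightarrow> (Cyl i, Suc 0) \<in> PEA_sig n" "i < n \<Longrightarrow> j < n \<Longrightarrow> (Diag i j, 0) \<in> PEA_sig n"
    "i < n \<Longrightarrow> j < n \<Longrightarrow> (Repl i j, Suc 0) \<in> PEA_sig n" "i < n \<Longrightarrow> j < n \<Longrightarrow> (Transp i j, Suc 0) \<in> PEA_sig n" for i j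
    by (auto simp: PEA_sig_def Df_sig_def diag_sig_def repl_sig_def transp_sig_def)
  show ?thesis
    using A closed_under_image[OF cl h e] boolean_alg_image[OF h e b]
    unfolding PEA_def e below_def
    by (simp add: homomorphism_simps[OF h] closed_under_simps[OF cl] sig)
      (intro ballI allI impI arg_cong[of _ _ h]; blast)
qed

lemma RA_image:
  assumes h: "homomorphism RA_sig h A B" and e: "elems B = h ` elems A" and A: "RA A"
  shows "RA B"
proof -
  have cl: "closed_under RA_sig A (elems A)" and b: "boolean_alg A"
    using A by (simp_all add: RA_def)
  have sig: "(Ident, 0) \<in> RA_sig" "(Conv, Suc 0) \<in> RA_sig" "(Comp, 2) \<in> RA_sig"
    by (auto simp: RA_sig_def)
  show ?thesis
    using A closed_under_image[OF cl h e] boolean_alg_image[OF h e b]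
    unfolding RA_def e below_def
    by (simp add: homomorphism_simps[OF h] closed_under_simps[OF cl] sig)
qed

lemma RA_subalgebra:
  assumes "RA A" "closed_under RA_sig A X"
  shows "RA (A\<lparr>elems := X\<rparr>)"
proof -
  have X: "X \<subseteq> elems A" "closed_under {} A X" using assms(2) by (auto simp: closed_under_def)
  define A' where "A' = A\<lparr>elems := X\<rparr>"
  have A': "elems A' = X" "join A' = join A" "meet A' = meet A" "neg A' = neg A" "bzero A' = bzero A"
    "bone A' = bone A" "oper A' = oper A"
    by (simp_all add: A'_def)
  have "closed_under {} A' X" "closed_under RA_sig A' X"
    using closed_under_self[OF X(2)] closed_under_self[OF assms(2)] by (simp_all add: A'_def)
  moreover have "boolean_alg A'"
    using assms(1) \<open>closed_under {} A' X\<close> X(1) unfolding RA_def boolean_alg_def A' by blast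
  ultimately have "RA A'"
    using assms(1) X(1) unfolding RA_def below_def A' by blast
  then show ?thesis by (simp add: A'_def)
qed

subsection \<open>Complex algebras\<close>

lemma Cm_simps [simp]:
  "elems (Cm S) = Pow (points S)" "join (Cm S) = (\<union>)" "meet (Cm S) = (\<inter>)" "neg (Cm S) = (\<lambda>X. points S - X)"
  "bzero (Cm S) = {}" "bone (Cm S) = points S"
  by (simp_all add: Cm_def)

lemma oper_Cm:
  "oper (Cm S) f [] = {s \<in> points S. rel S f s []}"
  "oper (Cm S) f [X] = {s \<in> points S. \<exists>x\<in>X. rel S f s [x]}"
  "oper (Cm S) f [X, Y] = {s \<in> points S. \<exists>x\<in>X. \<exists>y\<in>Y. rel S f s [x, y]}"
  by (auto simp: Cm_def list_all2_Cons2)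

lemma closed_under_Cm: "closed_under sig (Cm S) (Pow (points S))"
  unfolding closed_under_def by (auto simp: Cm_def)

lemma boolean_alg_Cm: "boolean_alg (Cm S)"
  unfolding boolean_alg_def using closed_under_Cm[of "{}" S] by auto

lemma list_all2_mem_map_image:
  "list_all2 (\<in>) ys (map ((`) d) Xs) \<longleftrightarrow> (\<exists>xs. ys = map d xs \<and> list_all2 (\<in>) xs Xs)"
proof (induction Xs arbitrary: ys)
  case (Cons X Xs)
  show ?case
  proof
    assume "list_all2 (\<in>) ys (map ((`) d) (X # Xs))"
    then obtain x xs where "ys = d x # map d xs" "x \<in> X" "list_all2 (\<in>) xs Xs"
      using Cons by (auto simp: list_all2_Cons2)
    then show "\<exists>xs. ys = map d xs \<and> list_all2 (\<in>) xs (X # Xs)"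
      by (intro exI[of _ "x # xs"]) auto
  next
    assume "\<exists>xs. ys = map d xs \<and> list_all2 (\<in>) xs (X # Xs)"
    then show "list_all2 (\<in>) ys (map ((`) d) (X # Xs))"
      using Cons by (auto simp: list_all2_Cons2)
  qed
qed auto

text \<open>\<open>isomorphic_as\<close> hides the map; here it is explicit, because taking images
  under it is the isomorphism of complex algebras in \<open>Cm_hom\<close>.\<close>

definition as_iso :: "'f signature \<Rightarrow> ('a \<Rightarrow> 'b) \<Rightarrow> ('f, 'a) atom_structure \<Rightarrow> ('f, 'b) atom_structure \<Rightarrow> bool" where
  "as_iso sig d S S' \<longleftrightarrow> bij_betw d (points S) (points S') \<and>
     (\<forall>f a as. (f, length as) \<in> sig \<and> a \<in> points S \<and> set as \<subseteq> points S \<longrightarrow>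
        (rel S f a as \<longleftrightarrow> rel S' f (d a) (map d as)))"

lemma isomorphic_as_iff: "isomorphic_as sig S S' \<longleftrightarrow> (\<exists>d. as_iso sig d S S')"
  unfolding isomorphic_as_def as_iso_def by fastforce

lemma as_iso_inv:
  assumes "as_iso sig d S S'"
  shows "as_iso sig (inv_into (points S) d) S' S"
proof -
  have d: "bij_betw d (points S) (points S')" using assms by (simp add: as_iso_def)
  let ?e = "inv_into (points S) d"
  have e: "?e y \<in> points S" "d (?e y) = y" if "y \<in> points S'" for y
    using d that by (auto simp: bij_betw_def inv_into_into f_inv_into_f)
  have "rel S' f a as \<longleftrightarrow> rel S f (?e a) (map ?e as)"
    if "(f, length as) \<in> sig" "a \<in> points S'" "set as \<subseteq> points S'" for f a as
  proof -
    have "map d (map ?e as) = as" using that(3) e by (auto intro!: map_idI)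
    moreover have "rel S f (?e a) (map ?e as) \<longleftrightarrow> rel S' f (d (?e a)) (map d (map ?e as))"
      using assms that e unfolding as_iso_def by (metis (no_types, lifting) image_subset_iff length_map list.set_map subset_iff)
    ultimately show ?thesis using e that by simp
  qed
  then show ?thesis using bij_betw_inv_into[OF d] by (auto simp: as_iso_def)
qed

lemma Cm_hom:
  assumes "as_iso sig d S S'"
  shows "homomorphism sig ((`) d) (Cm S) (Cm S')" "inj_on ((`) d) (elems (Cm S))" "(`) d ` elems (Cm S) = elems (Cm S')"
proof -
  have d: "inj_on d (points S)" "d ` points S = points S'"
    using assms by (auto simp: as_iso_def bij_betw_def)
  have "d ` oper (Cm S) f Xs = oper (Cm S') f (map ((`) d) Xs)"
    if "(f, length Xs) \<in> sig" "set Xs \<subseteq> Pow (points S)" for f Xs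
  proof -
    have *: "rel S f s ss \<longleftrightarrow> rel S' f (d s) (map d ss)"
      if "s \<in> points S" "list_all2 (\<in>) ss Xs" for s ss
    proof -
      have "set ss \<subseteq> points S"
        using that(2) \<open>set Xs \<subseteq> _\<close> by (fastforce simp: list_all2_conv_all_nth in_set_conv_nth subset_iff)
      moreover have "length ss = length Xs" using that(2) by (rule list_all2_lengthD)
      ultimately show ?thesis using assms that(1) \<open>(f, length Xs) \<in> sig\<close> by (simp add: as_iso_def)
    qed
    show ?thesis
      unfolding Cm_def using d * by (fastforce simp: list_all2_mem_map_image image_iff)
  qed
  moreover have "d ` (X \<inter> Y) = d ` X \<inter> d ` Y" "d ` (points S - X) = points S' - d ` X"
    if "X \<subseteq> points S" "Y \<subseteq> points S" for X Y
    using that d inj_on_image_Int[OF d(1)] inj_on_image_set_diff[OF d(1)] by auto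
  moreover have "d ` X \<subseteq> points S'" if "X \<subseteq> points S" for X
    using that d(2) by blast
  ultimately show "homomorphism sig ((`) d) (Cm S) (Cm S')"
    using d(2) unfolding homomorphism_def by (auto simp: image_Un)
  show "inj_on ((`) d) (elems (Cm S))" using inj_on_image_Pow[OF d(1)] by simp
  show "(`) d ` elems (Cm S) = elems (Cm S')" using d(2) by (simp add: image_Pow_surj)
qed

lemma elems_Tm:
  assumes "closed_under sig (Cm S) X" "{{s} | s. s \<in> points S} \<subseteq> X"
  shows "elems (Tm sig S) \<subseteq> X"
  using assms by (auto simp: Tm_def generated_subalgebra_def)

lemma Tm_eq: "Tm sig S = (Cm S)\<lparr>elems := elems (Tm sig S)\<rparr>"
  by (simp add: Tm_def generated_subalgebra_def)

lemma closed_under_Tm: "closed_under sig (Cm S) (elems (Tm sig S))"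
proof -
  have "Pow (points S) \<in> {X. closed_under sig (Cm S) X \<and> {{s} | s. s \<in> points S} \<subseteq> X}"
    using closed_under_Cm by auto
  then have "closed_under sig (Cm S) (\<Inter>{X. closed_under sig (Cm S) X \<and> {{s} | s. s \<in> points S} \<subseteq> X})"
    by (intro closed_under_Inter) auto
  then show ?thesis by (simp add: Tm_def generated_subalgebra_def)
qed

text \<open>A representation is constructed once, for a subalgebra of one convenient complex
  algebra. Preimages under the isomorphism of complex algebras move it to a structure with other
  points.\<close>

lemma vimage_subalgebra:
  assumes d: "as_iso sig d S S'" and B: "closed_under sig (Cm S') B" "{{s} | s. s \<in> points S'} \<subseteq> B"
    and rep: "in_product sig F ((Cm S')\<lparr>elems := B\<rparr>) I U"
  obtains X where "closed_under sig (Cm S) X" "{{s} | s. s \<in> points S} \<subseteq> X"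
    "in_product sig F ((Cm S)\<lparr>elems := X\<rparr>) I U"
proof
  let ?X = "{X \<in> elems (Cm S). d ` X \<in> B}"
  note hom = Cm_hom[OF d]
  show cl: "closed_under sig (Cm S) ?X"
    by (rule closed_under_vimage[OF hom(1) _ B(1)]) (simp add: closed_under_Cm)
  have "d s \<in> points S'" if "s \<in> points S" for s
    using d that by (auto simp: as_iso_def bij_betw_def)
  then show "{{s} | s. s \<in> points S} \<subseteq> ?X" using B(2) by auto
  have "homomorphism sig ((`) d) ((Cm S)\<lparr>elems := ?X\<rparr>) ((Cm S')\<lparr>elems := B\<rparr>)"
    by (rule homomorphism_restrict[OF hom(1)]) auto
  then show "in_product sig F ((Cm S)\<lparr>elems := ?X\<rparr>) I U"
    by (rule in_product_embed[OF rep]) (use closed_under_self[OF cl] inj_on_subset[OF hom(2), of ?X] in auto)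
qed

text \<open>The term algebra is the least subalgebra with all singletons, so a representation of a
  larger one restricts to it.\<close>

lemma in_product_Tm:
  assumes d: "as_iso sig d S S'" and B: "closed_under sig (Cm S') B" "{{s} | s. s \<in> points S'} \<subseteq> B"
    and rep: "in_product sig F ((Cm S')\<lparr>elems := B\<rparr>) I U"
  shows "in_product sig F (Tm sig S) I U"
proof -
  obtain X where X: "closed_under sig (Cm S) X" "{{s} | s. s \<in> points S} \<subseteq> X"
    "in_product sig F ((Cm S)\<lparr>elems := X\<rparr>) I U"
    by (rule vimage_subalgebra[OF assms])
  have sub: "elems (Tm sig S) \<subseteq> X" by (rule elems_Tm[OF X(1,2)])
  have "homomorphism sig id ((Cm S)\<lparr>elems := X\<rparr>) ((Cm S)\<lparr>elems := X\<rparr>)"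
    using closed_under_self[OF X(1)] by (simp add: homomorphism_def)
  from homomorphism_restrict[OF this, of "elems (Tm sig S)" X] sub
  have hom: "homomorphism sig id (Tm sig S) ((Cm S)\<lparr>elems := X\<rparr>)"
    using Tm_eq[of sig S] by simp
  have "closed_under sig (Tm sig S) (elems (Tm sig S))"
    using closed_under_self[OF closed_under_Tm] Tm_eq[of sig S] by metis
  then show ?thesis by (rule in_product_embed[OF X(3) hom inj_on_id])
qed

text \<open>Every non-empty member contains a singleton, which is itself a member. So all algebras
  between the term algebra and the complex algebra are candidates for weak and for strong
  representability of the same atom structure.\<close>

lemma singleton_subalgebra_atoms:
  assumes X: "closed_under sig (Cm S) X" "{{s} | s. s \<in> points S} \<subseteq> X"
  defines "A \<equiv> (Cm S)\<lparr>elems := X\<rparr>"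
  shows "atoms A = {{s} | s. s \<in> points S}" "atomic A" "as_iso sig (\<lambda>s. {s}) S (At A)"
proof -
  have XS: "x \<subseteq> points S" if "x \<in> X" for x using X that by (auto simp: closed_under_def)
  have bel: "below A x y \<longleftrightarrow> x \<subseteq> y" for x y by (auto simp: A_def below_def)
  have A: "elems A = X" "bzero A = {}" by (simp_all add: A_def)
  show at: "atoms A = {{s} | s. s \<in> points S}"
  proof (intro set_eqI iffI)
    fix a assume a: "a \<in> atoms A"
    then obtain s where s: "s \<in> a" "a \<in> X" by (auto simp: atoms_def A)
    then have "{s} \<in> X" using X XS by blast
    moreover have "{s} \<subseteq> a" using s by simp
    ultimately have "{s} = a" using a unfolding atoms_def bel A by blast
    then show "a \<in> {{s} | s. s \<in> points S}" using s XS by blast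
  next
    fix a assume "a \<in> {{s} | s. s \<in> points S}"
    then show "a \<in> atoms A" using X(2) unfolding atoms_def bel A by blast
  qed
  show "atomic A"
    unfolding atomic_def at bel A
  proof (intro ballI impI)
    fix x assume "x \<in> X" "x \<noteq> {}"
    then obtain s where "s \<in> x" "s \<in> points S" using XS by blast
    then show "\<exists>a\<in>{{s} | s. s \<in> points S}. a \<subseteq> x" by (intro bexI[of _ "{s}"]) auto
  qed
  have "rel S f a as \<longleftrightarrow> {a} \<subseteq> oper A f (map (\<lambda>s. {s}) as)" if "a \<in> points S" for f a as
  proof -
    have "list_all2 (\<in>) ss (map (\<lambda>s. {s}) as) \<longleftrightarrow> ss = as" for ss
      by (induction as arbitrary: ss) (auto simp: list_all2_Cons2)
    then show ?thesis using that by (simp add: A_def Cm_def)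
  qed
  moreover have "bij_betw (\<lambda>s. {s}) (points S) (points (At A))"
    unfolding At_def at bij_betw_def by auto
  ultimately show "as_iso sig (\<lambda>s. {s}) S (At A)"
    by (simp add: as_iso_def At_def bel)
qed

section \<open>Labels and networks\<close>

locale monk =
  fixes n :: nat
  assumes n: "2 < n"
begin

text \<open>Label \<open>0\<close> is the identity.  A label \<open>a > 0\<close> encodes its colour, its vertex and its clique; clique
  \<open>0\<close> is the limit clique, which is not part of the atom structure on \<open>L\<close>.\<close>

definition col :: "nat \<Rightarrow> nat" where "col a = (a - 1) mod n"
definition vtx :: "nat \<Rightarrow> nat" where "vtx a = (a - 1) div n mod (n * n)"
definition clq :: "nat \<Rightarrow> nat" where "clq a = (a - 1) div n div (n * n)"
definition lab :: "nat \<Rightarrow> nat \<Rightarrow> nat \<Rightarrow> nat" where "lab c k v = Suc (c + n * (v + n * n * k))"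

text \<open>Adjacency is consulted by \<open>tri\<close> only for three labels of one colour, so the
  colour is left out.\<close>

definition adj :: "nat \<Rightarrow> nat \<Rightarrow> bool" where
  "adj a b \<longleftrightarrow> clq a = clq b \<and> (clq a = 0 \<or> vtx a \<noteq> vtx b)"

definition tri :: "nat \<Rightarrow> nat \<Rightarrow> nat \<Rightarrow> bool" where
  "tri a b c \<longleftrightarrow> (if a = 0 then b = c else if b = 0 then a = c else if c = 0 then a = b
     else col a = col b \<and> col b = col c \<longrightarrow> adj a b \<or> adj b c \<or> adj a c)"

definition L :: "nat set" where "L = {a. a = 0 \<or> clq a \<noteq> 0}"

lemma col_less [simp]: "col a < n" using n by (simp add: col_def)
lemma vtx_less [simp]: "vtx a < n * n" using n by (simp add: vtx_def)

lemma lab_simps [simp]: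
  "lab c k v \<noteq> 0" "0 < lab c k v"
  "c < n \<Longrightarrow> col (lab c k v) = c" "c < n \<Longrightarrow> v < n * n \<Longrightarrow> vtx (lab c k v) = v"
  "c < n \<Longrightarrow> v < n * n \<Longrightarrow> clq (lab c k v) = k"
  by (auto simp: lab_def col_def vtx_def clq_def)

lemma zero_in_L [simp]: "0 \<in> L" by (simp add: L_def)

lemma lab_in_L: "c < n \<Longrightarrow> v < n * n \<Longrightarrow> lab c k v \<in> L \<longleftrightarrow> k \<noteq> 0" by (simp add: L_def)

lemma adj_sym: "adj a b \<longleftrightarrow> adj b a" by (auto simp: adj_def)

lemma tri_rot: "tri a b c \<longleftrightarrow> tri b a c" "tri a b c \<longleftrightarrow> tri a c b"
  by (auto simp: tri_def adj_sym)

lemma tri_zero [simp]: "tri 0 a b \<longleftrightarrow> a = b" "tri a 0 b \<longleftrightarrow> a = b" "tri a b 0 \<longleftrightarrow> a = b"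
  by (auto simp: tri_def)

lemma tri_pos: "a \<noteq> 0 \<Longrightarrow> b \<noteq> 0 \<Longrightarrow> c \<noteq> 0 \<Longrightarrow> tri a b c \<longleftrightarrow>
    (col a = col b \<and> col b = col c \<longrightarrow> adj a b \<or> adj b c \<or> adj a c)"
  by (simp add: tri_def)

text \<open>Label \<open>0\<close> between different points is allowed, because sequences may repeat
  an element. Points at label \<open>0\<close> are interchangeable (\<open>net_on_zero\<close>), and
  the constructions below have to respect this equivalence.\<close>

definition net_on :: "nat set \<Rightarrow> (nat \<times> nat \<Rightarrow> nat) \<Rightarrow> bool" where
  "net_on J f \<longleftrightarrow> (\<forall>x\<in>J. f (x, x) = 0) \<and> (\<forall>x\<in>J. \<forall>y\<in>J. f (y, x) = f (x, y)) \<and>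
     (\<forall>x\<in>J. \<forall>y\<in>J. \<forall>z\<in>J. tri (f (x, z)) (f (x, y)) (f (y, z)))"

text \<open>A value \<open>\<psi> x = 0\<close> is permitted; the new point then duplicates
  \<open>x\<close>.\<close>

definition point_ext :: "nat set \<Rightarrow> (nat \<times> nat \<Rightarrow> nat) \<Rightarrow> (nat \<Rightarrow> nat) \<Rightarrow> bool" where
  "point_ext J f \<psi> \<longleftrightarrow> (\<forall>x\<in>J. \<forall>y\<in>J. tri (f (x, y)) (\<psi> x) (\<psi> y))"

definition add_point :: "nat \<Rightarrow> (nat \<Rightarrow> nat) \<Rightarrow> (nat \<times> nat \<Rightarrow> nat) \<Rightarrow> nat \<times> nat \<Rightarrow> nat" where
  "add_point i \<psi> f = (\<lambda>(x, y). if x = i then if y = i then 0 else \<psi> y else if y = i then \<psi> x else f (x, y))"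

section \<open>Elementary properties of networks and their one-point extensions\<close>

lemma net_onD:
  assumes "net_on J f" "x \<in> J" "y \<in> J"
  shows "f (x, x) = 0" "f (y, x) = f (x, y)" "z \<in> J \<Longrightarrow> tri (f (x, z)) (f (x, y)) (f (y, z))"
  using assms by (auto simp: net_on_def)

lemma net_on_zero:
  assumes "net_on J f" "x \<in> J" "y \<in> J" "z \<in> J" "f (x, y) = 0"
  shows "f (x, z) = f (y, z)" "f (z, x) = f (z, y)"
  using net_onD(3)[OF assms(1), of y z x] net_onD(2)[OF assms(1), of x y]
    net_onD(2)[OF assms(1), of z x] net_onD(2)[OF assms(1), of z y] assms by auto

lemma net_on_subset: "net_on J f \<Longrightarrow> K \<subseteq> J \<Longrightarrow> net_on K f"
  by (auto simp: net_on_def subset_iff)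

lemma net_on_comp: "net_on J f \<Longrightarrow> \<tau> \<in> K \<rightarrow> J \<Longrightarrow> net_on K (\<lambda>(x, y). f (\<tau> x, \<tau> y))"
  by (auto simp: net_on_def Pi_iff)

lemma net_on_cong:
  assumes "\<And>x y. x \<in> J \<Longrightarrow> y \<in> J \<Longrightarrow> f (x, y) = g (x, y)"
  shows "net_on J f \<longleftrightarrow> net_on J g"
  using assms by (simp add: net_on_def)

lemma net_on_add_point:
  assumes f: "net_on J f" and p: "point_ext J f \<psi>"
  shows "net_on (insert i J) (add_point i \<psi> f)"
proof -
  have t: "tri (f (x, y)) (\<psi> x) (\<psi> y)" if "x \<in> J" "y \<in> J" for x y
    using p that by (simp add: point_ext_def)
  then have t': "tri (\<psi> x) (f (x, y)) (\<psi> y)" "tri (\<psi> x) (\<psi> y) (f (x, y))" if "x \<in> J" "y \<in> J" for x y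
    using that tri_rot by metis+
  show ?thesis
    unfolding net_on_def add_point_def
    using net_onD[OF f] t t' by (auto) (metis tri_rot(2))+
qed

lemma point_ext_net:
  assumes "net_on (insert i J) g"
  shows "point_ext J g (\<lambda>x. g (i, x))"
  unfolding point_ext_def
proof (intro ballI)
  fix x y assume xy: "x \<in> J" "y \<in> J"
  then have "tri (g (x, y)) (g (x, i)) (g (i, y))" "g (x, i) = g (i, x)"
    using net_onD(3)[OF assms, of x i y] net_onD(2)[OF assms, of i x] by auto
  then show "tri (g (x, y)) (g (i, x)) (g (i, y))" by simp
qed

text \<open>New labels must be equal on points at label \<open>0\<close>, so they are computed from
  representatives. Equivalent points satisfy the same predicate, hence \<open>SOME\<close> picks the
  same representative for them.\<close>

lemma class_rep:
  assumes f: "net_on J f"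
  obtains r where "\<And>x. x \<in> J \<Longrightarrow> r x \<in> J \<and> f (x, r x) = 0"
    "\<And>x y. x \<in> J \<Longrightarrow> y \<in> J \<Longrightarrow> r x = r y \<longleftrightarrow> f (x, y) = 0"
proof
  define r where "r x = (SOME y. y \<in> J \<and> f (x, y) = 0)" for x
  show r: "r x \<in> J \<and> f (x, r x) = 0" if "x \<in> J" for x
    unfolding r_def by (rule someI[of _ x]) (use f that net_onD in auto)
  show "r x = r y \<longleftrightarrow> f (x, y) = 0" if "x \<in> J" "y \<in> J" for x y
  proof
    assume "r x = r y"
    then show "f (x, y) = 0" using r[OF that(1)] r[OF that(2)] net_on_zero[OF f, of y "r y" x] that by simp
  next
    assume "f (x, y) = 0"
    then have "f (x, z) = f (y, z)" if "z \<in> J" for z using net_on_zero[OF f] that \<open>x \<in> J\<close> \<open>y \<in> J\<close> by blast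
    then show "r x = r y" unfolding r_def by (metis (no_types, lifting))
  qed
qed

text \<open>A triangle with a prescribed label and a new one, taken from \<open>\<nu>\<close>, is never monochromatic.\<close>

lemma one_point_extension:
  assumes f: "net_on J f" and K: "K \<subseteq> J" and \<phi>: "point_ext K f \<phi>"
    and \<nu>: "\<And>x. x \<in> J \<Longrightarrow> \<nu> x \<noteq> 0 \<and> col (\<nu> x) = c" "c \<notin> col ` \<phi> ` K"
    "\<And>x y. x \<in> J \<Longrightarrow> y \<in> J \<Longrightarrow> f (x, y) = 0 \<Longrightarrow> \<nu> x = \<nu> y"
    "\<And>x y. x \<in> J \<Longrightarrow> y \<in> J \<Longrightarrow> f (x, y) \<noteq> 0 \<Longrightarrow> adj (\<nu> x) (\<nu> y)"
  obtains \<psi> where "point_ext J f \<psi>" "\<And>x. x \<in> K \<Longrightarrow> \<psi> x = \<phi> x"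
    "(\<exists>x\<in>K. \<phi> x = 0 \<and> (\<forall>y\<in>J. \<psi> y = f (x, y))) \<or> 0 \<notin> \<phi> ` K \<and> (\<forall>x\<in>J. \<psi> x \<in> \<phi> ` K \<union> \<nu> ` J)"
proof (cases "0 \<in> \<phi> ` K")
  case True
  \<comment> \<open>A prescribed label \<open>0\<close> forces the new point to be a copy of
    \<open>x0\<close>.\<close>
  then obtain x0 where x0: "x0 \<in> K" "\<phi> x0 = 0" by force
  show thesis
  proof
    show "point_ext J f (\<lambda>y. f (x0, y))"
      using net_on_subset[OF f, of "insert x0 J"] x0 K by (intro point_ext_net) (auto simp: subset_iff)
    show "f (x0, x) = \<phi> x" if "x \<in> K" for x
    proof -
      have "tri (f (x0, x)) (\<phi> x0) (\<phi> x)" using \<phi> x0(1) that unfolding point_ext_def by blast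
      then show ?thesis using x0 by simp
    qed
  qed (use x0 in auto)
next
  case False
  \<comment> \<open>Points equivalent to a member of \<open>K\<close> inherit its label; only the
    others receive a new one.\<close>
  define \<psi> where "\<psi> x = (if \<exists>y\<in>K. f (x, y) = 0 then \<phi> (SOME y. y \<in> K \<and> f (x, y) = 0) else \<nu> x)" for x
  have \<psi>1: "\<exists>x'\<in>K. f (x, x') = 0 \<and> \<psi> x = \<phi> x'" if "\<exists>y\<in>K. f (x, y) = 0" for x
    using that someI_ex[of "\<lambda>y. y \<in> K \<and> f (x, y) = 0"] by (auto simp: \<psi>_def)
  have \<psi>2: "\<psi> x = \<nu> x" if "\<not> (\<exists>y\<in>K. f (x, y) = 0)" for x
    using that by (auto simp: \<psi>_def)
  have eqK: "\<phi> x = \<phi> y" if "x \<in> K" "y \<in> K" "f (x, y) = 0" for x y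
  proof -
    have "tri (f (x, y)) (\<phi> x) (\<phi> y)" using \<phi> that unfolding point_ext_def by blast
    then show ?thesis using that by simp
  qed
  show thesis
  proof
    show "point_ext J f \<psi>"
      unfolding point_ext_def
    proof (intro ballI)
      fix x y assume xy: "x \<in> J" "y \<in> J"
      have sym: "f (y, x) = f (x, y)" using net_onD(2)[OF f] xy by simp
      have mixed: "tri (f (x, y)) (\<psi> x) (\<psi> y)"
        if x: "\<exists>z\<in>K. f (x, z) = 0" and y: "\<not> (\<exists>z\<in>K. f (y, z) = 0)" and xy: "x \<in> J" "y \<in> J" for x y
      proof -
        obtain z where z: "z \<in> K" "f (x, z) = 0" "\<psi> x = \<phi> z" using \<psi>1[OF x] by blast
        have "f (x, y) \<noteq> 0"
        proof
          assume "f (x, y) = 0"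
          then have "f (y, z) = 0" using net_on_zero[OF f xy, of z] z K by auto
          with y z show False by blast
        qed
        moreover have "\<psi> x \<noteq> 0" "col (\<psi> x) \<noteq> c" using z False \<nu>(2) by force+
        ultimately show ?thesis using \<psi>2[OF y] \<nu>(1)[OF xy(2)] by (simp add: tri_pos)
      qed
      show "tri (f (x, y)) (\<psi> x) (\<psi> y)"
      proof (cases "\<exists>z\<in>K. f (x, z) = 0")
        case x: True
        show ?thesis
        proof (cases "\<exists>z\<in>K. f (y, z) = 0")
          case y: True
          obtain x' y' where x': "x' \<in> K" "f (x, x') = 0" "\<psi> x = \<phi> x'" and y': "y' \<in> K" "f (y, y') = 0" "\<psi> y = \<phi> y'"
            using \<psi>1[OF x] \<psi>1[OF y] by blast
          have "f (x', y') = f (x, y)"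
            using net_on_zero(1)[OF f, of x x' y'] net_on_zero(2)[OF f, of y y' x] x' y' xy K by (auto dest!: subsetD[OF K])
          then show ?thesis using \<phi> x' y' by (metis point_ext_def)
        qed (use mixed x xy in blast)
      next
        case x: False
        show ?thesis
        proof (cases "\<exists>z\<in>K. f (y, z) = 0")
          case True
          then have "tri (f (y, x)) (\<psi> y) (\<psi> x)" using mixed x xy by blast
          then show ?thesis using sym tri_rot by metis
        next
          case False
          then show ?thesis using x \<psi>2 \<nu>(1,3,4) xy by (cases "f (x, y) = 0") (simp_all add: tri_pos)
        qed
      qed
    qed
    show "\<psi> x = \<phi> x" if "x \<in> K" for x
    proof -
      have "f (x, x) = 0" using net_onD(1)[OF f] K that by blast
      then show ?thesis using \<psi>1[of x] that eqK by metis
    qed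
    \<comment> \<open>From this alternative the callers read off that the labels obtained are real,
      or that they are not \<open>0\<close>.\<close>
    have "\<psi> x \<in> \<phi> ` K \<union> \<nu> ` J" if "x \<in> J" for x
      using \<psi>1[of x] \<psi>2[of x] that by (cases "\<exists>y\<in>K. f (x, y) = 0") auto
    with False show "(\<exists>x\<in>K. \<phi> x = 0 \<and> (\<forall>y\<in>J. \<psi> y = f (x, y))) \<or> 0 \<notin> \<phi> ` K \<and> (\<forall>x\<in>J. \<psi> x \<in> \<phi> ` K \<union> \<nu> ` J)"
      by blast
  qed
qed

text \<open>The number of colours is chosen for this: matrices have n coordinates, and changing one
  of them prescribes fewer than n labels.\<close>

lemma free_colour:
  assumes "finite K" "card K < n"
  obtains c where "c < n" "c \<notin> col ` \<phi> ` K"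
proof -
  have "card (col ` \<phi> ` K) < card {..<n}"
    using assms card_image_le[of K \<phi>] card_image_le[of "\<phi> ` K" col] by simp
  then have "\<not> {..<n} \<subseteq> col ` \<phi> ` K"
    using assms card_mono[of "col ` \<phi> ` K" "{..<n}"] by auto
  then show thesis using that by auto
qed

text \<open>For at most n points a single real clique has enough vertices to give inequivalent
  points different, hence adjacent, new labels. Associativity, amalgamation and the basis conditions
  all reduce to this lemma.\<close>

lemma real_extension:
  assumes f: "net_on J f" and J: "finite J" "card J \<le> n" and K: "K \<subseteq> J" "card K < n" and \<phi>: "point_ext K f \<phi>"
    and fL: "\<And>x y. x \<in> J \<Longrightarrow> y \<in> J \<Longrightarrow> f (x, y) \<in> L" and \<phi>L: "\<And>x. x \<in> K \<Longrightarrow> \<phi> x \<in> L"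
  obtains \<psi> where "point_ext J f \<psi>" "\<And>x. x \<in> K \<Longrightarrow> \<psi> x = \<phi> x" "\<And>x. x \<in> J \<Longrightarrow> \<psi> x \<in> L"
proof -
  obtain c where c: "c < n" "c \<notin> col ` \<phi> ` K"
    using free_colour K J by (meson finite_subset)
  obtain r where r: "\<And>x. x \<in> J \<Longrightarrow> r x \<in> J \<and> f (x, r x) = 0"
    "\<And>x y. x \<in> J \<Longrightarrow> y \<in> J \<Longrightarrow> r x = r y \<longleftrightarrow> f (x, y) = 0"
    using class_rep[OF f] by blast
  obtain e where e: "inj_on e J" "e ` J \<subseteq> {..<n}"
    using J by (metis card_le_inj card_lessThan finite_lessThan)
  have e': "e x < n * n" if "x \<in> J" for x
  proof -
    have "e x < n" using e that by auto
    also have "n \<le> n * n" by simp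
    finally show ?thesis .
  qed
  \<comment> \<open>Clique 1 may already occur in \<open>f\<close>: mixed triangles are safe through
    their colours, and the new labels have to be adjacent to each other only.\<close>
  define \<nu> where "\<nu> x = lab c 1 (e (r x))" for x
  obtain \<psi> where \<psi>: "point_ext J f \<psi>" "\<And>x. x \<in> K \<Longrightarrow> \<psi> x = \<phi> x"
    "(\<exists>x\<in>K. \<phi> x = 0 \<and> (\<forall>y\<in>J. \<psi> y = f (x, y))) \<or> 0 \<notin> \<phi> ` K \<and> (\<forall>x\<in>J. \<psi> x \<in> \<phi> ` K \<union> \<nu> ` J)"
  proof (rule one_point_extension[OF f K(1) \<phi>, of \<nu> c])
    show "\<nu> x \<noteq> 0 \<and> col (\<nu> x) = c" for x using c by (simp add: \<nu>_def)
    show "\<nu> x = \<nu> y" if "x \<in> J" "y \<in> J" "f (x, y) = 0" for x y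
    proof -
      have "r x = r y" using r(2) that by blast
      then show ?thesis by (simp add: \<nu>_def)
    qed
    show "adj (\<nu> x) (\<nu> y)" if "x \<in> J" "y \<in> J" "f (x, y) \<noteq> 0" for x y
    proof -
      have "e (r x) \<noteq> e (r y)" using r that e(1) by (metis inj_on_eq_iff)
      then show ?thesis using c e' r(1) that by (simp add: \<nu>_def adj_def)
    qed
  qed (use c in blast)+
  moreover have "\<psi> x \<in> L" if "x \<in> J" for x
    using \<psi>(3)
  proof
    assume "\<exists>x\<in>K. \<phi> x = 0 \<and> (\<forall>y\<in>J. \<psi> y = f (x, y))"
    then show ?thesis using that fL K by (metis subsetD)
  next
    assume "0 \<notin> \<phi> ` K \<and> (\<forall>x\<in>J. \<psi> x \<in> \<phi> ` K \<union> \<nu> ` J)"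
    moreover have "\<nu> y \<in> L" if "y \<in> J" for y
      using that e' r(1) c by (simp add: \<nu>_def lab_in_L)
    ultimately show ?thesis using that \<phi>L by (metis UnE imageE)
  qed
  ultimately show thesis using that by blast
qed

subsection \<open>Similarity of networks\<close>

text \<open>The permutation \<open>\<kappa>\<close> moves the cliques; vertices inside a clique with index \<open>0\<close> or at least \<open>m\<close>
  are ignored.\<close>

definition lsim :: "nat \<Rightarrow> (nat \<Rightarrow> nat) \<Rightarrow> nat \<Rightarrow> nat \<Rightarrow> bool" where
  "lsim m \<kappa> a b \<longleftrightarrow> (a = 0 \<longleftrightarrow> b = 0) \<and>
     (b \<noteq> 0 \<longrightarrow> col a = col b \<and> clq a = \<kappa> (clq b) \<and> (0 < clq b \<and> clq b < m \<longrightarrow> a = b))"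

text \<open>\<open>\<kappa>\<close> may send \<open>0\<close> to a number that is at least
  \<open>m\<close>. Through this freedom limit labels have real counterparts.\<close>

definition perm_above :: "nat \<Rightarrow> (nat \<Rightarrow> nat) \<Rightarrow> bool" where
  "perm_above m \<kappa> \<longleftrightarrow> bij \<kappa> \<and> (\<forall>q. 0 < q \<and> q < m \<longrightarrow> \<kappa> q = q)"

text \<open>One permutation serves all entries, so that the sharing of a clique is preserved.
  Adjacency need not be: two vertices may coincide on one side only.\<close>

definition sim :: "nat \<Rightarrow> nat set \<Rightarrow> (nat \<times> nat \<Rightarrow> nat) \<Rightarrow> (nat \<times> nat \<Rightarrow> nat) \<Rightarrow> bool" where
  "sim m J f g \<longleftrightarrow> (\<exists>\<kappa>. perm_above m \<kappa> \<and> (\<forall>x\<in>J. \<forall>y\<in>J. lsim m \<kappa> (f (x, y)) (g (x, y))))"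

lemma perm_above_id: "perm_above m id" by (simp add: perm_above_def)

lemma perm_above_inv: "perm_above m \<kappa> \<Longrightarrow> perm_above m (inv \<kappa>)"
  by (auto simp: perm_above_def bij_imp_bij_inv inv_f_eq bij_is_inj)

lemma perm_above_comp: "perm_above m \<kappa> \<Longrightarrow> perm_above m \<kappa>' \<Longrightarrow> perm_above m (\<kappa> \<circ> \<kappa>')"
  by (auto simp: perm_above_def bij_comp)

lemma perm_above_mono: "perm_above m' \<kappa> \<Longrightarrow> m \<le> m' \<Longrightarrow> perm_above m \<kappa>"
  by (auto simp: perm_above_def)

lemma lsim_refl: "lsim m id a a" by (simp add: lsim_def)

lemma lsim_sym:
  assumes k: "perm_above m \<kappa>" and ab: "lsim m \<kappa> a b"
  shows "lsim m (inv \<kappa>) b a"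
proof -
  have inj: "inj \<kappa>" using k by (simp add: perm_above_def bij_is_inj)
  have "b = a" if "b \<noteq> 0" "0 < clq a" "clq a < m"
  proof -
    have "\<kappa> (clq b) = \<kappa> (clq a)" using that k ab by (simp add: perm_above_def lsim_def)
    then have "clq b = clq a" using inj by (simp add: inj_eq)
    then show ?thesis using that ab by (simp add: lsim_def)
  qed
  then show ?thesis using ab inj by (auto simp: lsim_def)
qed

lemma lsim_trans: "lsim m \<kappa> a b \<Longrightarrow> lsim m \<kappa>' b c \<Longrightarrow> lsim m (\<kappa> \<circ> \<kappa>') a c"
  by (auto simp: lsim_def)

lemma lsim_mono: "lsim m' \<kappa> a b \<Longrightarrow> m \<le> m' \<Longrightarrow> lsim m \<kappa> a b"
  by (auto simp: lsim_def)

lemma sim_refl: "sim m J f f"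
  unfolding sim_def using perm_above_id lsim_refl by blast

lemma sim_sym: "sim m J f g \<Longrightarrow> sim m J g f"
  unfolding sim_def using perm_above_inv lsim_sym by meson

lemma sim_trans: "sim m J f g \<Longrightarrow> sim m J g h \<Longrightarrow> sim m J f h"
  unfolding sim_def using perm_above_comp lsim_trans by meson

lemma sim_mono: "sim m' J f g \<Longrightarrow> m \<le> m' \<Longrightarrow> sim m J f g"
  unfolding sim_def using perm_above_mono lsim_mono by meson

lemma sim_subset: "sim m J f g \<Longrightarrow> K \<subseteq> J \<Longrightarrow> sim m K f g"
  unfolding sim_def by blast

lemma sim_comp: "sim m J f g \<Longrightarrow> \<tau> \<in> K \<rightarrow> J \<Longrightarrow> sim m K (\<lambda>(x, y). f (\<tau> x, \<tau> y)) (\<lambda>(x, y). g (\<tau> x, \<tau> y))"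
  unfolding sim_def by (fastforce simp: Pi_iff)

lemma sim_cong:
  assumes "\<And>x y. x \<in> J \<Longrightarrow> y \<in> J \<Longrightarrow> f (x, y) = f' (x, y)" "\<And>x y. x \<in> J \<Longrightarrow> y \<in> J \<Longrightarrow> g (x, y) = g' (x, y)"
  shows "sim m J f g \<longleftrightarrow> sim m J f' g'"
  using assms unfolding sim_def by auto

lemma sim_zero: "sim m J f g \<Longrightarrow> x \<in> J \<Longrightarrow> y \<in> J \<Longrightarrow> f (x, y) = 0 \<longleftrightarrow> g (x, y) = 0"
  by (auto simp: sim_def lsim_def)

text \<open>The new labels get vertices that are different from each other and from all vertices of \<open>f\<close>;
  this is why a clique has \<open>n * n\<close> vertices.\<close>

lemma sim_extension:
  assumes f: "net_on J f" and g: "net_on (insert i J) g" and s: "sim m J f g"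
    and J: "finite J" "card J < n"
  obtains \<psi> \<kappa> where "perm_above m \<kappa>" "point_ext J f \<psi>"
    "\<forall>x\<in>J. \<forall>y\<in>J. lsim m \<kappa> (f (x, y)) (g (x, y))" "\<forall>x\<in>J. lsim m \<kappa> (\<psi> x) (g (i, x))"
    "(\<forall>x\<in>J. \<forall>y\<in>J. f (x, y) \<in> L) \<longrightarrow> (\<forall>x\<in>J. \<psi> x \<in> L)"
proof -
  obtain \<kappa>0 where \<kappa>0: "perm_above m \<kappa>0" "\<And>x y. x \<in> J \<Longrightarrow> y \<in> J \<Longrightarrow> lsim m \<kappa>0 (f (x, y)) (g (x, y))"
    using s by (auto simp: sim_def)
  show thesis
  proof (cases "\<exists>w\<in>J. g (i, w) = 0")
    case True
    then obtain w where w: "w \<in> J" "g (i, w) = 0" by blast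
    have "g (i, x) = g (w, x)" if "x \<in> J" for x
      using net_on_zero(1)[OF g, of i w x] w that by auto
    then have "lsim m \<kappa>0 (f (w, x)) (g (i, x))" if "x \<in> J" for x
      using \<kappa>0(2) w that by simp
    moreover have "point_ext J f (\<lambda>x. f (w, x))"
      using w f by (intro point_ext_net) (simp add: insert_absorb)
    ultimately show thesis using that[of \<kappa>0 "\<lambda>x. f (w, x)"] \<kappa>0 w by blast
  next
    case False
    \<comment> \<open>\<open>M\<close> lies above all cliques in \<open>f\<close> and all cliques
      that \<open>\<kappa>0\<close> assigns to the new labels.\<close>
    obtain M where M: "m < M" "\<And>x y. x \<in> J \<Longrightarrow> y \<in> J \<Longrightarrow> clq (f (x, y)) < M" "\<And>x. x \<in> J \<Longrightarrow> \<kappa>0 (clq (g (i, x))) < M"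
    proof -
      have "finite (insert m ((\<lambda>p. clq (f p)) ` (J \<times> J) \<union> (\<lambda>x. \<kappa>0 (clq (g (i, x)))) ` J))" using J by simp
      then obtain M where "\<forall>s\<in>insert m ((\<lambda>p. clq (f p)) ` (J \<times> J) \<union> (\<lambda>x. \<kappa>0 (clq (g (i, x)))) ` J). s < M"
        using finite_nat_set_iff_bounded by meson
      then show thesis by (intro that) auto
    qed
    obtain \<kappa> where \<kappa>: "perm_above m \<kappa>" "\<And>x y. x \<in> J \<Longrightarrow> y \<in> J \<Longrightarrow> lsim m \<kappa> (f (x, y)) (g (x, y))"
      and \<kappa>L: "(\<And>x y. x \<in> J \<Longrightarrow> y \<in> J \<Longrightarrow> f (x, y) \<in> L) \<Longrightarrow> \<forall>x\<in>J. \<kappa> (clq (g (i, x))) \<noteq> 0"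
    proof (cases "\<forall>x\<in>J. \<forall>y\<in>J. f (x, y) \<in> L")
      case True
      \<comment> \<open>Swapping \<open>0\<close> and \<open>M\<close> moves the new labels out of
        the limit clique. The labels of \<open>f\<close> other than the identity keep their cliques,
        which are neither \<open>0\<close> nor \<open>M\<close>.\<close>
      let ?t = "Transposition.transpose 0 M"
      have "perm_above m (?t \<circ> \<kappa>0)"
        using \<kappa>0(1) M(1) by (auto simp: perm_above_def bij_comp Transposition.transpose_def)
      moreover have "lsim m (?t \<circ> \<kappa>0) (f (x, y)) (g (x, y))" if "x \<in> J" "y \<in> J" for x y
      proof -
        have "f (x, y) \<in> L" using True that by blast
        then show ?thesis
          using \<kappa>0(2)[OF that] M(2)[OF that] by (auto simp: lsim_def L_def Transposition.transpose_def)
      qed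
      moreover have "(?t \<circ> \<kappa>0) (clq (g (i, x))) \<noteq> 0" if "x \<in> J" for x
        using M(1) M(3)[OF that] by (auto simp: Transposition.transpose_def)
      ultimately show thesis using that by blast
    qed (use \<kappa>0 that in blast)
    obtain r where r: "\<And>x. x \<in> J \<Longrightarrow> r x \<in> J \<and> f (x, r x) = 0"
      "\<And>x y. x \<in> J \<Longrightarrow> y \<in> J \<Longrightarrow> r x = r y \<longleftrightarrow> f (x, y) = 0"
      using class_rep[OF f] by blast
    obtain e where e: "inj_on e J" "e ` J \<subseteq> {..<n * n} - (\<lambda>p. vtx (f p)) ` (J \<times> J)"
    proof -
      let ?V = "(\<lambda>p. vtx (f p)) ` (J \<times> J)"
      have "card ?V \<le> card J * card J" using card_image_le[of "J \<times> J" "\<lambda>p. vtx (f p)"] J by (simp add: card_cartesian_product)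
      moreover have "Suc (card J) * Suc (card J) \<le> n * n" using J by (intro mult_le_mono) auto
      moreover have "?V \<subseteq> {..<n * n}" by auto
      ultimately have "card J \<le> card ({..<n * n} - ?V)"
        using J by (simp add: card_Diff_subset)
      then obtain e where "e ` J \<subseteq> {..<n * n} - ?V" "inj_on e J"
        using card_le_inj[OF J(1)] by (metis finite_Diff finite_lessThan)
      then show thesis using that by blast
    qed
    \<comment> \<open>Inside the fixed cliques similarity dictates the label. Elsewhere it
      prescribes colour and clique only, and the vertex can be a fresh one.\<close>
    define \<psi> where "\<psi> x = (let a = g (i, x) in if 0 < clq a \<and> clq a < m then a else lab (col a) (\<kappa> (clq a)) (e (r x)))" for x
    have e1: "e (r x) < n * n" "vtx (f (y, z)) \<noteq> e (r x)" if "x \<in> J" "y \<in> J" "z \<in> J" for x y z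
      using e(2) r(1)[OF that(1)] that by (force simp: subset_iff)+
    have \<psi>: "\<psi> x \<noteq> 0" "col (\<psi> x) = col (g (i, x))" "clq (\<psi> x) = \<kappa> (clq (g (i, x)))"
      "0 < clq (g (i, x)) \<and> clq (g (i, x)) < m \<Longrightarrow> \<psi> x = g (i, x)"
      "\<not> (0 < clq (g (i, x)) \<and> clq (g (i, x)) < m) \<Longrightarrow> vtx (\<psi> x) = e (r x)"
      if "x \<in> J" for x
      using \<kappa>(1) e1[OF that that that] False that
      by (auto simp: \<psi>_def Let_def perm_above_def lab_in_L)
    have gz: "g (i, x) \<noteq> 0" if "x \<in> J" for x using False that by metis
    have ls: "lsim m \<kappa> (\<psi> x) (g (i, x))" if "x \<in> J" for x
      using \<psi>[OF that] gz[OF that] by (auto simp: lsim_def)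
    have "point_ext J f \<psi>"
      unfolding point_ext_def
    proof (intro ballI)
      fix x y assume xy: "x \<in> J" "y \<in> J"
      have lf: "lsim m \<kappa> (f (x, y)) (g (x, y))" by (rule \<kappa>(2)[OF xy])
      have tg: "tri (g (x, y)) (g (i, x)) (g (i, y))"
        using point_ext_net[OF g] xy by (simp add: point_ext_def)
      have vdiff: "vtx (f (x, y)) \<noteq> e (r z)" if "z \<in> J" for z using e1 that xy by blast
      show "tri (f (x, y)) (\<psi> x) (\<psi> y)"
      proof (cases "f (x, y) = 0")
        case True
        then have "g (x, y) = 0" using lf by (simp add: lsim_def)
        then have "g (i, x) = g (i, y)" using tg by simp
        moreover have "r x = r y" using r xy True by blast
        ultimately have "\<psi> x = \<psi> y" by (simp add: \<psi>_def Let_def)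
        then show ?thesis using True by simp
      next
        case False
        have fz: "f (x, y) \<noteq> 0" "g (x, y) \<noteq> 0" using lf False by (auto simp: lsim_def)
        \<comment> \<open>Adjacency is carried from \<open>g\<close> to \<open>f\<close> only. In a
          fixed clique both labels are those of \<open>g\<close>; elsewhere the fresh vertex differs
          from the vertex of \<open>f (x, y)\<close>.\<close>
        have A: "adj (f (x, y)) (\<psi> z)" if z: "z \<in> J" "adj (g (x, y)) (g (i, z))" for z
        proof (cases "0 < clq (g (i, z)) \<and> clq (g (i, z)) < m")
          case True
          then have "f (x, y) = g (x, y)" using lf z fz by (auto simp: lsim_def adj_def)
          then show ?thesis using \<psi>(4)[OF z(1) True] z by simp
        next
          case False
          then show ?thesis using \<psi>(3,5)[OF z(1)] vdiff[OF z(1)] z lf fz by (auto simp: adj_def lsim_def)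
        qed
        have B: "adj (\<psi> x) (\<psi> y)" if "adj (g (i, x)) (g (i, y))"
        proof (cases "0 < clq (g (i, x)) \<and> clq (g (i, x)) < m")
          case True
          then show ?thesis using \<psi>(4) xy that by (simp add: adj_def)
        next
          case F: False
          have "e (r x) \<noteq> e (r y)" using r xy e(1) False by (metis inj_on_eq_iff)
          then show ?thesis using F \<psi>(3,5) xy that by (simp add: adj_def)
        qed
        show ?thesis
          using tg A[OF xy(1)] A[OF xy(2)] B \<psi>(1,2) fz gz lf xy
          by (auto simp: tri_pos lsim_def)
      qed
    qed
    moreover have "\<psi> x \<in> L" if "\<And>x y. x \<in> J \<Longrightarrow> y \<in> J \<Longrightarrow> f (x, y) \<in> L" "x \<in> J" for x
      using \<kappa>L[OF that(1)] \<psi>(3)[OF that(2)] that(2) by (simp add: L_def)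
    ultimately show thesis using that \<kappa> ls by blast
  qed
qed

lemma sim_add_point:
  assumes "perm_above m \<kappa>" "\<And>x y. x \<in> J \<Longrightarrow> y \<in> J \<Longrightarrow> lsim m \<kappa> (f (x, y)) (g (x, y))"
    "\<And>x. x \<in> J \<Longrightarrow> lsim m \<kappa> (\<psi> x) (g (i, x))" "net_on (insert i J) g" "i \<notin> J"
  shows "sim m (insert i J) (add_point i \<psi> f) g"
  unfolding sim_def
proof (intro exI conjI ballI)
  fix x y assume xy: "x \<in> insert i J" "y \<in> insert i J"
  have "g (i, i) = 0" "g (x, i) = g (i, x)" using net_onD[OF assms(4)] xy by auto
  then show "lsim m \<kappa> (add_point i \<psi> f (x, y)) (g (x, y))"
    using assms(2,3,5) xy by (auto simp: add_point_def) (simp add: lsim_def)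
qed (rule assms(1))

text \<open>Starting from the empty network, \<open>sim_extension\<close> copies \<open>g\<close>
  point by point, and its last clause keeps the copy real.\<close>

lemma realisation:
  assumes g: "net_on J g" and J: "finite J" "card J \<le> n"
  obtains f where "net_on J f" "sim m J f g" "\<forall>x\<in>J. \<forall>y\<in>J. f (x, y) \<in> L"
proof -
  have "\<exists>f. net_on J f \<and> sim m J f g \<and> (\<forall>x\<in>J. \<forall>y\<in>J. f (x, y) \<in> L)"
    using J g
  proof (induction J rule: finite_induct)
    case empty
    then show ?case using perm_above_id by (auto simp: net_on_def sim_def)
  next
    case (insert i J)
    have "net_on J g" using insert.prems(2) net_on_subset by blast
    then obtain f where f: "net_on J f" "sim m J f g" "\<forall>x\<in>J. \<forall>y\<in>J. f (x, y) \<in> L"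
      using insert by auto
    obtain \<psi> \<kappa> where e: "perm_above m \<kappa>" "point_ext J f \<psi>"
      "\<forall>x\<in>J. \<forall>y\<in>J. lsim m \<kappa> (f (x, y)) (g (x, y))" "\<forall>x\<in>J. lsim m \<kappa> (\<psi> x) (g (i, x))" "\<forall>x\<in>J. \<psi> x \<in> L"
      using sim_extension[OF f(1) insert.prems(2) f(2) insert.hyps(1)] insert f(3)
      by (metis (no_types, lifting) card_insert_disjoint less_eq_Suc_le)
    then have "net_on (insert i J) (add_point i \<psi> f) \<and> sim m (insert i J) (add_point i \<psi> f) g"
      using net_on_add_point[OF f(1) e(2), of i] sim_add_point[of m \<kappa> J f g \<psi> i] insert.prems(2) insert.hyps(2)
      by simp
    moreover have "\<forall>x\<in>insert i J. \<forall>y\<in>insert i J. add_point i \<psi> f (x, y) \<in> L"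
      using f(3) e(5) by (auto simp: add_point_def)
    ultimately show ?case by blast
  qed
  then show thesis using that by blast
qed

subsection \<open>A universal homogeneous structure\<close>

text \<open>One limit label of a free colour is adjacent to itself and can be used towards all old
  points, however many there are. The vertices of a real clique would run out.\<close>

lemma model_step:
  assumes f: "net_on {..<k} f" and K: "finite K" "card K < n" "K \<subseteq> {..<k}" and \<phi>: "point_ext K f \<phi>" "0 \<notin> \<phi> ` K"
  obtains \<psi> where "point_ext {..<k} f \<psi>" "\<And>x. x \<in> K \<Longrightarrow> \<psi> x = \<phi> x" "\<And>x. x < k \<Longrightarrow> \<psi> x \<noteq> 0"
proof -
  obtain c where c: "c < n" "c \<notin> col ` \<phi> ` K" using free_colour K by blast
  have nn: "0 < n * n" using n by simp
  obtain \<psi> where \<psi>: "point_ext {..<k} f \<psi>" "\<And>x. x \<in> K \<Longrightarrow> \<psi> x = \<phi> x"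
    "(\<exists>x\<in>K. \<phi> x = 0 \<and> (\<forall>y\<in>{..<k}. \<psi> y = f (x, y))) \<or>
      0 \<notin> \<phi> ` K \<and> (\<forall>x\<in>{..<k}. \<psi> x \<in> \<phi> ` K \<union> (\<lambda>_. lab c 0 0) ` {..<k})"
    by (rule one_point_extension[OF f K(3) \<phi>(1), of "\<lambda>_. lab c 0 0" c]) (use c nn in \<open>auto simp: adj_def\<close>)
  then have "\<psi> x \<noteq> 0" if "x < k" for x
    using \<phi>(2) that lab_simps(1)[of c 0 0] by (metis (no_types, lifting) UnE image_iff lessThan_iff)
  with \<psi> show thesis using that by blast
qed

text \<open>The structure is the union of a chain of finite networks, and stage \<open>k\<close>
  adds the point \<open>k\<close>. A new point never takes label \<open>0\<close> to an old one, so
  label \<open>0\<close> becomes equality, and each extension request over fewer than n points is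
  met at some stage.\<close>

lemma model_exists:
  obtains N where "\<And>x y. N (x, y) = 0 \<longleftrightarrow> x = y" "net_on UNIV N"
    "\<And>K \<phi>. finite K \<Longrightarrow> card K < n \<Longrightarrow> point_ext K N \<phi> \<Longrightarrow> 0 \<notin> \<phi> ` K \<Longrightarrow> \<exists>u. \<forall>x\<in>K. N (u, x) = \<phi> x"
proof -
  \<comment> \<open>The code of a list of pairs (point, label) is paired with a number, so that each
    list is requested at arbitrarily late stages.\<close>
  define req where "req k = (from_nat (fst (prod_decode k)) :: (nat \<times> nat) list)" for k
  define Q where "Q k f K \<phi> \<longleftrightarrow> card K < n \<and> K \<subseteq> {..<k} \<and> point_ext K f \<phi> \<and> 0 \<notin> \<phi> ` K"
    for k :: nat and f K \<phi>
  define P where "P k f \<psi> \<longleftrightarrow> point_ext {..<k} f \<psi> \<and> (\<forall>x<k. \<psi> x \<noteq> 0) \<and>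
    (Q k f (fst ` set (req k)) (the \<circ> map_of (req k)) \<longrightarrow> (\<forall>x\<in>fst ` set (req k). \<psi> x = (the \<circ> map_of (req k)) x))"
    for k :: nat and f \<psi>
  define \<Psi> where "\<Psi> k f = (SOME \<psi>. P k f \<psi>)" for k f
  have \<Psi>: "P k f (\<Psi> k f)" if f: "net_on {..<k} f" for k f
  proof -
    have "\<exists>\<psi>. P k f \<psi>"
    proof (cases "Q k f (fst ` set (req k)) (the \<circ> map_of (req k))")
      case True
      then show ?thesis
        using model_step[OF f, of "fst ` set (req k)" "the \<circ> map_of (req k)"] unfolding P_def Q_def
        by (metis List.finite_set finite_imageI)
    next
      case False
      \<comment> \<open>If the request makes no sense yet, any new point will do; the empty
        prescription yields one.\<close>
      have "0 < n" using n by simp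
      then show ?thesis
        using model_step[OF f, of "{}" "\<lambda>_. 0"] False unfolding P_def
        by (metis card.empty empty_iff empty_subsetI finite.emptyI image_empty point_ext_def)
    qed
    then show ?thesis unfolding \<Psi>_def by (rule someI_ex)
  qed
  define G where "G = rec_nat (\<lambda>_. 0) (\<lambda>k f. add_point k (\<Psi> k f) f)"
  have G: "G 0 = (\<lambda>_. 0)" "G (Suc k) = add_point k (\<Psi> k (G k)) (G k)" for k
    by (simp_all add: G_def)
  have net: "net_on {..<k} (G k) \<and> (\<forall>x<k. \<forall>y<k. G k (x, y) = 0 \<longleftrightarrow> x = y)" for k
  proof (induction k)
    case 0
    then show ?case by (simp add: net_on_def)
  next
    case (Suc k)
    then have P: "P k (G k) (\<Psi> k (G k))" using \<Psi> by blast
    then have "net_on (insert k {..<k}) (G (Suc k))"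
      unfolding G using Suc by (intro net_on_add_point) (auto simp: P_def)
    moreover have "G (Suc k) (x, y) = 0 \<longleftrightarrow> x = y" if "x < Suc k" "y < Suc k" for x y
      using Suc P that by (auto simp: G add_point_def P_def less_Suc_eq)
    ultimately show ?case by (simp add: lessThan_Suc)
  qed
  have stable: "G k' (x, y) = G k (x, y)" if "k \<le> k'" "x < k" "y < k" for k k' x y
    using that(1)
  proof (induction k' rule: dec_induct)
    case (step l)
    then show ?case using that by (simp add: G add_point_def)
  qed simp
  \<comment> \<open>Entries do not change once both points are present, and stage
    \<open>Suc (max x y)\<close> is the first with both.\<close>
  define N where "N = (\<lambda>(x, y). G (Suc (max x y)) (x, y))"
  have N: "N (x, y) = G k (x, y)" if "x < k" "y < k" for k x y
    using stable[of "Suc (max x y)" k x y] that by (simp add: N_def)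
  have "N (x, y) = 0 \<longleftrightarrow> x = y" for x y
    using net[of "Suc (max x y)"] by (simp add: N_def less_Suc_eq_le)
  moreover have "net_on UNIV N"
    unfolding net_on_def
  proof (intro conjI ballI)
    fix x y z :: nat
    define k where "k = Suc (max x (max y z))"
    have k: "x < k" "y < k" "z < k" by (auto simp: k_def)
    note D = net_onD[OF conjunct1[OF net[of k]]]
    show "N (x, x) = 0" using D(1)[of x x] k N by simp
    show "N (y, x) = N (x, y)" using D(2)[of x y] k N by simp
    show "tri (N (x, z)) (N (x, y)) (N (y, z))" using D(3)[of x y z] k N by simp
  qed
  moreover have "\<exists>u. \<forall>x\<in>K. N (u, x) = \<phi> x"
    if K: "finite K" "card K < n" "point_ext K N \<phi>" "0 \<notin> \<phi> ` K" for K \<phi>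
  proof -
    define ps where "ps = map (\<lambda>x. (x, \<phi> x)) (sorted_list_of_set K)"
    have ps: "fst ` set ps = K" "\<And>x. x \<in> K \<Longrightarrow> (the \<circ> map_of ps) x = \<phi> x"
      using K(1) by (auto simp: ps_def image_image map_of_map_restrict)
    obtain M where M: "K \<subseteq> {..<M}" using K(1) finite_nat_iff_bounded by blast
    \<comment> \<open>With \<open>M\<close> in the code, stage \<open>k\<close> comes after all
      points of \<open>K\<close> have been added.\<close>
    define k where "k = prod_encode (to_nat ps, M)"
    have "M \<le> k" unfolding k_def by (rule le_prod_encode_2)
    then have Kk: "K \<subseteq> {..<k}" using M by auto
    have req: "req k = ps" by (simp add: req_def k_def)
    have "point_ext K (G k) (the \<circ> map_of ps)"
      unfolding point_ext_def
    proof (intro ballI)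
      fix x y assume xy: "x \<in> K" "y \<in> K"
      then have "N (x, y) = G k (x, y)" using N Kk by blast
      then show "tri (G k (x, y)) ((the \<circ> map_of ps) x) ((the \<circ> map_of ps) y)"
        using K(3) xy ps(2) unfolding point_ext_def by metis
    qed
    then have "Q k (G k) (fst ` set (req k)) (the \<circ> map_of (req k))"
      using K Kk ps unfolding Q_def req by (auto simp: image_iff)
    then have \<psi>: "\<forall>x\<in>K. \<Psi> k (G k) x = \<phi> x"
      using \<Psi>[OF conjunct1[OF net[of k]]] ps unfolding P_def req by auto
    have "N (k, x) = \<phi> x" if "x \<in> K" for x
    proof -
      have "x < k" using Kk that by auto
      then show ?thesis using N[of k "Suc k" x] \<psi> that by (simp add: G add_point_def)
    qed
    then show ?thesis by blast
  qed
  ultimately show thesis using that by blast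
qed

end

section \<open>The polyadic equality algebra of networks\<close>

lemma mat_comp_apply [simp]: "x < n \<Longrightarrow> y < n \<Longrightarrow> mat_comp n f \<tau> (x, y) = f (\<tau> x, \<tau> y)"
  by (simp add: mat_comp_def)

lemma mat_comp_mat_comp:
  assumes "\<tau> \<in> {..<n} \<rightarrow> {..<n}"
  shows "mat_comp n (mat_comp n f \<sigma>) \<tau> = mat_comp n f (\<sigma> \<circ> \<tau>)"
  using assms by (auto simp: mat_comp_def fun_eq_iff Pi_iff)

lemma transpose_lessThan: "i < n \<Longrightarrow> j < n \<Longrightarrow> Transposition.transpose i j \<in> {..<n} \<rightarrow> {..<(n :: nat)}"
  by (auto simp: Transposition.transpose_def)

lemma replace_lessThan: "j < n \<Longrightarrow> id(i := j) \<in> {..<n} \<rightarrow> {..<(n :: nat)}"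
  by auto

lemma agree_off_refl [simp]: "agree_off n Z f f"
  by (simp add: agree_off_def)

lemma agree_off_sym: "agree_off n Z f g \<Longrightarrow> agree_off n Z g f"
  by (simp add: agree_off_def)

lemma PEA_sig_cases:
  assumes "(f, length xs) \<in> PEA_sig n"
  obtains (c) i x where "f = Cyl i" "xs = [x]" "i < n"
    | (d) i j where "f = Diag i j" "xs = []" "i < n" "j < n"
    | (r) i j x where "f = Repl i j" "xs = [x]" "i < n" "j < n"
    | (t) i j x where "f = Transp i j" "xs = [x]" "i < n" "j < n"
  using assms
  by (auto simp: PEA_sig_def Df_sig_def diag_sig_def repl_sig_def transp_sig_def length_Suc_conv)

context monk
begin

definition nets :: "(nat \<times> nat \<Rightarrow> nat) set" where
  "nets = {f \<in> {..<n} \<times> {..<n} \<rightarrow>\<^sub>E L. net_on {..<n} f}"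

fun net_rel :: "pea_op \<Rightarrow> (nat \<times> nat \<Rightarrow> nat) \<Rightarrow> (nat \<times> nat \<Rightarrow> nat) list \<Rightarrow> bool" where
  "net_rel (Cyl i) f [g] \<longleftrightarrow> agree_off n {i} f g"
| "net_rel (Diag i j) f [] \<longleftrightarrow> f (i, j) = 0"
| "net_rel (Repl i j) f [g] \<longleftrightarrow> mat_comp n f (id(i := j)) = g"
| "net_rel (Transp i j) f [g] \<longleftrightarrow> mat_comp n f (Transposition.transpose i j) = g"
| "net_rel _ f _ \<longleftrightarrow> False"

definition netS :: "(pea_op, nat \<times> nat \<Rightarrow> nat) atom_structure" where
  "netS = \<lparr> points = nets, rel = net_rel \<rparr>"

lemma points_netS [simp]: "points netS = nets" by (simp add: netS_def)

lemma netsD: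
  assumes "f \<in> nets"
  shows "net_on {..<n} f" "x < n \<Longrightarrow> y < n \<Longrightarrow> f (x, y) \<in> L" "x < n \<Longrightarrow> f (x, x) = 0"
    "x < n \<Longrightarrow> y < n \<Longrightarrow> f (y, x) = f (x, y)"
  using assms by (auto simp: nets_def PiE_iff net_on_def)

lemma nets_eqI:
  assumes "f \<in> nets" "g \<in> nets" "\<And>x y. x < n \<Longrightarrow> y < n \<Longrightarrow> f (x, y) = g (x, y)"
  shows "f = g"
proof (rule PiE_ext)
  show "f \<in> {..<n} \<times> {..<n} \<rightarrow>\<^sub>E L" "g \<in> {..<n} \<times> {..<n} \<rightarrow>\<^sub>E L" using assms by (auto simp: nets_def)
qed (use assms(3) in auto)

lemma restrict_nets:
  assumes "net_on {..<n} f" "\<And>x y. x < n \<Longrightarrow> y < n \<Longrightarrow> f (x, y) \<in> L"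
  shows "restrict f ({..<n} \<times> {..<n}) \<in> nets"
  using assms net_on_cong[of "{..<n}" "restrict f ({..<n} \<times> {..<n})" f] by (auto simp: nets_def)

lemma mat_comp_nets:
  assumes "f \<in> nets" "\<tau> \<in> {..<n} \<rightarrow> {..<n}"
  shows "mat_comp n f \<tau> \<in> nets"
proof -
  have "mat_comp n f \<tau> = restrict (\<lambda>(x, y). f (\<tau> x, \<tau> y)) ({..<n} \<times> {..<n})"
    by (simp add: mat_comp_def)
  also have "\<dots> \<in> nets"
    using assms by (intro restrict_nets net_on_comp[OF netsD(1)]) (auto simp: Pi_iff netsD(2))
  finally show ?thesis .
qed

lemma mat_comp_id: "f \<in> nets \<Longrightarrow> mat_comp n f id = f"
  by (rule nets_eqI) (auto intro: mat_comp_nets)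

lemma extend_net:
  assumes f: "f \<in> nets" and x: "x < n" and K: "K \<subseteq> {..<n} - {x}"
    and \<phi>: "point_ext K f \<phi>" "\<And>w. w \<in> K \<Longrightarrow> \<phi> w \<in> L"
  obtains h where "h \<in> nets" "agree_off n {x} f h" "\<And>w. w \<in> K \<Longrightarrow> h (x, w) = \<phi> w"
proof -
  let ?J = "{..<n} - {x}"
  have J: "finite ?J" "card ?J < n" using x by auto
  then have "card K < n" using K card_mono[OF J(1) K] by simp
  obtain \<psi> where \<psi>: "point_ext ?J f \<psi>" "\<And>w. w \<in> K \<Longrightarrow> \<psi> w = \<phi> w" "\<And>w. w \<in> ?J \<Longrightarrow> \<psi> w \<in> L"
    by (rule real_extension[OF net_on_subset[OF netsD(1)[OF f]] J(1) _ K \<open>card K < n\<close> \<phi>(1)])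
      (use J f \<phi>(2) netsD(2)[OF f] in auto)
  define h where "h = add_point x \<psi> f"
  have "net_on (insert x ?J) h"
    unfolding h_def by (rule net_on_add_point[OF net_on_subset[OF netsD(1)[OF f]] \<psi>(1)]) auto
  then have "net_on {..<n} h" using x by (simp add: insert_absorb)
  moreover have "h (u, v) \<in> L" if "u < n" "v < n" for u v
    using that \<psi>(3) netsD(2)[OF f] by (auto simp: h_def add_point_def)
  ultimately have "restrict h ({..<n} \<times> {..<n}) \<in> nets" by (rule restrict_nets)
  moreover have "agree_off n {x} f (restrict h ({..<n} \<times> {..<n}))"
    by (auto simp: agree_off_def h_def add_point_def)
  moreover have "restrict h ({..<n} \<times> {..<n}) (x, w) = \<phi> w" if "w \<in> K" for w
    using that K x \<psi>(2) by (auto simp: h_def add_point_def)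
  ultimately show thesis using that by blast
qed

text \<open>Only the label between \<open>x\<close> and \<open>y\<close> is open: the labels of
  \<open>g\<close> at \<open>x\<close> are prescribed over the remaining points of \<open>f\<close>,
  and a one-point extension supplies the last one.\<close>

lemma amalgamate_nets:
  assumes f: "f \<in> nets" and g: "g \<in> nets" and xy: "x < n" "y < n" and a: "agree_off n {x, y} f g"
  obtains h where "h \<in> nets" "agree_off n {x} h f" "agree_off n {y} h g"
proof (cases "x = y")
  case True
  then show thesis using that[of g] g a by (auto intro: agree_off_sym)
next
  case False
  let ?K = "{..<n} - {x, y}"
  have fg: "f (u, v) = g (u, v)" if "u \<in> ?K" "v \<in> ?K" for u v
    using a that by (auto simp: agree_off_def)
  have "point_ext ?K g (\<lambda>w. g (x, w))"
    by (rule point_ext_net[OF net_on_subset[OF netsD(1)[OF g]]]) (use xy in auto)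
  then have "point_ext ?K f (\<lambda>w. g (x, w))"
    using fg by (simp add: point_ext_def)
  then obtain h where h: "h \<in> nets" "agree_off n {x} f h" "\<And>w. w \<in> ?K \<Longrightarrow> h (x, w) = g (x, w)"
    by (rule extend_net[OF f xy(1), rotated]) (use netsD(2)[OF g] xy in auto)
  have "agree_off n {y} h g"
    unfolding agree_off_def
  proof (intro allI impI)
    fix u v assume uv: "u < n" "v < n" "u \<notin> {y} \<and> v \<notin> {y}"
    show "h (u, v) = g (u, v)"
    proof (cases "u = x")
      case True
      then show ?thesis using h(3)[of v] netsD(3)[OF h(1)] netsD(3)[OF g] uv by (cases "v = x") auto
    next
      case u: False
      show ?thesis
      proof (cases "v = x")
        case True
        then show ?thesis using h(3)[of u] u netsD(4)[OF h(1), of u x] netsD(4)[OF g, of u x] uv xy by auto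
      next
        case False
        then show ?thesis using h(2) fg[of u v] u uv by (auto simp: agree_off_def)
      qed
    qed
  qed
  with h show thesis using that agree_off_sym by blast
qed

lemma netS_ops:
  "cyl (Cm netS) i X = {f \<in> nets. \<exists>g\<in>X. agree_off n {i} f g}"
  "diag (Cm netS) i j = {f \<in> nets. f (i, j) = 0}"
  "repl (Cm netS) i j X = {f \<in> nets. mat_comp n f (id(i := j)) \<in> X}"
  "Defs.transp (Cm netS) i j X = {f \<in> nets. mat_comp n f (Transposition.transpose i j) \<in> X}"
  unfolding oper_Cm by (auto simp: netS_def)

lemma repl_refl_netS: "X \<subseteq> nets \<Longrightarrow> repl (Cm netS) i i X = X"
  by (auto simp: netS_ops fun_upd_idem mat_comp_id subset_iff)

text \<open>From left to right, the witness \<open>g\<close> satisfies \<open>g (i, j) = 0\<close>,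
  since it agrees off \<open>k\<close> with a substituted matrix. What is wanted is a matrix that is
  \<open>f\<close> off \<open>k\<close> and \<open>g\<close> off \<open>i\<close>; amalgamation
  provides it, and its substitution is \<open>g\<close>.\<close>

lemma repl_cyl_netS:
  assumes X: "X \<subseteq> nets" and k: "i < n" "j < n" "k < n" "k \<noteq> i" "k \<noteq> j" and ij: "i \<noteq> j"
  shows "repl (Cm netS) i j (cyl (Cm netS) k X) = cyl (Cm netS) k (repl (Cm netS) i j X)"
proof (intro set_eqI iffI)
  fix f assume "f \<in> repl (Cm netS) i j (cyl (Cm netS) k X)"
  then obtain g where f: "f \<in> nets" and g: "g \<in> X" "agree_off n {k} (mat_comp n f (id(i := j))) g"
    by (auto simp: netS_ops)
  have gn: "g \<in> nets" using g X by blast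
  have "mat_comp n f (id(i := j)) (i, j) = g (i, j)"
    using g(2) k unfolding agree_off_def by blast
  then have gij: "g (i, j) = 0" using netsD(3)[OF f] k ij by simp
  have "agree_off n {k, i} f g"
    unfolding agree_off_def
  proof (intro allI impI)
    fix x y assume xy: "x < n" "y < n" "x \<notin> {k, i} \<and> y \<notin> {k, i}"
    then have "mat_comp n f (id(i := j)) (x, y) = g (x, y)" using g(2) unfolding agree_off_def by blast
    then show "f (x, y) = g (x, y)" using xy by simp
  qed
  then obtain h where h: "h \<in> nets" "agree_off n {k} h f" "agree_off n {i} h g"
    using amalgamate_nets[OF f gn k(3,1)] by blast
  have "mat_comp n h (id(i := j)) = g"
  proof (rule nets_eqI)
    show "mat_comp n h (id(i := j)) \<in> nets" using h k by (intro mat_comp_nets) auto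
    fix x y assume xy: "x < n" "y < n"
    have hg: "h (u, v) = g (u, v)" if "u < n" "v < n" "u \<noteq> i" "v \<noteq> i" for u v
      using h(3) that by (auto simp: agree_off_def)
    have "g (j, y) = g (i, y)" "g (x, j) = g (x, i)"
      using net_on_zero[OF netsD(1)[OF gn], of i j] gij k xy by auto
    moreover have "g (j, j) = 0" "g (i, i) = 0" "h (j, j) = 0" using netsD(3)[OF gn] netsD(3)[OF h(1)] k by auto
    ultimately show "mat_comp n h (id(i := j)) (x, y) = g (x, y)"
      using xy hg ij k by auto
  qed (rule gn)
  then show "f \<in> cyl (Cm netS) k (repl (Cm netS) i j X)"
    using f h g by (auto simp: netS_ops intro: agree_off_sym)
next
  fix f assume "f \<in> cyl (Cm netS) k (repl (Cm netS) i j X)"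
  then obtain g where g: "f \<in> nets" "g \<in> nets" "mat_comp n g (id(i := j)) \<in> X" "agree_off n {k} f g"
    by (auto simp: netS_ops)
  have "agree_off n {k} (mat_comp n f (id(i := j))) (mat_comp n g (id(i := j)))"
    using g(4) k by (auto simp: agree_off_def)
  then show "f \<in> repl (Cm netS) i j (cyl (Cm netS) k X)"
    using g k mat_comp_nets[OF g(1) replace_lessThan] by (auto simp: netS_ops)
qed

lemma PEA_netS: "PEA n (Cm netS)"
proof -
  let ?A = "Cm netS"
  note [simp] = netS_ops
  have repl: "mat_comp n f (id(i := j)) \<in> nets" if "f \<in> nets" "j < n" for f i j
    using that by (intro mat_comp_nets) auto
  have trans: "mat_comp n f (Transposition.transpose i j) \<in> nets" if "f \<in> nets" "i < n" "j < n" for f i j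
    using that by (intro mat_comp_nets transpose_lessThan)
  have one: "X \<subseteq> cyl ?A i X" "cyl ?A i (X \<union> Y) = cyl ?A i X \<union> cyl ?A i Y" "repl ?A i i X = X" "Defs.transp ?A i i X = X"
    if "X \<subseteq> nets" "Y \<subseteq> nets" "i < n" for X Y i
    using that by (auto simp: subset_iff fun_upd_idem mat_comp_id intro: agree_off_refl)
  have two: "Defs.transp ?A i j X = Defs.transp ?A j i X"
    "repl ?A i j (X \<union> Y) = repl ?A i j X \<union> repl ?A i j Y"
    "repl ?A i j (nets - X) = nets - repl ?A i j X"
    "Defs.transp ?A i j (X \<union> Y) = Defs.transp ?A i j X \<union> Defs.transp ?A i j Y"
    "Defs.transp ?A i j (nets - X) = nets - Defs.transp ?A i j X"
    "repl ?A i j (diag ?A i j) = nets"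
    if "X \<subseteq> nets" "Y \<subseteq> nets" "i < n" "j < n" for X Y i j
    using that repl trans by (auto simp: transpose_commute netsD(3))
  have two': "repl ?A i j (cyl ?A i X) = cyl ?A i X" if "X \<subseteq> nets" "i < n" "j < n" for X i j
  proof -
    have "agree_off n {i} (mat_comp n f (id(i := j))) g \<longleftrightarrow> agree_off n {i} f g" for f g :: "nat \<times> nat \<Rightarrow> nat"
      by (auto simp: agree_off_def)
    then show ?thesis using that repl by auto
  qed
  have three: "cyl ?A i (repl ?A i j X) = repl ?A i j X" if "X \<subseteq> nets" "i < n" "j < n" "i \<noteq> j" for X i j
  proof -
    have eq: "mat_comp n f (id(i := j)) = mat_comp n g (id(i := j))"
      if "f \<in> nets" "g \<in> nets" "agree_off n {i} f g" for f g
      using that \<open>i \<noteq> j\<close> \<open>j < n\<close> by (intro nets_eqI repl) (auto simp: agree_off_def)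
    have "(\<exists>g\<in>repl ?A i j X. agree_off n {i} f g) \<longleftrightarrow> mat_comp n f (id(i := j)) \<in> X" if f: "f \<in> nets" for f
    proof
      assume "\<exists>g\<in>repl ?A i j X. agree_off n {i} f g"
      then obtain g where "g \<in> nets" "mat_comp n g (id(i := j)) \<in> X" "agree_off n {i} f g" by auto
      then show "mat_comp n f (id(i := j)) \<in> X" using eq[OF f] by simp
    next
      assume "mat_comp n f (id(i := j)) \<in> X"
      then show "\<exists>g\<in>repl ?A i j X. agree_off n {i} f g"
        using f by (intro bexI[of _ f]) auto
    qed
    then show ?thesis unfolding netS_ops(1)[of i "repl ?A i j X"] by auto
  qed
  have four: "Defs.transp ?A i j (Defs.transp ?A i j X) = X"
    "Defs.transp ?A i j (repl ?A i j X) = repl ?A j i X"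
    if "X \<subseteq> nets" "i < n" "j < n" for X i j
  proof -
    have "Transposition.transpose i j \<circ> id(i := j) = id(j := i)"
      by (auto simp: fun_eq_iff)
    then show "Defs.transp ?A i j (Defs.transp ?A i j X) = X"
      "Defs.transp ?A i j (repl ?A i j X) = repl ?A j i X"
      using that trans repl transpose_lessThan[of i n j] replace_lessThan[of j n i]
      by (auto simp: mat_comp_mat_comp mat_comp_id subset_iff)
  qed
  have five: "X \<inter> diag ?A i j \<subseteq> repl ?A i j X" if "X \<subseteq> nets" "i < n" "j < n" for X i j
  proof
    fix f assume f: "f \<in> X \<inter> diag ?A i j"
    then have fn: "f \<in> nets" "f (i, j) = 0" using that by auto
    have "mat_comp n f (id(i := j)) = f"
    proof (rule nets_eqI)
      fix x y assume xy: "x < n" "y < n"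
      have "f (j, y) = f (i, y)" "f (x, j) = f (x, i)" "f (j, j) = f (i, i)"
        using net_on_zero[OF netsD(1)[OF fn(1)], of i j] fn(2) that xy netsD(3)[OF fn(1)] by auto
      then show "mat_comp n f (id(i := j)) (x, y) = f (x, y)" using xy by auto
    qed (use fn repl that in auto)
    then show "f \<in> repl ?A i j X" using f fn by auto
  qed
  have six: "Defs.transp ?A i j (Defs.transp ?A i k X) = Defs.transp ?A j k (Defs.transp ?A i j X)"
    if "X \<subseteq> nets" "i < n" "j < n" "k < n" "k \<noteq> i" "k \<noteq> j" "i \<noteq> j" for X i j k
  proof -
    have "Transposition.transpose i j \<circ> Transposition.transpose i k = Transposition.transpose j k \<circ> Transposition.transpose i j"
      using that by (auto simp: fun_eq_iff Transposition.transpose_def)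
    then show ?thesis
      using that trans transpose_lessThan[of i n j] transpose_lessThan[of i n k] by (auto simp: mat_comp_mat_comp)
  qed
  have repl_cyl: "repl ?A i j (cyl ?A k X) = cyl ?A k (repl ?A i j X)"
    if "X \<subseteq> nets" "i < n" "j < n" "k < n" "k \<noteq> i" "k \<noteq> j" for X i j k
  proof (cases "i = j")
    case True
    have "cyl ?A k X \<subseteq> nets" by auto
    then show ?thesis
      using True repl_refl_netS[OF that(1)] by (simp only: repl_refl_netS)
  qed (use that repl_cyl_netS in blast)
  have cl: "closed_under (PEA_sig n) ?A (elems ?A)" using closed_under_Cm[of "PEA_sig n" netS] by simp
  show ?thesis
    unfolding PEA_def below_def
    using boolean_alg_Cm[of netS] cl one two two' three four five six repl_cyl
    by (simp del: netS_ops add: subset_Un_eq[symmetric]) (intro ballI allI impI six; blast)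
qed

subsection \<open>Representation of the term algebra\<close>

text \<open>Invariance under similarity at level \<open>m\<close> plays the role of a finite
  support. The sets with such a support form a subalgebra that contains the term algebra.\<close>

definition supp :: "nat \<Rightarrow> (nat \<times> nat \<Rightarrow> nat) set \<Rightarrow> bool" where
  "supp m X \<longleftrightarrow> X \<subseteq> nets \<and> (\<forall>f\<in>X. \<forall>g\<in>nets. sim m {..<n} g f \<longrightarrow> g \<in> X)"

definition fin_supp :: "(nat \<times> nat \<Rightarrow> nat) set set" where
  "fin_supp = {X. \<exists>m. supp m X}"

lemma supp_mono: "supp m X \<Longrightarrow> m \<le> m' \<Longrightarrow> supp m' X"
  unfolding supp_def using sim_mono by blast

lemma supp_join:
  assumes "X \<in> fin_supp" "Y \<in> fin_supp"
  obtains m where "supp m X" "supp m Y"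
proof -
  obtain m m' where "supp m X" "supp m' Y" using assms by (auto simp: fin_supp_def)
  then have "supp (max m m') X" "supp (max m m') Y" using supp_mono by simp_all
  then show thesis using that by blast
qed

text \<open>The back-and-forth step for one coordinate. Both \<open>f\<close> and \<open>g\<close>
  may have limit labels, so the step passes between real matrices and matrices induced by the
  structure, in either direction.\<close>

lemma sim_net_extension:
  assumes f: "net_on {..<n} f" and g: "net_on {..<n} g" and i: "i < n" and s: "sim m ({..<n} - {i}) f g"
  obtains h where "net_on {..<n} h" "sim m {..<n} h g" "agree_off n {i} f h"
    "(\<forall>x<n. \<forall>y<n. f (x, y) \<in> L) \<longrightarrow> (\<forall>x<n. \<forall>y<n. h (x, y) \<in> L)"
proof -
  let ?J = "{..<n} - {i}"
  have ins: "insert i ?J = {..<n}" and J: "finite ?J" "card ?J < n" using i by auto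
  have fJ: "net_on ?J f" by (rule net_on_subset[OF f]) auto
  have gJ: "net_on (insert i ?J) g" using g ins by simp
  obtain \<psi> \<kappa> where \<psi>: "perm_above m \<kappa>" "point_ext ?J f \<psi>"
      "\<forall>x\<in>?J. \<forall>y\<in>?J. lsim m \<kappa> (f (x, y)) (g (x, y))" "\<forall>x\<in>?J. lsim m \<kappa> (\<psi> x) (g (i, x))"
      "(\<forall>x\<in>?J. \<forall>y\<in>?J. f (x, y) \<in> L) \<longrightarrow> (\<forall>x\<in>?J. \<psi> x \<in> L)"
    by (rule sim_extension[OF fJ gJ s J])
  show thesis
  proof
    show "net_on {..<n} (add_point i \<psi> f)" using net_on_add_point[OF fJ \<psi>(2), of i] ins by simp
    show "sim m {..<n} (add_point i \<psi> f) g"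
      using sim_add_point[of m \<kappa> ?J f g \<psi> i] \<psi> gJ ins by simp
    show "agree_off n {i} f (add_point i \<psi> f)" by (auto simp: agree_off_def add_point_def)
    show "(\<forall>x<n. \<forall>y<n. f (x, y) \<in> L) \<longrightarrow> (\<forall>x<n. \<forall>y<n. add_point i \<psi> f (x, y) \<in> L)"
      using \<psi>(5) by (auto simp: add_point_def)
  qed
qed

lemma sim_net_extension':
  assumes f: "f \<in> nets" and g: "net_on {..<n} g" and i: "i < n" and s: "sim m ({..<n} - {i}) f g"
  obtains h where "h \<in> nets" "sim m {..<n} h g" "agree_off n {i} f h"
proof -
  obtain h where h: "net_on {..<n} h" "sim m {..<n} h g" "agree_off n {i} f h" "\<forall>x<n. \<forall>y<n. h (x, y) \<in> L"
    using sim_net_extension[OF netsD(1)[OF f] g i s] netsD(2)[OF f] by metis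
  let ?h = "restrict h ({..<n} \<times> {..<n})"
  have "?h \<in> nets" using h by (intro restrict_nets) auto
  moreover have "sim m {..<n} ?h g"
    using h(2) sim_cong[of "{..<n}" ?h h g g m] by auto
  moreover have "agree_off n {i} f ?h" using h(3) by (auto simp: agree_off_def)
  ultimately show thesis using that by blast
qed

lemma sim_agree_off:
  assumes "sim m {..<n} f g" "agree_off n {i} f f'" "agree_off n {i} g g'"
  shows "sim m ({..<n} - {i}) f' g'"
proof -
  have "sim m ({..<n} - {i}) f g" by (rule sim_subset[OF assms(1)]) auto
  then show ?thesis using assms sim_cong[of "{..<n} - {i}" f f' g g'] by (auto simp: agree_off_def)
qed

lemma supp_ops:
  "supp m {}" "supp m nets" "supp m X \<Longrightarrow> supp m Y \<Longrightarrow> supp m (X \<union> Y)" "supp m X \<Longrightarrow> supp m Y \<Longrightarrow> supp m (X \<inter> Y)"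
  by (auto simp: supp_def)

lemma supp_neg: "supp m X \<Longrightarrow> supp m (nets - X)"
  unfolding supp_def using sim_sym by blast

text \<open>A back-and-forth step copies the witness for \<open>f\<close> to one for the similar
  \<open>f'\<close>, and the level stays the same.\<close>

lemma supp_cyl:
  assumes X: "supp m X" and i: "i < n"
  shows "supp m (cyl (Cm netS) i X)"
  unfolding supp_def netS_ops
proof (intro conjI ballI impI)
  fix f f' assume "f \<in> {f \<in> nets. \<exists>g\<in>X. agree_off n {i} f g}" and f': "f' \<in> nets" "sim m {..<n} f' f"
  then obtain g where g: "f \<in> nets" "g \<in> X" "agree_off n {i} f g" by blast
  then have gn: "g \<in> nets" using X by (auto simp: supp_def)
  obtain h where h: "h \<in> nets" "sim m {..<n} h g" "agree_off n {i} f' h"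
    using sim_net_extension'[OF f'(1) netsD(1)[OF gn] i sim_agree_off[OF f'(2) agree_off_refl g(3)]] .
  then have "h \<in> X" using X g by (auto simp: supp_def)
  then show "f' \<in> {f \<in> nets. \<exists>g\<in>X. agree_off n {i} f g}" using f' h by auto
qed auto

lemma sim_mat_comp:
  assumes "sim m {..<n} f g" "\<tau> \<in> {..<n} \<rightarrow> {..<n}"
  shows "sim m {..<n} (mat_comp n f \<tau>) (mat_comp n g \<tau>)"
  using sim_comp[OF assms] sim_cong[of "{..<n}" "mat_comp n f \<tau>" "\<lambda>(x, y). f (\<tau> x, \<tau> y)"
      "mat_comp n g \<tau>" "\<lambda>(x, y). g (\<tau> x, \<tau> y)"] by simp

lemma supp_vimage:
  assumes X: "supp m X" and \<tau>: "\<tau> \<in> {..<n} \<rightarrow> {..<n}"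
  shows "supp m {f \<in> nets. mat_comp n f \<tau> \<in> X}"
  using X sim_mat_comp[OF _ \<tau>] mat_comp_nets[OF _ \<tau>] unfolding supp_def by blast

lemma supp_diag: "i < n \<Longrightarrow> j < n \<Longrightarrow> supp m (diag (Cm netS) i j)"
  unfolding supp_def netS_ops using sim_zero by fastforce

lemma fin_supp_closed: "closed_under (PEA_sig n) (Cm netS) fin_supp"
proof -
  have op: "oper (Cm netS) f Xs \<in> fin_supp" if "(f, length Xs) \<in> PEA_sig n" "set Xs \<subseteq> fin_supp" for f Xs
    using that(1)
  proof (cases rule: PEA_sig_cases)
    case (c i X)
    then show ?thesis using that(2) supp_cyl by (auto simp: fin_supp_def)
  next
    case (d i j)
    then show ?thesis using supp_diag by (auto simp: fin_supp_def)
  next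
    case (r i j X)
    then show ?thesis using that(2) supp_vimage[OF _ replace_lessThan[OF r(4)]]
      unfolding fin_supp_def by (auto simp: netS_ops simp del: fun_upd_apply)
  next
    case (t i j X)
    then show ?thesis using that(2) supp_vimage[OF _ transpose_lessThan[OF t(3,4)]]
      unfolding fin_supp_def by (auto simp: netS_ops)
  qed
  have bool: "X \<union> Y \<in> fin_supp" "X \<inter> Y \<in> fin_supp" "nets - X \<in> fin_supp" if XY: "X \<in> fin_supp" "Y \<in> fin_supp" for X Y
  proof -
    obtain m where m: "supp m X" "supp m Y" using supp_join[OF XY] .
    show "X \<union> Y \<in> fin_supp" "X \<inter> Y \<in> fin_supp" "nets - X \<in> fin_supp"
      using supp_ops(3,4)[OF m] supp_neg[OF m(1)] by (auto simp: fin_supp_def)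
  qed
  have "fin_supp \<subseteq> Pow nets" by (auto simp: fin_supp_def supp_def)
  moreover have "{} \<in> fin_supp" "nets \<in> fin_supp" using supp_ops by (auto simp: fin_supp_def)
  ultimately show ?thesis using op bool unfolding closed_under_def by auto
qed

text \<open>If \<open>m\<close> exceeds all cliques in \<open>f\<close>, similarity at level
  \<open>m\<close> fixes every entry, because real labels other than \<open>0\<close> lie in cliques
  with positive number.\<close>

lemma fin_supp_singleton: "f \<in> nets \<Longrightarrow> {f} \<in> fin_supp"
proof -
  assume f: "f \<in> nets"
  obtain m where m: "\<And>x y. x < n \<Longrightarrow> y < n \<Longrightarrow> clq (f (x, y)) < m"
  proof -
    have "finite ((\<lambda>p. clq (f p)) ` ({..<n} \<times> {..<n}))" by simp
    then obtain m where "\<forall>q\<in>(\<lambda>p. clq (f p)) ` ({..<n} \<times> {..<n}). q < m"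
      using finite_nat_set_iff_bounded by meson
    then show thesis by (intro that) auto
  qed
  have "g = f" if g: "g \<in> nets" "sim m {..<n} g f" for g
  proof (rule nets_eqI[OF g(1) f])
    fix x y assume xy: "x < n" "y < n"
    then obtain \<kappa> where "lsim m \<kappa> (g (x, y)) (f (x, y))" using g(2) by (auto simp: sim_def)
    then show "g (x, y) = f (x, y)"
      using m[OF xy] netsD(2)[OF f xy] by (auto simp: lsim_def L_def)
  qed
  then have "supp m {f}" using f by (auto simp: supp_def)
  then show ?thesis by (auto simp: fin_supp_def)
qed

end

section \<open>Evaluation of finitely supported sets of networks in the homogeneous
  structure\<close>

locale monk_model = monk +
  fixes N :: "nat \<times> nat \<Rightarrow> nat"
  assumes N_zero: "N (x, y) = 0 \<longleftrightarrow> x = y"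
    and N_net: "net_on UNIV N"
    and N_ext: "finite K \<Longrightarrow> card K < n \<Longrightarrow> point_ext K N \<phi> \<Longrightarrow> 0 \<notin> \<phi> ` K \<Longrightarrow> \<exists>u. \<forall>x\<in>K. N (u, x) = \<phi> x"
begin

lemma N_sym: "N (y, x) = N (x, y)"
  using net_onD(2)[OF N_net] by simp

text \<open>\<open>s\<close> may repeat points; the entry of \<open>g\<close> is then
  \<open>0\<close> and the wanted labels coincide, so the prescription is well defined on the image
  of \<open>s\<close>. If \<open>g\<close> makes \<open>i\<close> a copy of an old point, that point
  is reused, as \<open>N_ext\<close> excludes label \<open>0\<close>.\<close>

lemma N_point:
  assumes J: "finite J" "card J < n" and g: "net_on (insert i J) g" and s: "\<And>x y. x \<in> J \<Longrightarrow> y \<in> J \<Longrightarrow> N (s x, s y) = g (x, y)"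
  obtains u where "\<And>x. x \<in> J \<Longrightarrow> N (u, s x) = g (i, x)"
proof (cases "\<exists>w\<in>J. g (i, w) = 0")
  case True
  then obtain w where "w \<in> J" "g (i, w) = 0" by blast
  then have "N (s w, s x) = g (i, x)" if "x \<in> J" for x
    using net_on_zero(1)[OF g, of i w x] s that by simp
  then show thesis using that by blast
next
  case False
  have eq: "g (i, x) = g (i, y)" if "x \<in> J" "y \<in> J" "s x = s y" for x y
  proof -
    have "g (x, y) = 0" using s[OF that(1,2)] that(3) N_zero[of "s x" "s y"] by simp
    then show ?thesis using net_on_zero(2)[OF g, of x y i] that by simp
  qed
  define \<phi> where "\<phi> v = g (i, SOME x. x \<in> J \<and> s x = v)" for v
  have \<phi>: "\<phi> (s x) = g (i, x)" if "x \<in> J" for x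
    using someI[of "\<lambda>y. y \<in> J \<and> s y = s x" x] that eq unfolding \<phi>_def by blast
  have "card (s ` J) < n" using card_image_le[OF J(1), of s] J(2) by simp
  moreover have "point_ext (s ` J) N \<phi>"
    using point_ext_net[OF g] s \<phi> by (auto simp: point_ext_def)
  moreover have "0 \<notin> \<phi> ` s ` J" using False \<phi> by (metis (no_types, lifting) image_iff)
  ultimately obtain u where "\<forall>v\<in>s ` J. N (u, v) = \<phi> v"
    using N_ext[of "s ` J" \<phi>] J(1) by blast
  then show thesis using that \<phi> by auto
qed

lemma N_embeds:
  assumes "net_on {..<k} g" "k \<le> n"
  shows "\<exists>s. \<forall>x<k. \<forall>y<k. N (s x, s y) = g (x, y)"
  using assms
proof (induction k)
  case (Suc k)
  have ins: "insert k {..<k} = {..<Suc k}" by auto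
  have "net_on {..<k} g" by (rule net_on_subset[OF Suc.prems(1)]) auto
  then obtain s where s: "\<forall>x<k. \<forall>y<k. N (s x, s y) = g (x, y)"
    using Suc by auto
  obtain u where u: "\<And>x. x \<in> {..<k} \<Longrightarrow> N (u, s x) = g (k, x)"
    using N_point[of "{..<k}" k g s] Suc.prems s unfolding ins by auto
  have "N ((s(k := u)) x, (s(k := u)) y) = g (x, y)" if "x < Suc k" "y < Suc k" for x y
  proof -
    have "N (s x, u) = g (x, k)" if "x < k" for x
      using u[of x] that N_sym[of "s x" u] net_onD(2)[OF Suc.prems(1), of k x] by simp
    then show ?thesis
      using that s u N_zero[of u u] net_onD(1)[OF Suc.prems(1), of k] by (auto simp: less_Suc_eq)
  qed
  then show ?case by blast
qed simp

definition induced :: "(nat \<Rightarrow> nat) \<Rightarrow> nat \<times> nat \<Rightarrow> nat" where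
  "induced s = (\<lambda>(x, y). N (s x, s y))"

lemma net_on_induced: "net_on J (induced s)"
  using net_on_comp[OF N_net, of s J] by (simp add: induced_def)

text \<open>The quantifier over all levels makes the value independent of the choice of a support. A
  matrix with limit labels is similar to no single real matrix at all levels, hence one witness for
  each level.\<close>

definition interp :: "(nat \<times> nat \<Rightarrow> nat) set \<Rightarrow> (nat \<Rightarrow> nat) set" where
  "interp X = {s \<in> seqs n UNIV. \<forall>m. \<exists>f\<in>X. sim m {..<n} f (induced s)}"

lemma interp_seqs: "s \<in> interp X \<Longrightarrow> s \<in> seqs n UNIV"
  by (simp add: interp_def)

lemma realise_induced:
  obtains f where "f \<in> nets" "sim m {..<n} f (induced s)"
proof -
  obtain f where f: "net_on {..<n} f" "sim m {..<n} f (induced s)" "\<forall>x\<in>{..<n}. \<forall>y\<in>{..<n}. f (x, y) \<in> L"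
    by (rule realisation[OF net_on_induced, of "{..<n}"]) auto
  let ?f = "restrict f ({..<n} \<times> {..<n})"
  have "?f \<in> nets" using f by (intro restrict_nets) auto
  moreover have "sim m {..<n} ?f (induced s)"
    using f(2) sim_cong[of "{..<n}" ?f f "induced s" "induced s" m] by auto
  ultimately show thesis using that by blast
qed

text \<open>A real approximation of \<open>s\<close> at a higher level is similar to
  \<open>f\<close> at level \<open>m\<close> and so lies in \<open>X\<close> as well. This turns one
  witness into witnesses at every level.\<close>

lemma interp_iff:
  assumes X: "supp m X" and s: "s \<in> seqs n UNIV"
  shows "s \<in> interp X \<longleftrightarrow> (\<exists>f\<in>X. sim m {..<n} f (induced s))"
proof
  assume "\<exists>f\<in>X. sim m {..<n} f (induced s)"
  then obtain f where f: "f \<in> X" "sim m {..<n} f (induced s)" by blast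
  have "\<exists>g\<in>X. sim m' {..<n} g (induced s)" for m'
  proof -
    obtain g where g: "g \<in> nets" "sim (max m m') {..<n} g (induced s)" by (rule realise_induced)
    have "sim m {..<n} g f" "sim m' {..<n} g (induced s)"
      using sim_trans[OF sim_mono[OF g(2)] sim_sym[OF f(2)]] sim_mono[OF g(2)] by auto
    then show ?thesis using X f g unfolding supp_def by blast
  qed
  then show "s \<in> interp X" using s by (simp add: interp_def)
qed (simp add: interp_def)

text \<open>Membership is decided at one real approximation, the same for all sets with support
  \<open>m\<close>. Hence \<open>interp\<close> commutes with the Boolean operations.\<close>

lemma interp_iff_net:
  assumes X: "supp m X" and s: "s \<in> seqs n UNIV" and f: "f \<in> nets" "sim m {..<n} f (induced s)"
  shows "s \<in> interp X \<longleftrightarrow> f \<in> X"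
  using interp_iff[OF X s] f X sim_trans sim_sym unfolding supp_def by blast

lemma seqs_comp: "\<tau> \<in> {..<n} \<rightarrow> {..<n} \<Longrightarrow> \<forall>k\<ge>n. \<tau> k = k \<Longrightarrow> s \<in> seqs n UNIV \<Longrightarrow> s \<circ> \<tau> \<in> seqs n (UNIV :: nat set)"
  by (auto simp: PiE_iff extensional_def)

lemma interp_vimage:
  assumes X: "supp m X" and \<tau>: "\<tau> \<in> {..<n} \<rightarrow> {..<n}" "\<forall>k\<ge>n. \<tau> k = k"
  shows "interp {f \<in> nets. mat_comp n f \<tau> \<in> X} = {s \<in> seqs n UNIV. s \<circ> \<tau> \<in> interp X}"
proof -
  have "s \<in> interp {f \<in> nets. mat_comp n f \<tau> \<in> X} \<longleftrightarrow> s \<circ> \<tau> \<in> interp X" if s: "s \<in> seqs n UNIV" for s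
  proof -
    obtain f where f: "f \<in> nets" "sim m {..<n} f (induced s)" by (rule realise_induced)
    have "sim m {..<n} (mat_comp n f \<tau>) (induced (s \<circ> \<tau>))"
      using sim_mat_comp[OF f(2) \<tau>(1)]
        sim_cong[of "{..<n}" "mat_comp n f \<tau>" "mat_comp n f \<tau>" "mat_comp n (induced s) \<tau>" "induced (s \<circ> \<tau>)"]
      by (simp add: induced_def)
    then show ?thesis
      using interp_iff_net[OF supp_vimage[OF X \<tau>(1)] s f] interp_iff_net[OF X seqs_comp[OF \<tau> s] mat_comp_nets[OF f(1) \<tau>(1)]] f
      by simp
  qed
  then show ?thesis using interp_seqs by blast
qed

text \<open>From left to right, the real witness is copied to a network that agrees with
  \<open>s\<close> off \<open>i\<close>, perhaps with limit labels, and the extension property of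
  the structure supplies the point. From right to left, a real approximation of \<open>t\<close> is
  changed at \<open>i\<close> into one of \<open>s\<close>.\<close>

lemma interp_cyl:
  assumes X: "supp m X" and i: "i < n"
  shows "interp (cyl (Cm netS) i X) = {s \<in> seqs n UNIV. \<exists>t\<in>interp X. \<forall>j<n. j \<noteq> i \<longrightarrow> t j = s j}"
proof -
  let ?J = "{..<n} - {i}"
  have ins: "insert i ?J = {..<n}" and J: "finite ?J" "card ?J < n" using i by auto
  have "s \<in> interp (cyl (Cm netS) i X) \<longleftrightarrow> (\<exists>t\<in>interp X. \<forall>j<n. j \<noteq> i \<longrightarrow> t j = s j)" (is "?l \<longleftrightarrow> ?r")
    if s: "s \<in> seqs n UNIV" for s
  proof
    assume ?l
    then obtain f g where f: "f \<in> nets" "sim m {..<n} f (induced s)" and g: "g \<in> X" "agree_off n {i} f g"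
      using interp_iff[OF supp_cyl[OF X i] s] unfolding netS_ops by auto
    have gn: "g \<in> nets" using X g by (auto simp: supp_def)
    obtain h where h: "net_on {..<n} h" "sim m {..<n} h g" "agree_off n {i} (induced s) h"
      by (rule sim_net_extension[OF net_on_induced netsD(1)[OF gn] i sim_agree_off[OF sim_sym[OF f(2)] agree_off_refl g(2)]])
    obtain u where u: "\<And>x. x \<in> ?J \<Longrightarrow> N (u, s x) = h (i, x)"
    proof (rule N_point[OF J, of i h s])
      show "net_on (insert i ?J) h" using h(1) ins by simp
      show "N (s x, s y) = h (x, y)" if "x \<in> ?J" "y \<in> ?J" for x y
        using h(3) that by (auto simp: agree_off_def induced_def)
    qed (rule that)
    let ?t = "s(i := u)"
    have "induced ?t (x, y) = h (x, y)" if "x < n" "y < n" for x y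
    proof -
      have "h (x, i) = h (i, x)" "h (i, i) = 0" using net_onD(2)[OF h(1), of i x] net_onD(1)[OF h(1), of i i] i that by auto
      then show ?thesis
        using that u[of x] u[of y] N_sym[of u "s x"] h(3) N_zero[of u u]
        by (auto simp: induced_def agree_off_def)
    qed
    then have "sim m {..<n} (induced ?t) g"
      using h(2) sim_cong[of "{..<n}" "induced ?t" h g g m] by simp
    moreover have "?t \<in> seqs n UNIV" using s i by (auto simp: PiE_iff extensional_def)
    ultimately have "?t \<in> interp X" using interp_iff[OF X] g(1) sim_sym by blast
    then show ?r by (intro bexI[of _ ?t]) auto
  next
    assume ?r
    then obtain t where t: "t \<in> interp X" "\<forall>j<n. j \<noteq> i \<longrightarrow> t j = s j" by blast
    have tq: "t \<in> seqs n UNIV" using t by (simp add: interp_def)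
    obtain g where g: "g \<in> X" "sim m {..<n} g (induced t)" using t(1) interp_iff[OF X tq] by blast
    have gn: "g \<in> nets" using X g by (auto simp: supp_def)
    have "agree_off n {i} (induced t) (induced s)" using t(2) by (auto simp: agree_off_def induced_def)
    then obtain f where f: "f \<in> nets" "sim m {..<n} f (induced s)" "agree_off n {i} g f"
      using sim_net_extension'[OF gn net_on_induced i sim_agree_off[OF g(2) agree_off_refl]] by metis
    then have "f \<in> cyl (Cm netS) i X" using g(1) by (auto simp: netS_ops intro: agree_off_sym)
    then show ?l using interp_iff[OF supp_cyl[OF X i] s] f by blast
  qed
  then show ?thesis using interp_seqs by blast
qed

lemma interp_hom: "homomorphism (PEA_sig n) interp ((Cm netS)\<lparr>elems := fin_supp\<rparr>) (set_algebra n UNIV)"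
proof -
  have bool: "interp (X \<union> Y) = interp X \<union> interp Y" "interp (X \<inter> Y) = interp X \<inter> interp Y"
    "interp (nets - X) = seqs n UNIV - interp X" if XY: "X \<in> fin_supp" "Y \<in> fin_supp" for X Y
  proof -
    obtain m where m: "supp m X" "supp m Y" using supp_join[OF XY] .
    have "(s \<in> interp (X \<union> Y) \<longleftrightarrow> s \<in> interp X \<or> s \<in> interp Y) \<and>
        (s \<in> interp (X \<inter> Y) \<longleftrightarrow> s \<in> interp X \<and> s \<in> interp Y) \<and> (s \<in> interp (nets - X) \<longleftrightarrow> s \<notin> interp X)"
      if s: "s \<in> seqs n UNIV" for s
    proof -
      obtain f where f: "f \<in> nets" "sim m {..<n} f (induced s)" by (rule realise_induced)
      show ?thesis
        using interp_iff_net[OF m(1) s f] interp_iff_net[OF m(2) s f] interp_iff_net[OF supp_ops(3)[OF m] s f]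
          interp_iff_net[OF supp_ops(4)[OF m] s f] interp_iff_net[OF supp_neg[OF m(1)] s f] f(1)
        by blast
    qed
    then show "interp (X \<union> Y) = interp X \<union> interp Y" "interp (X \<inter> Y) = interp X \<inter> interp Y"
      "interp (nets - X) = seqs n UNIV - interp X"
      using interp_seqs by blast+
  qed
  have top: "interp {} = {}" "interp nets = seqs n UNIV"
    using realise_induced unfolding interp_def by blast+
  have op: "interp (oper (Cm netS) f Xs) = set_oper n UNIV f (map interp Xs)"
    if fX: "(f, length Xs) \<in> PEA_sig n" "set Xs \<subseteq> fin_supp" for f Xs
    using fX(1)
  proof (cases rule: PEA_sig_cases)
    case (c i X)
    then obtain m where "supp m X" using fX(2) by (auto simp: fin_supp_def)
    then show ?thesis using c interp_cyl by simp
  next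
    case (d i j)
    have "s \<in> interp (diag (Cm netS) i j) \<longleftrightarrow> s i = s j" if s: "s \<in> seqs n UNIV" for s
    proof -
      obtain f where f: "f \<in> nets" "sim 0 {..<n} f (induced s)" by (rule realise_induced)
      have "f (i, j) = 0 \<longleftrightarrow> s i = s j"
        using sim_zero[OF f(2), of i j] d N_zero[of "s i" "s j"] by (simp add: induced_def)
      then show ?thesis
        using interp_iff_net[OF supp_diag[of i j] s f] d f(1) by (simp add: netS_ops)
    qed
    then show ?thesis using d by (auto simp: interp_def)
  next
    case (r i j X)
    then obtain m where "supp m X" using fX(2) by (auto simp: fin_supp_def)
    then show ?thesis using r interp_vimage[of m X "id(i := j)"] by (simp add: netS_ops)
  next
    case (t i j X)
    then obtain m where "supp m X" using fX(2) by (auto simp: fin_supp_def)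
    moreover have "\<forall>k\<ge>n. Transposition.transpose i j k = k" using t by (auto simp: Transposition.transpose_def)
    ultimately show ?thesis
      using t interp_vimage[of m X "Transposition.transpose i j"] transpose_lessThan by (simp add: netS_ops)
  qed
  have "interp X \<subseteq> seqs n UNIV" for X by (auto simp: interp_def)
  then show ?thesis
    unfolding homomorphism_def using bool top op by (auto simp: set_algebra_def simp del: PiE_iff)
qed

lemma interp_nonempty:
  assumes X: "X \<in> fin_supp" "X \<noteq> {}"
  shows "interp X \<noteq> {}"
proof -
  obtain f m where f: "f \<in> X" and m: "supp m X" using X by (auto simp: fin_supp_def)
  then have fn: "f \<in> nets" by (auto simp: supp_def)
  \<comment> \<open>A real network occurs in the structure exactly, so it approximates its own copy
    at every level.\<close>
  obtain s where s: "\<forall>x<n. \<forall>y<n. N (s x, s y) = f (x, y)"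
    using N_embeds[OF netsD(1)[OF fn]] by blast
  let ?s = "restrict s {..<n}"
  have "sim m {..<n} f (induced ?s)"
    using sim_refl[of m "{..<n}" f] sim_cong[of "{..<n}" f f "induced ?s" f m] s by (simp add: induced_def)
  then have "?s \<in> interp X" using interp_iff[OF m, of ?s] f by auto
  then show ?thesis by blast
qed

lemma interp_inj: "inj_on interp fin_supp"
proof (rule inj_onI)
  fix X Y assume XY: "X \<in> fin_supp" "Y \<in> fin_supp" "interp X = interp Y"
  have sub: "X \<subseteq> Y" if XY: "X \<in> fin_supp" "Y \<in> fin_supp" "interp X = interp Y" for X Y
  proof -
    have Z: "nets - Y \<in> fin_supp" "X \<inter> (nets - Y) \<in> fin_supp"
      using closed_under_simps(4,5)[OF fin_supp_closed] XY by auto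
    have "interp (X \<inter> (nets - Y)) = interp X \<inter> (seqs n UNIV - interp Y)"
      using interp_hom XY Z(1) unfolding homomorphism_def by (simp add: set_algebra_def)
    then have "X \<inter> (nets - Y) = {}" using interp_nonempty[OF Z(2)] XY(3) by auto
    moreover have "X \<subseteq> nets" using XY(1) by (auto simp: fin_supp_def supp_def)
    ultimately show ?thesis by blast
  qed
  show "X = Y" using sub[OF XY] sub[OF XY(2,1) XY(3)[symmetric]] by blast
qed

lemma fin_supp_representable:
  "in_product (PEA_sig n) (set_algebra n) ((Cm netS)\<lparr>elems := fin_supp\<rparr>) {()} (\<lambda>_. UNIV :: nat set)"
  by (rule in_product_singleI[where F = "set_algebra n" and U = UNIV, OF _ interp_hom]) (use closed_under_self[OF fin_supp_closed] interp_inj in simp_all)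

end

section \<open>The relation algebra\<close>

context monk
begin

fun lab_rel :: "ra_op \<Rightarrow> nat \<Rightarrow> nat list \<Rightarrow> bool" where
  "lab_rel Ident a [] \<longleftrightarrow> a = 0"
| "lab_rel Conv a [b] \<longleftrightarrow> a = b"
| "lab_rel Comp a [b, c] \<longleftrightarrow> tri a b c"
| "lab_rel _ a _ \<longleftrightarrow> False"

definition labS :: "(ra_op, nat) atom_structure" where
  "labS = \<lparr> points = L, rel = lab_rel \<rparr>"

lemma points_labS [simp]: "points labS = L" by (simp add: labS_def)

lemma labS_ops:
  "ident (Cm labS) = {0}"
  "rconv (Cm labS) X = X \<inter> L"
  "rcomp (Cm labS) X Y = {a \<in> L. \<exists>b\<in>X. \<exists>c\<in>Y. tri a b c}"
  unfolding oper_Cm by (auto simp: labS_def)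

text \<open>A consistent triangle becomes a network on three points, so that the extension lemmas
  for networks apply to the composition of labels.\<close>

definition triangle_net :: "nat \<Rightarrow> nat \<Rightarrow> nat \<Rightarrow> nat \<times> nat \<Rightarrow> nat" where
  "triangle_net a b c = add_point 2 (\<lambda>x. if x = 0 then b else c) (add_point 1 (\<lambda>_. a) (\<lambda>_. 0))"

lemma net_on_edge: "net_on {0, 1} (add_point 1 (\<lambda>_. a) (\<lambda>_. 0))"
proof -
  have "net_on (insert 1 {0}) (add_point 1 (\<lambda>_. a) (\<lambda>_. 0))"
    by (rule net_on_add_point) (auto simp: net_on_def point_ext_def)
  then show ?thesis by (simp add: insert_commute)
qed

lemma net_on_triangle: "tri a b c \<Longrightarrow> net_on {0, 1, 2} (triangle_net a b c)"
proof -
  assume t: "tri a b c"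
  then have "tri a c b" by (metis tri_rot)
  with t have "point_ext {0, 1} (add_point 1 (\<lambda>_. a) (\<lambda>_. 0)) (\<lambda>x. if x = 0 then b else c)"
    by (auto simp: point_ext_def add_point_def)
  then have "net_on (insert 2 {0, 1}) (triangle_net a b c)"
    unfolding triangle_net_def by (rule net_on_add_point[OF net_on_edge])
  then show ?thesis by (simp add: insert_commute)
qed

lemma triangle_simps [simp]:
  "triangle_net a b c (0, Suc 0) = a" "triangle_net a b c (Suc 0, 0) = a" "triangle_net a b c (0, 2) = b"
  "triangle_net a b c (2, 0) = b" "triangle_net a b c (Suc 0, 2) = c" "triangle_net a b c (2, Suc 0) = c"
  "triangle_net a b c (0, 0) = 0" "triangle_net a b c (Suc 0, Suc 0) = 0" "triangle_net a b c (2, 2) = 0"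
  by (simp_all add: triangle_net_def add_point_def)

text \<open>A fourth point gets label \<open>d\<close> to point 0 and \<open>e\<close> to point 2;
  its label to point 1 is \<open>b'\<close>. Two prescribed labels over three points are within the
  bounds of \<open>real_extension\<close> because n > 2.\<close>

lemma tri_assoc:
  assumes "tri a b c" "tri b d e" "{a, b, c, d, e} \<subseteq> L"
  shows "\<exists>b'\<in>L. tri a d b' \<and> tri b' e c"
proof -
  let ?f = "triangle_net a b c" and ?\<phi> = "\<lambda>x. if x = 0 then d else e"
  have "tri b e d" using assms(2) by (metis tri_rot)
  then have \<phi>: "point_ext {0, 2} ?f ?\<phi>" using assms(2) by (auto simp: point_ext_def)
  obtain \<psi> where \<psi>: "point_ext {0, 1, 2} ?f \<psi>" "\<And>x. x \<in> {0, 2} \<Longrightarrow> \<psi> x = ?\<phi> x" "\<And>x. x \<in> {0, 1, 2} \<Longrightarrow> \<psi> x \<in> L"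
    by (rule real_extension[OF net_on_triangle[OF assms(1)] _ _ _ _ \<phi>]) (use n assms(3) in auto)
  have "tri (?f (0, 1)) (\<psi> 0) (\<psi> 1)" "tri (?f (2, 1)) (\<psi> 2) (\<psi> 1)"
    using \<psi>(1) unfolding point_ext_def by blast+
  then have "tri a d (\<psi> 1)" "tri c e (\<psi> 1)" using \<psi>(2)[of 0] \<psi>(2)[of 2] by simp_all
  then show ?thesis using \<psi>(3)[of 1] tri_rot by (metis insertCI)
qed

lemma RA_labS: "RA (Cm labS)"
proof -
  have assoc: "rcomp (Cm labS) (rcomp (Cm labS) X Y) Z = rcomp (Cm labS) X (rcomp (Cm labS) Y Z)"
    if XYZ: "X \<subseteq> L" "Y \<subseteq> L" "Z \<subseteq> L" for X Y Z
  proof (intro set_eqI iffI)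
    fix a assume "a \<in> rcomp (Cm labS) (rcomp (Cm labS) X Y) Z"
    then obtain b c d e where *: "a \<in> L" "tri a b c" "b \<in> L" "c \<in> Z" "d \<in> X" "e \<in> Y" "tri b d e"
      unfolding labS_ops by blast
    then obtain b' where "b' \<in> L" "tri a d b'" "tri b' e c" using tri_assoc[of a b c d e] XYZ by auto
    then show "a \<in> rcomp (Cm labS) X (rcomp (Cm labS) Y Z)" using * unfolding labS_ops by blast
  next
    fix a assume "a \<in> rcomp (Cm labS) X (rcomp (Cm labS) Y Z)"
    then obtain b c d e where *: "a \<in> L" "tri a d b" "b \<in> L" "c \<in> Z" "d \<in> X" "e \<in> Y" "tri b e c"
      unfolding labS_ops by blast
    \<comment> \<open>\<open>tri\<close> is symmetric, so reversing the products reduces this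
      inclusion to \<open>tri_assoc\<close> again.\<close>
    then have "tri a b d" "tri b c e" by (metis tri_rot)+
    then obtain b' where b': "b' \<in> L" "tri a c b'" "tri b' e d" using tri_assoc[of a b d c e] XYZ * by auto
    then have "tri a b' c" "tri b' d e" by (metis tri_rot)+
    then show "a \<in> rcomp (Cm labS) (rcomp (Cm labS) X Y) Z" using * b' unfolding labS_ops by blast
  qed
  have cl: "closed_under RA_sig (Cm labS) (elems (Cm labS))" using closed_under_Cm[of RA_sig labS] by simp
  have 2: "rcomp (Cm labS) X (ident (Cm labS)) = X" "rconv (Cm labS) (rconv (Cm labS) X) = X"
    "rconv (Cm labS) (X \<union> Y) = rconv (Cm labS) X \<union> rconv (Cm labS) Y"
    "rconv (Cm labS) (rcomp (Cm labS) X Y) = rcomp (Cm labS) (rconv (Cm labS) Y) (rconv (Cm labS) X)"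
    "rcomp (Cm labS) (rconv (Cm labS) X) (L - rcomp (Cm labS) X Y) \<subseteq> L - Y"
    "rcomp (Cm labS) (X \<union> Y) Z = rcomp (Cm labS) X Z \<union> rcomp (Cm labS) Y Z"
    if "X \<subseteq> L" "Y \<subseteq> L" for X Y Z
  proof -
    show "rconv (Cm labS) (rcomp (Cm labS) X Y) = rcomp (Cm labS) (rconv (Cm labS) Y) (rconv (Cm labS) X)"
      unfolding labS_ops using that tri_rot(2) by blast
    show "rcomp (Cm labS) (rconv (Cm labS) X) (L - rcomp (Cm labS) X Y) \<subseteq> L - Y"
    proof
      fix a assume "a \<in> rcomp (Cm labS) (rconv (Cm labS) X) (L - rcomp (Cm labS) X Y)"
      then obtain b c where *: "a \<in> L" "b \<in> X" "c \<in> L" "c \<notin> rcomp (Cm labS) X Y" "tri a b c"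
        unfolding labS_ops by blast
      have "tri c b a" using *(5) by (metis tri_rot)
      then have "a \<notin> Y" using * unfolding labS_ops by blast
      then show "a \<in> L - Y" using * by blast
    qed
  qed (use that in \<open>auto simp: labS_ops\<close>)
  show ?thesis
    unfolding RA_def below_def
    using boolean_alg_Cm[of labS] cl assoc 2 by (simp add: subset_Un_eq[symmetric])
qed

subsection \<open>Representable subalgebra\<close>

definition lsimilar :: "nat \<Rightarrow> nat \<Rightarrow> nat \<Rightarrow> bool" where
  "lsimilar m a b \<longleftrightarrow> (\<exists>\<kappa>. perm_above m \<kappa> \<and> lsim m \<kappa> a b)"

lemma lsimilar_sym: "lsimilar m a b \<Longrightarrow> lsimilar m b a"
  unfolding lsimilar_def using lsim_sym perm_above_inv by blast

lemma lsimilar_trans: "lsimilar m a b \<Longrightarrow> lsimilar m b c \<Longrightarrow> lsimilar m a c"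
  unfolding lsimilar_def using lsim_trans perm_above_comp by blast

lemma lsimilar_mono: "lsimilar m' a b \<Longrightarrow> m \<le> m' \<Longrightarrow> lsimilar m a b"
  unfolding lsimilar_def using lsim_mono perm_above_mono by blast

lemma lsimilar_zero: "lsimilar m a b \<Longrightarrow> a = 0 \<longleftrightarrow> b = 0"
  by (auto simp: lsimilar_def lsim_def)

text \<open>A label is a network on two points and a decomposition of it adds a third, so this is
  \<open>sim_extension\<close> over two points, fewer than n.\<close>

lemma lsimilar_extension:
  assumes t: "tri a b c" and s: "lsimilar m a' a"
  obtains b' c' where "tri a' b' c'" "lsimilar m b' b" "lsimilar m c' c" "a' \<in> L \<Longrightarrow> b' \<in> L \<and> c' \<in> L"
proof -
  let ?f = "add_point 1 (\<lambda>_. a') (\<lambda>_. 0)" and ?g = "triangle_net a b c"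
  obtain \<kappa> where \<kappa>: "perm_above m \<kappa>" "lsim m \<kappa> a' a" using s by (auto simp: lsimilar_def)
  have "sim m {0, 1} ?f ?g"
    unfolding sim_def using \<kappa> by (intro exI[of _ \<kappa>]) (auto simp: add_point_def lsim_def)
  note fg = this
  have g: "net_on (insert 2 {0, 1}) ?g"
    using net_on_triangle[OF t] by (simp add: insert_commute)
  have c: "finite {0, 1 :: nat}" "card {0, 1 :: nat} < n" using n by auto
  obtain \<psi> \<kappa>' where \<psi>: "perm_above m \<kappa>'" "point_ext {0, 1} ?f \<psi>"
    "\<forall>x\<in>{0, 1}. \<forall>y\<in>{0, 1}. lsim m \<kappa>' (?f (x, y)) (?g (x, y))"
    "\<forall>x\<in>{0, 1}. lsim m \<kappa>' (\<psi> x) (?g (2, x))"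
    "(\<forall>x\<in>{0, 1}. \<forall>y\<in>{0, 1}. ?f (x, y) \<in> L) \<longrightarrow> (\<forall>x\<in>{0, 1}. \<psi> x \<in> L)"
    by (rule sim_extension[OF net_on_edge g fg c])
  have "tri (?f (0, 1)) (\<psi> 0) (\<psi> 1)" using \<psi>(2) unfolding point_ext_def by blast
  then have "tri a' (\<psi> 0) (\<psi> 1)" by (simp add: add_point_def)
  moreover have "lsimilar m (\<psi> 0) b" "lsimilar m (\<psi> 1) c" using \<psi>(1,4) by (auto simp: lsimilar_def)
  moreover have "\<psi> 0 \<in> L \<and> \<psi> 1 \<in> L" if "a' \<in> L" using \<psi>(5) that by (auto simp: add_point_def)
  ultimately show thesis using that by blast
qed

lemma lsimilar_realise:
  obtains a' where "a' \<in> L" "lsimilar m a' a"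
proof -
  have c: "finite {0, 1 :: nat}" "card {0, 1 :: nat} \<le> n" using n by auto
  obtain f where f: "net_on {0, 1} f" "sim m {0, 1} f (add_point 1 (\<lambda>_. a) (\<lambda>_. 0))"
    "\<forall>x\<in>{0, 1}. \<forall>y\<in>{0, 1}. f (x, y) \<in> L"
    by (rule realisation[OF net_on_edge c])
  have "lsimilar m (f (0, 1)) a"
    using f(2) by (auto simp: sim_def lsimilar_def add_point_def)
  then show thesis using that f(3) by blast
qed

definition lsupp :: "nat \<Rightarrow> nat set \<Rightarrow> bool" where
  "lsupp m X \<longleftrightarrow> X \<subseteq> L \<and> (\<forall>a\<in>X. \<forall>b\<in>L. lsimilar m b a \<longrightarrow> b \<in> X)"

definition lfin_supp :: "nat set set" where "lfin_supp = {X. \<exists>m. lsupp m X}"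

lemma lsupp_mono: "lsupp m X \<Longrightarrow> m \<le> m' \<Longrightarrow> lsupp m' X"
  unfolding lsupp_def using lsimilar_mono by blast

lemma lsupp_join:
  assumes "X \<in> lfin_supp" "Y \<in> lfin_supp"
  obtains m where "lsupp m X" "lsupp m Y"
proof -
  obtain m m' where "lsupp m X" "lsupp m' Y" using assms by (auto simp: lfin_supp_def)
  then have "lsupp (max m m') X" "lsupp (max m m') Y" using lsupp_mono by simp_all
  then show thesis using that by blast
qed

lemma lsupp_ops:
  "lsupp m {}" "lsupp m L" "lsupp m {0}" "lsupp m X \<Longrightarrow> lsupp m Y \<Longrightarrow> lsupp m (X \<union> Y)"
  "lsupp m X \<Longrightarrow> lsupp m Y \<Longrightarrow> lsupp m (X \<inter> Y)"
  using lsimilar_zero by (auto simp: lsupp_def)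

lemma lsupp_neg: "lsupp m X \<Longrightarrow> lsupp m (L - X)"
  unfolding lsupp_def using lsimilar_sym by blast

lemma lsupp_comp:
  assumes "lsupp m X" "lsupp m Y"
  shows "lsupp m (rcomp (Cm labS) X Y)"
  unfolding lsupp_def labS_ops
proof (intro conjI ballI impI)
  fix a a' assume "a \<in> {a \<in> L. \<exists>b\<in>X. \<exists>c\<in>Y. tri a b c}" and a': "a' \<in> L" "lsimilar m a' a"
  then obtain b c where bc: "b \<in> X" "c \<in> Y" "tri a b c" by blast
  obtain b' c' where "tri a' b' c'" "lsimilar m b' b" "lsimilar m c' c" "b' \<in> L \<and> c' \<in> L"
    using lsimilar_extension[OF bc(3) a'(2)] a'(1) by metis
  then show "a' \<in> {a \<in> L. \<exists>b\<in>X. \<exists>c\<in>Y. tri a b c}" using assms a' bc unfolding lsupp_def by blast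
qed auto

lemma RA_sig_cases:
  assumes "(f, length xs) \<in> RA_sig"
  obtains (i) "f = Ident" "xs = []" | (c) x where "f = Conv" "xs = [x]" | (m) x y where "f = Comp" "xs = [x, y]"
  using assms by (auto simp: RA_sig_def length_Suc_conv numeral_2_eq_2)

lemma lfin_supp_closed: "closed_under RA_sig (Cm labS) lfin_supp"
proof -
  have op: "oper (Cm labS) f Xs \<in> lfin_supp" if fX: "(f, length Xs) \<in> RA_sig" "set Xs \<subseteq> lfin_supp" for f Xs
    using fX(1)
  proof (cases rule: RA_sig_cases)
    case i
    then show ?thesis using lsupp_ops(3) by (auto simp: lfin_supp_def labS_ops)
  next
    case (c X)
    then obtain m where m: "lsupp m X" using fX(2) by (auto simp: lfin_supp_def)
    then have "X \<inter> L = X" by (auto simp: lsupp_def)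
    then show ?thesis using c m by (auto simp: lfin_supp_def labS_ops)
  next
    case (m X Y)
    obtain k where "lsupp k X" "lsupp k Y" using lsupp_join[of X Y] m fX(2) by auto
    then show ?thesis using lsupp_comp m by (auto simp: lfin_supp_def)
  qed
  have bool: "X \<union> Y \<in> lfin_supp" "X \<inter> Y \<in> lfin_supp" "L - X \<in> lfin_supp"
    if XY: "X \<in> lfin_supp" "Y \<in> lfin_supp" for X Y
  proof -
    obtain m where m: "lsupp m X" "lsupp m Y" using lsupp_join[OF XY] .
    show "X \<union> Y \<in> lfin_supp" "X \<inter> Y \<in> lfin_supp" "L - X \<in> lfin_supp"
      using lsupp_ops(4,5)[OF m] lsupp_neg[OF m(1)] by (auto simp: lfin_supp_def)
  qed
  have "lfin_supp \<subseteq> Pow L" by (auto simp: lfin_supp_def lsupp_def)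
  moreover have "{} \<in> lfin_supp" "L \<in> lfin_supp" using lsupp_ops by (auto simp: lfin_supp_def)
  ultimately show ?thesis using op bool unfolding closed_under_def by auto
qed

lemma lfin_supp_singleton:
  assumes "a \<in> L"
  shows "{a} \<in> lfin_supp"
proof -
  have "b = a" if "lsimilar (Suc (clq a)) b a" for b
    using that assms by (auto simp: lsimilar_def lsim_def L_def)
  then have "lsupp (Suc (clq a)) {a}" using assms by (auto simp: lsupp_def)
  then show ?thesis by (auto simp: lfin_supp_def)
qed

end

section \<open>Evaluation of supported sets of labels as binary relations\<close>

context monk_model
begin

definition linterp :: "nat set \<Rightarrow> nat rel" where
  "linterp X = {(x, y). \<forall>m. \<exists>a\<in>X. lsimilar m a (N (x, y))}"

lemma linterp_iff:
  assumes X: "lsupp m X"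
  shows "(x, y) \<in> linterp X \<longleftrightarrow> (\<exists>a\<in>X. lsimilar m a (N (x, y)))"
proof
  assume "\<exists>a\<in>X. lsimilar m a (N (x, y))"
  then obtain a where a: "a \<in> X" "lsimilar m a (N (x, y))" by blast
  have "\<exists>b\<in>X. lsimilar m' b (N (x, y))" for m'
  proof -
    obtain b where b: "b \<in> L" "lsimilar (max m m') b (N (x, y))" by (rule lsimilar_realise)
    have "lsimilar m b a" "lsimilar m' b (N (x, y))"
      using lsimilar_trans[OF lsimilar_mono[OF b(2)] lsimilar_sym[OF a(2)]] lsimilar_mono[OF b(2)] by auto
    then show ?thesis using X a b unfolding lsupp_def by blast
  qed
  then show "(x, y) \<in> linterp X" by (simp add: linterp_def)
qed (simp add: linterp_def)

lemma linterp_iff_lab: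
  assumes X: "lsupp m X" and a: "a \<in> L" "lsimilar m a (N (x, y))"
  shows "(x, y) \<in> linterp X \<longleftrightarrow> a \<in> X"
  using linterp_iff[OF X] a X lsimilar_trans lsimilar_sym unfolding lsupp_def by blast

lemma N_triangle:
  assumes t: "tri (N (x, y)) b c"
  obtains z where "N (x, z) = b" "N (z, y) = c"
proof -
  let ?s = "\<lambda>k. if k = 0 then x else y"
  have "net_on (insert 2 {0, 1}) (triangle_net (N (x, y)) b c)"
    using net_on_triangle[OF t] by (simp add: insert_commute)
  moreover have "N (?s i, ?s j) = triangle_net (N (x, y)) b c (i, j)" if "i \<in> {0, 1}" "j \<in> {0, 1}" for i j
    using that N_zero[of x x] N_zero[of y y] N_sym[of x y] by auto
  ultimately obtain z where z: "\<And>i. i \<in> {0, 1} \<Longrightarrow> N (z, ?s i) = triangle_net (N (x, y)) b c (2, i)"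
    using N_point[of "{0, 1}" 2 "triangle_net (N (x, y)) b c" ?s] n by auto
  show thesis using that[of z] z[of 0] z[of 1] N_sym[of x z] by simp
qed

text \<open>A decomposition of a real label is copied to one of \<open>N (x, y)\<close>, for which
  the structure has a middle point. Conversely, the two labels at a middle point are approximated by
  real ones that decompose an approximation of \<open>N (x, y)\<close>.\<close>

lemma linterp_comp:
  assumes XY: "lsupp m X" "lsupp m Y"
  shows "linterp (rcomp (Cm labS) X Y) = linterp X O linterp Y"
proof (intro set_eqI iffI; clarify)
  fix x y assume "(x, y) \<in> linterp (rcomp (Cm labS) X Y)"
  then obtain a b c where abc: "tri a b c" "b \<in> X" "c \<in> Y" "lsimilar m a (N (x, y))"
    using linterp_iff[OF lsupp_comp[OF XY]] unfolding labS_ops by blast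
  obtain b' c' where t: "tri (N (x, y)) b' c'" "lsimilar m b' b" "lsimilar m c' c"
    using lsimilar_extension[OF abc(1) lsimilar_sym[OF abc(4)]] by metis
  obtain z where z: "N (x, z) = b'" "N (z, y) = c'" using N_triangle[OF t(1)] .
  then have "(x, z) \<in> linterp X" "(z, y) \<in> linterp Y"
    using linterp_iff[OF XY(1)] linterp_iff[OF XY(2)] abc t lsimilar_sym by blast+
  then show "(x, y) \<in> linterp X O linterp Y" by blast
next
  fix x y z assume z: "(x, z) \<in> linterp X" "(z, y) \<in> linterp Y"
  have t: "tri (N (x, y)) (N (x, z)) (N (z, y))" using net_onD(3)[OF N_net] by simp
  obtain a where a: "a \<in> L" "lsimilar m a (N (x, y))" by (rule lsimilar_realise)
  obtain b c where bc: "tri a b c" "lsimilar m b (N (x, z))" "lsimilar m c (N (z, y))" "b \<in> L \<and> c \<in> L"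
    using lsimilar_extension[OF t a(2)] a(1) by metis
  then have "b \<in> X" "c \<in> Y" using linterp_iff_lab XY z by blast+
  then have "a \<in> rcomp (Cm labS) X Y" using a bc unfolding labS_ops by blast
  then show "(x, y) \<in> linterp (rcomp (Cm labS) X Y)" using linterp_iff[OF lsupp_comp[OF XY]] a by blast
qed

lemma linterp_hom: "homomorphism RA_sig linterp ((Cm labS)\<lparr>elems := lfin_supp\<rparr>) (rel_algebra UNIV)"
proof -
  have bool: "linterp (X \<union> Y) = linterp X \<union> linterp Y" "linterp (X \<inter> Y) = linterp X \<inter> linterp Y"
    "linterp (L - X) = UNIV - linterp X" if XY: "X \<in> lfin_supp" "Y \<in> lfin_supp" for X Y
  proof -
    obtain m where m: "lsupp m X" "lsupp m Y" using lsupp_join[OF XY] .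
    have *: "((x, y) \<in> linterp (X \<union> Y) \<longleftrightarrow> (x, y) \<in> linterp X \<or> (x, y) \<in> linterp Y) \<and>
        ((x, y) \<in> linterp (X \<inter> Y) \<longleftrightarrow> (x, y) \<in> linterp X \<and> (x, y) \<in> linterp Y) \<and>
        ((x, y) \<in> linterp (L - X) \<longleftrightarrow> (x, y) \<notin> linterp X)" for x y
    proof -
      obtain a where a: "a \<in> L" "lsimilar m a (N (x, y))" by (rule lsimilar_realise)
      show ?thesis
        using linterp_iff_lab[OF m(1) a] linterp_iff_lab[OF m(2) a] linterp_iff_lab[OF lsupp_ops(4)[OF m] a]
          linterp_iff_lab[OF lsupp_ops(5)[OF m] a] linterp_iff_lab[OF lsupp_neg[OF m(1)] a] a(1)
        by blast
    qed
    show "linterp (X \<union> Y) = linterp X \<union> linterp Y" "linterp (X \<inter> Y) = linterp X \<inter> linterp Y"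
      "linterp (L - X) = UNIV - linterp X"
      using * by auto
  qed
  have top: "linterp {} = {}" "linterp L = UNIV"
    using lsimilar_realise unfolding linterp_def by auto blast
  have op: "linterp (oper (Cm labS) f Xs) = rel_oper UNIV f (map linterp Xs)"
    if fX: "(f, length Xs) \<in> RA_sig" "set Xs \<subseteq> lfin_supp" for f Xs
    using fX(1)
  proof (cases rule: RA_sig_cases)
    case i
    have "(x, y) \<in> linterp {0} \<longleftrightarrow> x = y" for x y
    proof -
      obtain a where a: "a \<in> L" "lsimilar 0 a (N (x, y))" by (rule lsimilar_realise)
      show ?thesis using linterp_iff_lab[OF lsupp_ops(3) a] lsimilar_zero[OF a(2)] N_zero[of x y] by simp
    qed
    then show ?thesis using i by (auto simp: labS_ops)
  next
    case (c X)
    then have "X \<inter> L = X" using fX(2) by (auto simp: lfin_supp_def lsupp_def)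
    moreover have "(linterp X)\<inverse> = linterp X" using N_sym by (auto simp: linterp_def)
    ultimately show ?thesis using c by (simp add: labS_ops)
  next
    case (m X Y)
    obtain k where "lsupp k X" "lsupp k Y" using lsupp_join[of X Y] m fX(2) by auto
    then show ?thesis using linterp_comp m by simp
  qed
  show ?thesis
    unfolding homomorphism_def using bool top op by (auto simp: rel_algebra_def)
qed

lemma linterp_nonempty:
  assumes X: "X \<in> lfin_supp" "X \<noteq> {}"
  shows "linterp X \<noteq> {}"
proof -
  obtain a m where a: "a \<in> X" and m: "lsupp m X" using X by (auto simp: lfin_supp_def)
  \<comment> \<open>The point \<open>0\<close> is arbitrary: splitting its identity label gives it a
    neighbour at label \<open>a\<close>.\<close>
  have "tri (N (0, 0)) a a" using N_zero[of 0 0] by simp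
  then obtain z where "N (0, z) = a" by (rule N_triangle)
  then have "(0, z) \<in> linterp X"
    using a linterp_iff[OF m] perm_above_id lsim_refl unfolding lsimilar_def by blast
  then show ?thesis by blast
qed

lemma linterp_inj: "inj_on linterp lfin_supp"
proof (rule inj_onI)
  fix X Y assume XY: "X \<in> lfin_supp" "Y \<in> lfin_supp" "linterp X = linterp Y"
  have sub: "X \<subseteq> Y" if XY: "X \<in> lfin_supp" "Y \<in> lfin_supp" "linterp X = linterp Y" for X Y
  proof -
    have Z: "L - Y \<in> lfin_supp" "X \<inter> (L - Y) \<in> lfin_supp"
      using closed_under_simps(4,5)[OF lfin_supp_closed] XY by auto
    have "linterp (X \<inter> (L - Y)) = linterp X \<inter> (UNIV - linterp Y)"
      using linterp_hom XY Z(1) unfolding homomorphism_def by (simp add: rel_algebra_def)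
    then have "X \<inter> (L - Y) = {}" using linterp_nonempty[OF Z(2)] XY(3) by auto
    moreover have "X \<subseteq> L" using XY(1) by (auto simp: lfin_supp_def lsupp_def)
    ultimately show ?thesis by blast
  qed
  show "X = Y" using sub[OF XY] sub[OF XY(2,1) XY(3)[symmetric]] by blast
qed

lemma lfin_supp_representable:
  "in_product RA_sig rel_algebra ((Cm labS)\<lparr>elems := lfin_supp\<rparr>) {()} (\<lambda>_. UNIV :: nat set)"
  by (rule in_product_singleI[where F = rel_algebra and U = UNIV, OF _ linterp_hom])
    (use closed_under_self[OF lfin_supp_closed] linterp_inj in simp_all)

end

section \<open>Non-representability of the complex algebras\<close>

text \<open>\<open>Ramsey2\<close> colours two-element sets; minimum and maximum turn
  \<open>c\<close>, which may be asymmetric, into such a colouring.\<close>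

lemma Ramsey_triple:
  fixes c :: "nat \<Rightarrow> nat \<Rightarrow> nat"
  assumes "\<And>p q. p < q \<Longrightarrow> c p q < k"
  obtains p q r t where "p < q" "q < r" "c p q = t" "c p r = t" "c q r = t"
proof -
  define f where "f A = c (Min A) (Max A)" for A
  have f: "f {p, q} = c (min p q) (max p q)" for p q by (simp add: f_def)
  have "\<forall>p\<in>UNIV. \<forall>q\<in>UNIV. p \<noteq> q \<longrightarrow> f {p, q} < k"
    unfolding f using assms by (auto simp: min_def max_def)
  then obtain Y t where Y: "infinite Y" "\<forall>p\<in>Y. \<forall>q\<in>Y. p \<noteq> q \<longrightarrow> f {p, q} = t"
    using Ramsey2[OF infinite_UNIV_nat, of f k] by blast
  obtain p where p: "p \<in> Y" using Y(1) by (metis finite.emptyI ex_in_conv)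
  obtain q where q: "q \<in> Y" "p < q" using Y(1) by (meson infinite_nat_iff_unbounded)
  obtain r where r: "r \<in> Y" "q < r" using Y(1) by (meson infinite_nat_iff_unbounded)
  have c: "c x y = t" if "x \<in> Y" "y \<in> Y" "x < y" for x y
    using Y(2) that unfolding f by (metis less_imp_le max_absorb2 min_absorb1 less_irrefl)
  show thesis
    using that[of p q r t] c[of p q] c[of p r] c[of q r] p q r by simp
qed

context monk
begin

text \<open>The mixed radix number \<open>t\<close> lists the n * n^2 pairs of a colour and a
  vertex; the clique stays free.\<close>

definition cell :: "nat \<Rightarrow> nat set" where
  "cell t = {a \<in> L. a \<noteq> 0 \<and> col a + n * vtx a = t}"

lemma cell_cover: "L - {0} = (\<Union>t<n * (n * n). cell t)"
proof -
  have "col a + n * vtx a < n * (n * n)" for a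
  proof -
    have "col a + n * vtx a < n * Suc (vtx a)" by simp
    also have "\<dots> \<le> n * (n * n)" using vtx_less[of a] by (intro mult_le_mono order_refl Suc_leI)
    finally show ?thesis .
  qed
  then show ?thesis by (auto simp: cell_def)
qed

lemma cell_subset: "cell t \<subseteq> L" by (auto simp: cell_def)

text \<open>Labels of a cell agree in their vertex, so no two of them are adjacent, in one clique or
  in two. The self-adjacent limit labels are not in \<open>L\<close>.\<close>

lemma cell_independent:
  assumes "a \<in> cell t" "b \<in> cell t" "c \<in> cell t"
  shows "\<not> tri a b c"
proof -
  have n0: "0 < n" using n by simp
  have "col a = col b \<and> vtx a = vtx b" if "a \<in> cell t" "b \<in> cell t" for a b
  proof -
    have "col a + n * vtx a = col b + n * vtx b" using that by (auto simp: cell_def)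
    then have "(col a + n * vtx a) mod n = (col b + n * vtx b) mod n" "(col a + n * vtx a) div n = (col b + n * vtx b) div n"
      by simp_all
    then show ?thesis using n0 by simp
  qed
  from this[OF assms(1,2)] this[OF assms(2,3)] show ?thesis
    using assms by (auto simp: tri_pos adj_def cell_def L_def)
qed

text \<open>One label from each real clique; the successor skips the limit clique. These infinitely
  many labels force infinitely many points on a representation.\<close>

definition fresh :: "nat \<Rightarrow> nat" where "fresh m = lab 0 (Suc m) 0"

lemma fresh: "fresh m \<in> L" "fresh m = fresh m' \<longleftrightarrow> m = m'"
proof -
  have c: "0 < n" "0 < n * n" using n by auto
  then show "fresh m \<in> L" by (simp add: fresh_def lab_in_L)
  have "clq (fresh m) = Suc m" for m using c by (simp add: fresh_def)
  then show "fresh m = fresh m' \<longleftrightarrow> m = m'" by (metis nat.inject)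
qed

lemma zero_net: "restrict (\<lambda>_. 0) ({..<n} \<times> {..<n}) \<in> nets"
  by (rule restrict_nets) (auto simp: net_on_def)

definition has_label :: "nat \<Rightarrow> nat \<Rightarrow> nat set \<Rightarrow> (nat \<times> nat \<Rightarrow> nat) set" where
  "has_label j k X = {f \<in> nets. f (j, k) \<in> X}"

lemma cyl_has_label:
  assumes "j < n" "k < n" "l < n" "l \<noteq> j" "l \<noteq> k"
  shows "cyl (Cm netS) l (has_label j k X) = has_label j k X"
proof -
  have "f (j, k) = g (j, k)" if "agree_off n {l} f g" for f g :: "nat \<times> nat \<Rightarrow> nat"
    using that assms by (auto simp: agree_off_def)
  then have "f (j, k) \<in> X" if "g \<in> has_label j k X" "agree_off n {l} f g" for f g
    using that unfolding has_label_def by (metis (no_types, lifting) mem_Collect_eq)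
  then have "cyl (Cm netS) l (has_label j k X) \<subseteq> has_label j k X"
    unfolding netS_ops by (auto simp: has_label_def)
  moreover have "has_label j k X \<subseteq> cyl (Cm netS) l (has_label j k X)"
    unfolding netS_ops by (auto simp: has_label_def intro: agree_off_refl)
  ultimately show ?thesis by blast
qed

text \<open>Every point has a partner at any given real label. In a non-trivial representation each
  value of one coordinate is thus joined by that label to a value of the other.\<close>

lemma cyl_has_label_singleton:
  assumes jk: "j < n" "k < n" "j \<noteq> k" and a: "a \<in> L" and i: "i = j \<or> i = k"
  shows "cyl (Cm netS) i (has_label j k {a}) = nets"
proof -
  have "\<exists>g\<in>has_label j k {a}. agree_off n {i} f g" if f: "f \<in> nets" for f
  proof -
    obtain l where l: "l < n" "l \<noteq> i" "{i, l} = {j, k}" using i jk by auto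
    have "i < n" using i jk by auto
    have "point_ext {l} f (\<lambda>_. a)" using netsD(3)[OF f l(1)] by (simp add: point_ext_def)
    then obtain g where g: "g \<in> nets" "agree_off n {i} f g" "g (i, l) = a"
      using extend_net[OF f \<open>i < n\<close>, of "{l}" "\<lambda>_. a"] l a by (metis DiffI emptyE empty_subsetI insertE insertI1 insert_subset lessThan_iff)
    then have "g (j, k) = a" using l netsD(4)[OF g(1), of i l] \<open>i < n\<close> by (auto simp: doubleton_eq_iff)
    then show ?thesis using g by (auto simp: has_label_def)
  qed
  then show ?thesis unfolding netS_ops by blast
qed

text \<open>In the diagonal-free reduct, the three coordinates of a representation are unrelated sorts.
  The images of the identity label translate between them, and Ramsey's theorem is applied to a
  sequence of triples \<open>(x, y, z)\<close> of translated points.\<close>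

lemma Cm_netS_not_Df_representable:
  fixes U :: "'i \<Rightarrow> 'u set"
  assumes "in_product (Df_sig n) (set_algebra n) (Cm netS) I U"
  shows False
proof -
  have "bzero (Cm netS) \<in> elems (Cm netS)" "bone (Cm netS) \<in> elems (Cm netS)" "bzero (Cm netS) \<noteq> bone (Cm netS)"
    using zero_net by auto
  then obtain i0 g where hom: "homomorphism (Df_sig n) g (Cm netS) (set_algebra n (U i0))" and "g (bzero (Cm netS)) \<noteq> g (bone (Cm netS))"
    by (rule in_product_component[OF assms])
  then have ne: "g {} \<noteq> g nets" by simp
  define V where "V = U i0"
  note hs = homomorphism_simps[OF hom[folded V_def]]
  have g0: "g {} = {}" "g nets = seqs n V" using hs(1,2) by (simp_all add: set_algebra_def)
  have gUn: "g (X \<union> Y) = g X \<union> g Y" "g (X \<inter> Y) = g X \<inter> g Y" if "X \<subseteq> nets" "Y \<subseteq> nets" for X Y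
    using hs(3,4)[of X Y] that by (simp_all add: set_algebra_def)
  have gmono: "g X \<subseteq> g Y" if "X \<subseteq> Y" "Y \<subseteq> nets" for X Y
    using gUn(1)[of X Y] that by (metis Un_upper1 subset_Un_eq subset_trans)
  have gsub: "g X \<subseteq> seqs n V" if "X \<subseteq> nets" for X using gmono[OF that] g0 by simp
  have gcyl: "g (cyl (Cm netS) i X) = {s \<in> seqs n V. \<exists>t\<in>g X. \<forall>j<n. j \<noteq> i \<longrightarrow> t j = s j}"
    if "X \<subseteq> nets" "i < n" for X i
  proof -
    have "(Cyl i, Suc 0) \<in> Df_sig n" using that by (simp add: Df_sig_def)
    then show ?thesis using hs(7)[of "Cyl i" X] that by (simp add: set_algebra_def)
  qed
  have hl: "has_label j k X \<subseteq> nets" for j k X by (auto simp: has_label_def)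
  have inv: "s' \<in> g (has_label j k X)"
    if s: "s \<in> g (has_label j k X)" and s': "s' \<in> seqs n V" and eq: "s' j = s j" "s' k = s k" and jk: "j < n" "k < n"
    for s s' j k X
  proof -
    have sV: "s \<in> seqs n V" using s gsub[OF hl] by blast
    \<comment> \<open>\<open>t p\<close> has its first \<open>p\<close> coordinates from
      \<open>s'\<close>. Each change, unless at \<open>j\<close> or \<open>k\<close>, is made by a
      cylindrifier that fixes the element.\<close>
    define t where "t p = (\<lambda>x. if x < p then s' x else s x)" for p
    have "t p \<in> g (has_label j k X)" if "p \<le> n" for p
      using that
    proof (induction p)
      case 0
      then show ?case using s by (simp add: t_def)
    next
      case (Suc p)
      have tS: "t (Suc p) = (t p)(p := s' p)" by (auto simp: t_def less_Suc_eq)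
      show ?case
      proof (cases "p = j \<or> p = k")
        case True
        then have "t (Suc p) = t p" using eq tS by (auto simp: t_def fun_eq_iff)
        then show ?thesis using Suc by simp
      next
        case False
        have "t (Suc p) \<in> seqs n V" using sV s' by (auto simp: t_def PiE_iff extensional_def)
        moreover have "\<forall>l<n. l \<noteq> p \<longrightarrow> t p l = t (Suc p) l" using tS by simp
        ultimately have "t (Suc p) \<in> g (cyl (Cm netS) p (has_label j k X))"
          using gcyl[OF hl, of p] Suc by auto
        then show ?thesis using cyl_has_label[OF jk, of p X] False Suc.prems by auto
      qed
    qed
    moreover have "t n = s'" using sV s' by (auto simp: t_def PiE_iff extensional_def fun_eq_iff)
    ultimately show ?thesis by blast
  qed
  have n012: "0 < n" "1 < n" "2 < n" using n by auto
  \<comment> \<open>The argument uses the coordinates 0, 1 and 2; all others are filled with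
    \<open>x\<close>.\<close>
  define tup where "tup x y z = (\<lambda>k\<in>{..<n}. if k = 1 then y else if k = 2 then z else x)" for x y z :: 'u
  have tup: "tup x y z \<in> seqs n V" "tup x y z 0 = x" "tup x y z 1 = y" "tup x y z 2 = z"
    if "x \<in> V" "y \<in> V" "z \<in> V" for x y z
    using that n012 by (auto simp: tup_def)
  \<comment> \<open>By \<open>inv\<close> each of these relations depends on the two named
    coordinates, and the remaining argument of \<open>tup\<close> is a filler.\<close>
  define E01 where "E01 X x y \<longleftrightarrow> tup x y x \<in> g (has_label 0 1 X)" for X x y
  define E02 where "E02 X x z \<longleftrightarrow> tup x x z \<in> g (has_label 0 2 X)" for X x z
  define E12 where "E12 X y z \<longleftrightarrow> tup y y z \<in> g (has_label 1 2 X)" for X y z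
  have E: "tup x y z \<in> g (has_label 0 1 X) \<longleftrightarrow> E01 X x y" "tup x y z \<in> g (has_label 0 2 X) \<longleftrightarrow> E02 X x z"
    "tup x y z \<in> g (has_label 1 2 X) \<longleftrightarrow> E12 X y z"
    if V: "x \<in> V" "y \<in> V" "z \<in> V" for x y z X
  proof -
    show "tup x y z \<in> g (has_label 0 1 X) \<longleftrightarrow> E01 X x y"
      unfolding E01_def using inv[OF _ _ _ _ n012(1,2)] tup V by metis
    show "tup x y z \<in> g (has_label 0 2 X) \<longleftrightarrow> E02 X x z"
      unfolding E02_def using inv[OF _ _ _ _ n012(1,3)] tup V by metis
    show "tup x y z \<in> g (has_label 1 2 X) \<longleftrightarrow> E12 X y z"
      unfolding E12_def using inv[OF _ _ _ _ n012(2,3)] tup V by metis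
  qed
  have netD: "f (0, 2) = f (0, 1)" if "f \<in> nets" "f (1, 2) = 0" for f
    using net_on_zero(2)[OF netsD(1)[OF that(1)], of 1 2 0] that n012 by simp
  have netD': "f (1, 2) = f (0, 2)" if "f \<in> nets" "f (0, 1) = 0" for f
    using net_on_zero(1)[OF netsD(1)[OF that(1)], of 0 1 2] that n012 by simp
  have netT: "tri (f (0, 2)) (f (0, 1)) (f (1, 2))" if "f \<in> nets" for f
    using net_onD(3)[OF netsD(1)[OF that], of 0 1 2] n012 by simp
  \<comment> \<open>Label \<open>0\<close> between the sorts 1 and 2 carries a label seen from sort
    0 across; \<open>r2\<close> uses label \<open>0\<close> between the sorts 0 and 1 in the same
    way.\<close>
  have r1: "E02 X x z" if "E01 X x y" "E12 {0} y z" "x \<in> V" "y \<in> V" "z \<in> V" for X x y z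
  proof -
    have "tup x y z \<in> g (has_label 0 1 X \<inter> has_label 1 2 {0})"
      using that(1,2) E[OF that(3-5)] gUn(2)[OF hl hl] by simp
    moreover have "has_label 0 1 X \<inter> has_label 1 2 {0} \<subseteq> has_label 0 2 X"
    proof
      fix f assume "f \<in> has_label 0 1 X \<inter> has_label 1 2 {0}"
      then show "f \<in> has_label 0 2 X" using netD[of f] by (simp add: has_label_def)
    qed
    ultimately have "tup x y z \<in> g (has_label 0 2 X)" using gmono[OF _ hl] by blast
    then show ?thesis using E(2)[OF that(3-5)] by simp
  qed
  have r2: "E12 X y z" if "E01 {0} x y" "E02 X x z" "x \<in> V" "y \<in> V" "z \<in> V" for X x y z
  proof -
    have "tup x y z \<in> g (has_label 0 1 {0} \<inter> has_label 0 2 X)"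
      using that(1,2) E[OF that(3-5)] gUn(2)[OF hl hl] by simp
    moreover have "has_label 0 1 {0} \<inter> has_label 0 2 X \<subseteq> has_label 1 2 X"
    proof
      fix f assume "f \<in> has_label 0 1 {0} \<inter> has_label 0 2 X"
      then show "f \<in> has_label 1 2 X" using netD'[of f] by (simp add: has_label_def)
    qed
    ultimately have "tup x y z \<in> g (has_label 1 2 X)" using gmono[OF _ hl] by blast
    then show ?thesis using E(3)[OF that(3-5)] by simp
  qed
  have disj: "a = b" if "E02 {a} x z" "E02 {b} x z" for a b x z
  proof (rule ccontr)
    assume "a \<noteq> b"
    then have "has_label 0 2 {a} \<inter> has_label 0 2 {b} = {}" by (auto simp: has_label_def)
    moreover have "tup x x z \<in> g (has_label 0 2 {a} \<inter> has_label 0 2 {b})"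
      using that gUn(2)[OF hl hl] by (simp add: E02_def)
    ultimately show False using g0 by simp
  qed
  have indep: False if "E01 (cell t) x y" "E02 (cell t) x z" "E12 (cell t) y z" "x \<in> V" "y \<in> V" "z \<in> V" for t x y z
  proof -
    have "tup x y z \<in> g (has_label 0 1 (cell t) \<inter> has_label 0 2 (cell t)) \<inter> g (has_label 1 2 (cell t))"
      using that(1-3) E[OF that(4-6)] gUn(2)[OF hl hl] by simp
    then have "tup x y z \<in> g (has_label 0 1 (cell t) \<inter> has_label 0 2 (cell t) \<inter> has_label 1 2 (cell t))"
      using gUn(2)[of "has_label 0 1 (cell t) \<inter> has_label 0 2 (cell t)" "has_label 1 2 (cell t)"] hl by blast
    moreover have "has_label 0 1 (cell t) \<inter> has_label 0 2 (cell t) \<inter> has_label 1 2 (cell t) = {}"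
      using netT cell_independent unfolding has_label_def by blast
    ultimately show False using g0 by simp
  qed
  have cylE: "\<exists>t\<in>g (has_label j k {a}). \<forall>l<n. l \<noteq> i \<longrightarrow> t l = s l"
    if "s \<in> seqs n V" "j < n" "k < n" "j \<noteq> k" "a \<in> L" "i = j \<or> i = k" for s i j k a
  proof -
    have "i < n" using that by auto
    then have "s \<in> g (cyl (Cm netS) i (has_label j k {a}))"
      using that g0 cyl_has_label_singleton[of j k a i] by simp
    then show ?thesis using gcyl[OF hl \<open>i < n\<close>] by blast
  qed
  have toE: "t k \<in> V" "E01 X (t 0) (t 1) \<longleftrightarrow> t \<in> g (has_label 0 1 X)" "E02 X (t 0) (t 2) \<longleftrightarrow> t \<in> g (has_label 0 2 X)"
    if "t \<in> seqs n V" "k < n" for t k X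
  proof -
    have tV: "t l \<in> V" if "l < n" for l using PiE_mem[OF \<open>t \<in> seqs n V\<close>] that by simp
    note tV = tV[OF n012(1)] tV[OF n012(2)] tV[OF n012(3)] tV[OF \<open>k < n\<close>]
    show "t k \<in> V" by (rule tV(4))
    show "E01 X (t 0) (t 1) \<longleftrightarrow> t \<in> g (has_label 0 1 X)"
      unfolding E01_def using inv[OF _ _ _ _ n012(1,2)] tup[OF tV(1,2,1)] that(1) by metis
    show "E02 X (t 0) (t 2) \<longleftrightarrow> t \<in> g (has_label 0 2 X)"
      unfolding E02_def using inv[OF _ _ _ _ n012(1,3)] tup[OF tV(1,1,3)] that(1) by metis
  qed
  have ex1: "\<exists>y\<in>V. E01 {a} x y" if x: "x \<in> V" "a \<in> L" for x a
  proof -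
    obtain t where t: "t \<in> g (has_label 0 1 {a})" "\<forall>l<n. l \<noteq> 1 \<longrightarrow> t l = tup x x x l"
      using cylE[OF tup(1)[OF x(1,1,1)] n012(1,2) _ x(2), of 1] by auto
    have "t \<in> seqs n V" using t gsub[OF hl] by blast
    then show ?thesis using toE(1)[of t 1] toE(2)[of t 1 "{a}"] t n012 tup(2)[OF x(1,1,1)] by auto
  qed
  have ex0: "\<exists>x\<in>V. E01 {0} x y" if y: "y \<in> V" for y
  proof -
    obtain t where t: "t \<in> g (has_label 0 1 {0})" "\<forall>l<n. l \<noteq> 0 \<longrightarrow> t l = tup y y y l"
      using cylE[OF tup(1)[OF y y y] n012(1,2) _ zero_in_L, of 0] by auto
    have "t \<in> seqs n V" using t gsub[OF hl] by blast
    then show ?thesis using toE(1)[of t 0] toE(2)[of t 1 "{0}"] t n012 tup(3)[OF y y y] by auto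
  qed
  have ex2: "\<exists>z\<in>V. E02 {0} x z" if x: "x \<in> V" for x
  proof -
    obtain t where t: "t \<in> g (has_label 0 2 {0})" "\<forall>l<n. l \<noteq> 2 \<longrightarrow> t l = tup x x x l"
      using cylE[OF tup(1)[OF x x x] n012(1,3) _ zero_in_L, of 2] by auto
    have "t \<in> seqs n V" using t gsub[OF hl] by blast
    then show ?thesis using toE(1)[of t 2] toE(3)[of t 2 "{0}"] t n012 tup(2)[OF x x x] by auto
  qed
  \<comment> \<open>A homomorphism preserves finite unions only. There are finitely many cells, so
    they survive, which the infinitely many single labels need not.\<close>
  have cls: "\<exists>t<n * (n * n). E01 (cell t) x y" if xy: "x \<in> V" "y \<in> V" "\<not> E01 {0} x y" for x y
  proof -
    have fin: "s \<in> g (has_label 0 1 (\<Union>t<q. cell t)) \<Longrightarrow> \<exists>t<q. s \<in> g (has_label 0 1 (cell t))" for q s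
    proof (induction q)
      case 0
      then show ?case using g0 by (simp add: has_label_def)
    next
      case (Suc q)
      have "has_label 0 1 (\<Union>t<Suc q. cell t) = has_label 0 1 (\<Union>t<q. cell t) \<union> has_label 0 1 (cell q)"
        by (auto simp: has_label_def lessThan_Suc)
      then have "s \<in> g (has_label 0 1 (\<Union>t<q. cell t)) \<or> s \<in> g (has_label 0 1 (cell q))"
        using Suc.prems gUn(1)[OF hl hl] by simp
      then show ?case using Suc.IH less_Suc_eq by blast
    qed
    have "nets = has_label 0 1 {0} \<union> has_label 0 1 (L - {0})"
      using netsD(2) n012 by (auto simp: has_label_def)
    then have "tup x y x \<in> g (has_label 0 1 {0}) \<union> g (has_label 0 1 (L - {0}))"
      using gUn(1)[OF hl hl] g0 tup(1)[OF xy(1,2,1)] by metis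
    then show ?thesis using fin[of "tup x y x" "n * (n * n)"] xy(3) unfolding E01_def cell_cover by blast
  qed
  have "seqs n V \<noteq> {}" using ne g0 by auto
  then obtain x0 where x0: "x0 \<in> V" using n012 by (auto simp: PiE_eq_empty_iff)
  \<comment> \<open>The points \<open>y m\<close> of sort 1 are told apart by their labels to
    \<open>x0\<close>; \<open>x m\<close> and \<open>z m\<close> translate them to the sorts 0 and
    2.\<close>
  obtain y where y: "\<And>m. y m \<in> V" "\<And>m. E01 {fresh m} x0 (y m)"
    using ex1[OF x0 fresh(1)] by metis
  obtain x where x: "\<And>m. x m \<in> V" "\<And>m. E01 {0} (x m) (y m)"
    using ex0[OF y(1)] by metis
  obtain z where z: "\<And>m. z m \<in> V" "\<And>m. E02 {0} (x m) (z m)"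
    using ex2[OF x(1)] by metis
  have yz: "E12 {0} (y m) (z m)" for m using r2 x y z by blast
  \<comment> \<open>Otherwise \<open>z m\<close> translates both \<open>y m\<close> and
    \<open>y m'\<close>, and its label to \<open>x0\<close> is \<open>fresh m\<close> as well as
    \<open>fresh m'\<close>.\<close>
  have diff: "\<not> E01 {0} (x m) (y m')" if "m \<noteq> m'" for m m'
  proof
    assume "E01 {0} (x m) (y m')"
    then have "E12 {0} (y m') (z m)" using r2 x y z by blast
    then have "E02 {fresh m'} x0 (z m)" using r1 x0 y z by blast
    moreover have "E02 {fresh m} x0 (z m)" using r1 x0 y z yz by blast
    ultimately have "fresh m' = fresh m" by (rule disj)
    then show False using that fresh(2) by simp
  qed
  obtain c where c: "\<And>p q. p < q \<Longrightarrow> c p q < n * (n * n)" "\<And>p q. p < q \<Longrightarrow> E01 (cell (c p q)) (x p) (y q)"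
  proof -
    have "\<exists>t. p < q \<longrightarrow> t < n * (n * n) \<and> E01 (cell t) (x p) (y q)" for p q
      using cls[OF x(1) y(1) diff, of p q] by auto
    then show thesis using that by metis
  qed
  obtain p q r t where pqr: "p < q" "q < r" "c p q = t" "c p r = t" "c q r = t"
    using Ramsey_triple[of c] c(1) by metis
  \<comment> \<open>The forbidden triangle is on \<open>x p\<close>, \<open>y q\<close>,
    \<open>z r\<close>. The three coloured pairs all lie between the sorts 0 and 1, and translation
    makes them its sides.\<close>
  have "E02 (cell t) (x p) (z r)" using r1[OF c(2) yz] pqr x y z by (metis less_trans)
  moreover have "E02 (cell t) (x q) (z r)" using r1[OF c(2) yz] pqr x y z by metis
  then have "E12 (cell t) (y q) (z r)" using r2 x y z by blast
  moreover have "E01 (cell t) (x p) (y q)" using c(2) pqr by metis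
  ultimately show False using indep x y z by blast
qed

text \<open>The argument with a single sort: label \<open>0\<close> is represented by true equality,
  so the \<open>y m\<close> are different points and translations disappear.\<close>

lemma Cm_labS_not_representable:
  assumes "in_product RA_sig rel_algebra (Cm labS) I U"
  shows False
proof -
  have "L \<noteq> {}" using zero_in_L by blast
  then have "bzero (Cm labS) \<in> elems (Cm labS)" "bone (Cm labS) \<in> elems (Cm labS)" "bzero (Cm labS) \<noteq> bone (Cm labS)"
    by auto
  then obtain i0 g where hom: "homomorphism RA_sig g (Cm labS) (rel_algebra (U i0))" and "g (bzero (Cm labS)) \<noteq> g (bone (Cm labS))"
    by (rule in_product_component[OF assms])
  then have ne: "g {} \<noteq> g L" by simp
  define V where "V = U i0"
  note hs = homomorphism_simps[OF hom[folded V_def]]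
  have g0: "g {} = {}" "g L = V \<times> V" using hs(1,2) by (simp_all add: rel_algebra_def)
  have gUn: "g (X \<union> Y) = g X \<union> g Y" "g (X \<inter> Y) = g X \<inter> g Y" if "X \<subseteq> L" "Y \<subseteq> L" for X Y
    using hs(3,4)[of X Y] that by (simp_all add: rel_algebra_def)
  have gcomp: "g (rcomp (Cm labS) X Y) = g X O g Y" if "X \<subseteq> L" "Y \<subseteq> L" for X Y
    using hs(8)[of Comp X Y] that by (simp add: rel_algebra_def RA_sig_def)
  have gid: "g {0} = Id_on V"
    using hs(6)[of Ident] by (simp add: rel_algebra_def RA_sig_def labS_ops)
  have gmono: "g X \<subseteq> g Y" if "X \<subseteq> Y" "Y \<subseteq> L" for X Y
    using gUn(1)[of X Y] that by (metis Un_upper1 subset_Un_eq subset_trans)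
  have "V \<times> V \<noteq> {}" using ne g0 by auto
  then obtain x0 where x0: "x0 \<in> V" by auto
  have "\<exists>y\<in>V. (x0, y) \<in> g {a}" if a: "a \<in> L" for a
  proof -
    have "g {0} \<subseteq> g (rcomp (Cm labS) {a} {a})" by (rule gmono) (auto simp: labS_ops)
    then have "(x0, x0) \<in> g {a} O g {a}" using gid x0 gcomp[of "{a}" "{a}"] a by auto
    then obtain y where "(x0, y) \<in> g {a}" by blast
    moreover have "g {a} \<subseteq> V \<times> V" using gmono[of "{a}" L] a g0 by simp
    ultimately show ?thesis by blast
  qed
  then have "\<forall>m. \<exists>y. y \<in> V \<and> (x0, y) \<in> g {fresh m}" using fresh(1) by blast
  then obtain y where y: "\<And>m. y m \<in> V" "\<And>m. (x0, y m) \<in> g {fresh m}" by metis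
  have inj: "y m \<noteq> y m'" if "m \<noteq> m'" for m m'
  proof
    assume "y m = y m'"
    then have "(x0, y m) \<in> g ({fresh m} \<inter> {fresh m'})"
      using y(2)[of m] y(2)[of m'] gUn(2)[of "{fresh m}" "{fresh m'}"] fresh(1) by simp
    moreover have "{fresh m} \<inter> {fresh m'} = {}" using that fresh(2) by auto
    ultimately show False using g0 by simp
  qed
  have fin: "s \<in> g (\<Union>t<q. cell t) \<Longrightarrow> \<exists>t<q. s \<in> g (cell t)" for q s
  proof (induction q)
    case 0
    then show ?case using g0 by simp
  next
    case (Suc q)
    have "g ((\<Union>t<q. cell t) \<union> cell q) = g (\<Union>t<q. cell t) \<union> g (cell q)"
      by (rule gUn(1)) (use cell_subset in auto)
    then have "s \<in> g (\<Union>t<q. cell t) \<or> s \<in> g (cell q)"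
      using Suc.prems by (auto simp: lessThan_Suc Un_commute)
    then show ?case using Suc.IH less_Suc_eq by blast
  qed
  have "\<exists>t<n * (n * n). (y p, y q) \<in> g (cell t)" if "p < q" for p q
  proof -
    have "{0} \<union> (L - {0}) = L" using zero_in_L by blast
    then have "(y p, y q) \<in> g {0} \<union> g (L - {0})" using gUn(1)[of "{0}" "L - {0}"] y(1) g0 by auto
    moreover have "(y p, y q) \<notin> g {0}" using inj[of p q] that by (auto simp: gid)
    ultimately show ?thesis using fin[of "(y p, y q)" "n * (n * n)"] by (simp add: cell_cover)
  qed
  then have "\<exists>t. p < q \<longrightarrow> t < n * (n * n) \<and> (y p, y q) \<in> g (cell t)" for p q by blast
  then obtain c where c: "\<And>p q. p < q \<Longrightarrow> c p q < n * (n * n)" "\<And>p q. p < q \<Longrightarrow> (y p, y q) \<in> g (cell (c p q))"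
    by metis
  obtain p q r t where pqr: "p < q" "q < r" "c p q = t" "c p r = t" "c q r = t"
    using Ramsey_triple[of c] c(1) by metis
  have "(y p, y r) \<in> g (rcomp (Cm labS) (cell t) (cell t)) \<inter> g (cell t)"
    using c(2)[of p q] c(2)[of q r] c(2)[of p r] pqr gcomp[of "cell t" "cell t"] cell_subset by auto
  then have "(y p, y r) \<in> g (rcomp (Cm labS) (cell t) (cell t) \<inter> cell t)"
    using gUn(2)[of "rcomp (Cm labS) (cell t) (cell t)" "cell t"] cell_subset by (auto simp: labS_ops)
  moreover have "rcomp (Cm labS) (cell t) (cell t) \<inter> cell t = {}"
    using cell_independent by (auto simp: labS_ops)
  ultimately show False using g0 by simp
qed

section \<open>Basic matrices\<close>

lemma Cm_labS_atoms: "atoms (Cm labS) = {{a} | a. a \<in> L}" "atomic (Cm labS)"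
  "as_iso RA_sig (\<lambda>a. {a}) labS (At (Cm labS))"
proof -
  have e: "(Cm labS)\<lparr>elems := Pow (points labS)\<rparr> = Cm labS" by (simp add: Cm_def)
  show "atoms (Cm labS) = {{a} | a. a \<in> L}" "atomic (Cm labS)" "as_iso RA_sig (\<lambda>a. {a}) labS (At (Cm labS))"
    using singleton_subalgebra_atoms[of RA_sig labS, OF closed_under_Cm] unfolding e by auto
qed

lemma below_labS: "below (Cm labS) X Y \<longleftrightarrow> X \<subseteq> Y" by (auto simp: below_def)

text \<open>The atoms of \<open>Cm labS\<close> are singletons instead of labels;
  \<open>undefined\<close> off the square keeps the result extensional, as basic matrices
  are.\<close>

definition single :: "(nat \<times> nat \<Rightarrow> nat) \<Rightarrow> nat \<times> nat \<Rightarrow> nat set" where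
  "single f = (\<lambda>p\<in>{..<n} \<times> {..<n}. {f p})"

lemma single_apply [simp]: "x < n \<Longrightarrow> y < n \<Longrightarrow> single f (x, y) = {f (x, y)}"
  by (simp add: single_def)

lemma single_inj: "inj_on single nets"
proof (intro inj_onI nets_eqI)
  fix f g x y assume "single f = single g" "x < n" "y < n"
  then have "single f (x, y) = single g (x, y)" by simp
  then show "f (x, y) = g (x, y)" using \<open>x < n\<close> \<open>y < n\<close> by simp
qed

lemma basic_matrices_labS: "basic_matrices n (Cm labS) = single ` nets"
proof (intro set_eqI iffI)
  fix F assume F: "F \<in> basic_matrices n (Cm labS)"
  define f where "f = restrict (\<lambda>p. the_elem (F p)) ({..<n} \<times> {..<n})"
  have Ff: "F (x, y) = {f (x, y)}" "f (x, y) \<in> L" if "x < n" "y < n" for x y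
  proof -
    have "F \<in> {..<n} \<times> {..<n} \<rightarrow>\<^sub>E atoms (Cm labS)" using F unfolding basic_matrices_def mem_Collect_eq by (elim conjE)
    from PiE_mem[OF this, of "(x, y)"] have "F (x, y) \<in> atoms (Cm labS)" using that by simp
    then obtain a where "F (x, y) = {a}" "a \<in> L" unfolding Cm_labS_atoms by blast
    then show "F (x, y) = {f (x, y)}" "f (x, y) \<in> L" using that by (auto simp: f_def)
  qed
  have D: "F (x, x) \<subseteq> {0}" "F (y, x) = F (x, y) \<inter> L"
    "z < n \<Longrightarrow> F (x, z) \<subseteq> rcomp (Cm labS) (F (x, y)) (F (y, z))" if "x < n" "y < n" for x y z
    using F that unfolding basic_matrices_def below_labS labS_ops(1,2) by blast+
  have "net_on {..<n} f"
    unfolding net_on_def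
  proof (intro conjI ballI)
    fix x y z assume "x \<in> {..<n}" "y \<in> {..<n}" "z \<in> {..<n}"
    then have xyz: "x < n" "y < n" "z < n" by auto
    show "f (x, x) = 0" using D(1)[OF xyz(1,1)] Ff[OF xyz(1,1)] by simp
    show "f (y, x) = f (x, y)" using D(2)[OF xyz(1,2)] Ff[OF xyz(1,2)] Ff[OF xyz(2,1)] by simp
    show "tri (f (x, z)) (f (x, y)) (f (y, z))"
      using D(3)[OF xyz] Ff[OF xyz(1,2)] Ff[OF xyz(2,3)] Ff[OF xyz(1,3)] by (simp add: labS_ops)
  qed
  then have "f \<in> nets" using Ff(2) by (auto simp: nets_def f_def)
  moreover have "F = single f"
  proof (rule PiE_ext)
    show "F \<in> {..<n} \<times> {..<n} \<rightarrow>\<^sub>E UNIV" using F by (auto simp: basic_matrices_def PiE_iff)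
    show "single f \<in> {..<n} \<times> {..<n} \<rightarrow>\<^sub>E UNIV" by (auto simp: single_def)
  qed (use Ff in auto)
  ultimately show "F \<in> single ` nets" by blast
next
  fix F assume "F \<in> single ` nets"
  then obtain f where f: "f \<in> nets" "F = single f" by blast
  have "single f \<in> {..<n} \<times> {..<n} \<rightarrow>\<^sub>E atoms (Cm labS)"
    using netsD(2)[OF f(1)] unfolding Cm_labS_atoms by (auto simp: single_def)
  moreover have "tri (f (x, z)) (f (x, y)) (f (y, z))" if "x < n" "y < n" "z < n" for x y z
    using net_onD(3)[OF netsD(1)[OF f(1)]] that by simp
  ultimately show "F \<in> basic_matrices n (Cm labS)"
    using netsD(2-4)[OF f(1)] unfolding basic_matrices_def below_labS f(2) by (auto simp: labS_ops)
qed

lemma agree_off_single [simp]: "agree_off n Z (single f) (single g) \<longleftrightarrow> agree_off n Z f g"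
  by (simp add: agree_off_def)

lemma mat_comp_single:
  "\<tau> \<in> {..<n} \<rightarrow> {..<n} \<Longrightarrow> mat_comp n (single f) \<tau> = single (mat_comp n f \<tau>)"
  by (auto simp: mat_comp_def single_def fun_eq_iff Pi_iff)

lemma Mat_labS_iso: "as_iso (PEA_sig n) single netS (Mat n (Cm labS))"
  unfolding as_iso_def
proof (intro conjI allI impI)
  show "bij_betw single (points netS) (points (Mat n (Cm labS)))"
    using single_inj by (simp add: Mat_def bij_betw_def basic_matrices_labS)
  fix F f fs assume *: "(F, length fs) \<in> PEA_sig n \<and> f \<in> points netS \<and> set fs \<subseteq> points netS"
  have eq: "mat_comp n (single f) \<tau> = single g \<longleftrightarrow> mat_comp n f \<tau> = g" if "\<tau> \<in> {..<n} \<rightarrow> {..<n}" "g \<in> nets" for \<tau> g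
    using mat_comp_single[OF that(1)] inj_on_eq_iff[OF single_inj mat_comp_nets[OF _ that(1)] that(2)] * by simp
  from * have "(F, length fs) \<in> PEA_sig n" by simp
  then show "rel netS F f fs \<longleftrightarrow> rel (Mat n (Cm labS)) F (single f) (map single fs)"
    by (cases rule: PEA_sig_cases)
      (use * eq transpose_lessThan replace_lessThan in \<open>auto simp: netS_def Mat_def below_labS labS_ops\<close>)
qed

lemma polyadic_equality_basis_labS:
  "polyadic_equality_basis n (Cm labS) (basic_matrices n (Cm labS))"
proof -
  have 1: "\<exists>f\<in>nets. f (0, 1) = a" if a: "a \<in> L" for a
  proof -
    let ?z = "restrict (\<lambda>_. 0) ({..<n} \<times> {..<n})"
    have n01: "0 < n" "1 < n" using n by auto
    have "point_ext {0} ?z (\<lambda>_. a)" using n01 by (simp add: point_ext_def)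
    then obtain h where h: "h \<in> nets" "h (1, 0) = a"
      by (rule extend_net[OF zero_net n01(2), rotated]) (use n01 a in auto)
    then show ?thesis using netsD(4)[OF h(1), of 0 1] n01 by auto
  qed
  have 2: "\<exists>g\<in>nets. agree_off n {z} f g \<and> g (x, z) = a \<and> g (z, y) = b"
    if f: "f \<in> nets" and xyz: "x < n" "y < n" "z < n" "z \<noteq> x" "z \<noteq> y" and ab: "a \<in> L" "b \<in> L" "tri (f (x, y)) a b"
    for f x y z a b
  proof -
    \<comment> \<open>For \<open>x = y\<close> the two prescriptions concern the same point; they
      agree because the diagonal label is \<open>0\<close>.\<close>
    have ba: "b = a" if "x = y" using ab(3) netsD(3)[OF f] xyz that by simp
    let ?\<phi> = "\<lambda>w. if w = x then a else b"
    have "tri (f (y, x)) b a" using ab(3) netsD(4)[OF f xyz(1,2)] by (metis tri_rot(2))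
    then have "point_ext {x, y} f ?\<phi>" using ab(3) netsD(3)[OF f] xyz ba by (auto simp: point_ext_def)
    then obtain h where h: "h \<in> nets" "agree_off n {z} f h" "\<And>w. w \<in> {x, y} \<Longrightarrow> h (z, w) = ?\<phi> w"
      by (rule extend_net[OF f xyz(3), rotated]) (use xyz ab in auto)
    have "h (x, z) = a" "h (z, y) = b" using h(3)[of x] h(3)[of y] netsD(4)[OF h(1), of z x] xyz ba by auto
    then show ?thesis using h by blast
  qed
  have 3: "\<exists>h\<in>nets. agree_off n {x} h f \<and> agree_off n {y} h g"
    if "f \<in> nets" "g \<in> nets" "x < n" "y < n" "agree_off n {x, y} f g" for f g x y
    using amalgamate_nets[OF that] by blast
  have n01: "0 < n" "Suc 0 < n" using n by auto
  have "cylindric_basis n (Cm labS) (single ` nets)"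
    unfolding cylindric_basis_def
  proof (intro conjI)
    show "single ` nets \<subseteq> basic_matrices n (Cm labS)" by (simp add: basic_matrices_labS)
    show "\<forall>a\<in>atoms (Cm labS). \<exists>f\<in>single ` nets. f (0, 1) = a"
    proof
      fix A assume "A \<in> atoms (Cm labS)"
      then obtain a where "A = {a}" "a \<in> L" unfolding Cm_labS_atoms by blast
      then show "\<exists>f\<in>single ` nets. f (0, 1) = A" using 1[of a] n01 by auto
    qed
    show "\<forall>f\<in>single ` nets. \<forall>x<n. \<forall>y<n. \<forall>z<n. \<forall>a\<in>atoms (Cm labS). \<forall>b\<in>atoms (Cm labS).
        below (Cm labS) (f (x, y)) (rcomp (Cm labS) a b) \<and> z \<noteq> x \<and> z \<noteq> y \<longrightarrow>
        (\<exists>g\<in>single ` nets. agree_off n {z} f g \<and> g (x, z) = a \<and> g (z, y) = b)"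
    proof (intro ballI allI impI)
      fix F x y z A B
      assume *: "F \<in> single ` nets" "x < n" "y < n" "z < n" "A \<in> atoms (Cm labS)" "B \<in> atoms (Cm labS)"
        "below (Cm labS) (F (x, y)) (rcomp (Cm labS) A B) \<and> z \<noteq> x \<and> z \<noteq> y"
      obtain f where f: "f \<in> nets" "F = single f" using * by blast
      obtain a b where ab: "A = {a}" "a \<in> L" "B = {b}" "b \<in> L" using * unfolding Cm_labS_atoms by blast
      have "tri (f (x, y)) a b" using * unfolding below_labS f(2) ab by (simp add: labS_ops)
      then obtain g where "g \<in> nets" "agree_off n {z} f g" "g (x, z) = a" "g (z, y) = b"
        using 2[OF f(1) *(2-4)] * ab by blast
      then show "\<exists>g\<in>single ` nets. agree_off n {z} F g \<and> g (x, z) = A \<and> g (z, y) = B"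
        using * unfolding f(2) ab by (intro bexI[of _ "single g"]) auto
    qed
    show "\<forall>f\<in>single ` nets. \<forall>g\<in>single ` nets. \<forall>x<n. \<forall>y<n. agree_off n {x, y} f g \<longrightarrow>
        (\<exists>h\<in>single ` nets. agree_off n {x} h f \<and> agree_off n {y} h g)"
      using 3 by auto
  qed
  moreover have "mat_comp n f \<tau> \<in> single ` nets" if "f \<in> single ` nets" "\<tau> \<in> {..<n} \<rightarrow> {..<n}" for f \<tau>
    using that mat_comp_single mat_comp_nets by auto
  ultimately show ?thesis unfolding polyadic_equality_basis_def basic_matrices_labS by blast
qed

end

section \<open>Transfer along isomorphisms of atom structures, and the theorem\<close>

lemma (in monk) between_not_representable:
  fixes S :: "(pea_op, 's) atom_structure"
  assumes "between_Df_PEA n t" "as_iso (PEA_sig n) d netS S"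
  shows "\<not> representable t (set_algebra n) (Cm S)"
proof
  assume "representable t (set_algebra n) (Cm S)"
  then obtain I :: "'s set set" and U :: "'s set \<Rightarrow> 's set list set"
    where r: "in_product t (set_algebra n) (Cm S) I U" by (auto simp: representable_def)
  \<comment> \<open>Each intermediate signature contains the cylindrifiers, so its representations
    restrict to the diagonal-free reduct, where the refutation takes place.\<close>
  have sub: "Df_sig n \<subseteq> t" "Df_sig n \<subseteq> PEA_sig n" using assms(1) by (auto simp: between_Df_PEA_def PEA_sig_def)
  have "closed_under (Df_sig n) (Cm netS) (elems (Cm netS))" using closed_under_Cm[of "Df_sig n" netS] by simp
  with in_product_mono[OF r sub(1)] homomorphism_mono[OF Cm_hom(1)[OF assms(2)] sub(2)] Cm_hom(2)[OF assms(2)]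
  have "in_product (Df_sig n) (set_algebra n) (Cm netS) I U" by (rule in_product_embed)
  then show False by (rule Cm_netS_not_Df_representable)
qed

text \<open>The supported sets include the singletons, so their preimage includes the term algebra.
  The base here consists of natural numbers, and \<open>representable_set_algebraI\<close> exchanges
  it for one of the type in \<open>representable\<close>.\<close>

lemma (in monk_model) Tm_representable:
  assumes "as_iso (PEA_sig n) d netS S"
  shows "representable (PEA_sig n) (set_algebra n) (Tm (PEA_sig n) S)"
proof (rule representable_set_algebraI[OF order_refl])
  show "in_product (PEA_sig n) (set_algebra n) (Tm (PEA_sig n) S) {()} (\<lambda>_. UNIV :: nat set)"
    by (rule in_product_Tm[OF as_iso_inv[OF assms] fin_supp_closed _ fin_supp_representable])
      (use fin_supp_singleton in auto)
qed

lemma has_atom_structure_Cm: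
  assumes "K (Cm S)"
  shows "has_atom_structure sig K S (Cm S)"
proof -
  have e: "(Cm S)\<lparr>elems := Pow (points S)\<rparr> = Cm S" by (simp add: Cm_def)
  have "atomic (Cm S)" "as_iso sig (\<lambda>s. {s}) S (At (Cm S))"
    using singleton_subalgebra_atoms(2,3)[of sig S, OF closed_under_Cm] unfolding e by auto
  then show ?thesis
    using assms as_iso_inv unfolding has_atom_structure_def isomorphic_as_iff by blast
qed

theorem theorem3p3:
  fixes n :: nat
  assumes "n > 2"
  shows
    "(\<exists>S :: (pea_op, nat) atom_structure.
        is_atom_structure (PEA_sig n) (PEA n) S \<and>
        representable (PEA_sig n) (set_algebra n) (Tm (PEA_sig n) S) \<and>
        \<not> strongly_representable (PEA_sig n) (PEA n) (set_algebra n) S \<and>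
        (\<forall>t. between_Df_PEA n t \<longrightarrow> \<not> representable t (set_algebra n) (Cm S)))
     \<and>
     (\<exists>R :: (ra_op, nat set) algebra.
        RA R \<and> atomic R \<and>
        polyadic_equality_basis n R (basic_matrices n R) \<and>
        representable (PEA_sig n) (set_algebra n) (Tm (PEA_sig n) (Mat n R)) \<and>
        \<not> representable (Df_sig n) (set_algebra n) (Cm (Mat n R)) \<and>
        weakly_representable RA_sig RA rel_algebra (At R) \<and>
        \<not> strongly_representable RA_sig RA rel_algebra (At R))"
proof -
  interpret monk n by unfold_locales (rule assms)
  obtain N where N: "\<And>x y. N (x, y) = 0 \<longleftrightarrow> x = y" "net_on UNIV N"
    "\<And>K \<phi>. finite K \<Longrightarrow> card K < n \<Longrightarrow> point_ext K N \<phi> \<Longrightarrow> 0 \<notin> \<phi> ` K \<Longrightarrow> \<exists>u. \<forall>x\<in>K. N (u, x) = \<phi> x"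
    by (rule model_exists) blast
  interpret monk_model n N by unfold_locales (fact N)+
  have betw: "between_Df_PEA n (Df_sig n)" "between_Df_PEA n (PEA_sig n)"
    unfolding between_Df_PEA_def PEA_sig_def
     apply (rule exI[of _ "{}"], simp)
    apply (rule exI[of _ "{diag_sig n, repl_sig n, transp_sig n}"], simp add: Un_ac)
    done
  show ?thesis
  proof (intro conjI exI)
    \<comment> \<open>The points have to be natural numbers, so a matrix is coded by the list of its
      entries.\<close>
    define e where "e f = to_nat (map f (List.product [0..<n] [0..<n]))" for f :: "nat \<times> nat \<Rightarrow> nat"
    have inj: "inj_on e nets"
    proof (intro inj_onI nets_eqI)
      fix f g x y assume "e f = e g" "x < n" "y < n"
      then have "map f (List.product [0..<n] [0..<n]) = map g (List.product [0..<n] [0..<n])"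
        "(x, y) \<in> set (List.product [0..<n] [0..<n])"
        by (simp_all add: e_def)
      then show "f (x, y) = g (x, y)" unfolding map_eq_conv by blast
    qed
    let ?S = "\<lparr> points = e ` nets, rel = \<lambda>f p ps. net_rel f (inv_into nets e p) (map (inv_into nets e) ps) \<rparr>"
    have "map (inv_into nets e) (map e as) = as" if "set as \<subseteq> nets" for as
      using that inj by (auto intro!: map_idI)
    then have iso: "as_iso sig e netS ?S" for sig
      using inj by (auto simp: as_iso_def netS_def bij_betw_def)
    have PEA: "PEA n (Cm ?S)"
      by (rule PEA_image[OF Cm_hom(1)[OF iso] Cm_hom(3)[OF iso, symmetric] PEA_netS])
    have has: "has_atom_structure (PEA_sig n) (PEA n) ?S (Cm ?S)"
      by (rule has_atom_structure_Cm[where K = "PEA n", OF PEA])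
    show "is_atom_structure (PEA_sig n) (PEA n) ?S" using has by (auto simp: is_atom_structure_def)
    show "representable (PEA_sig n) (set_algebra n) (Tm (PEA_sig n) ?S)" by (rule Tm_representable[OF iso])
    show "\<forall>t. between_Df_PEA n t \<longrightarrow> \<not> representable t (set_algebra n) (Cm ?S)"
      using between_not_representable iso by blast
    then show "\<not> strongly_representable (PEA_sig n) (PEA n) (set_algebra n) ?S"
      using has betw(2) unfolding strongly_representable_def by blast
  next
    let ?R = "Cm labS"
    note iso = Cm_labS_atoms(3)
    show "RA ?R" by (rule RA_labS)
    show "atomic ?R" by (rule Cm_labS_atoms)
    show "polyadic_equality_basis n ?R (basic_matrices n ?R)" by (rule polyadic_equality_basis_labS)
    show "representable (PEA_sig n) (set_algebra n) (Tm (PEA_sig n) (Mat n ?R))"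
      by (rule Tm_representable[OF Mat_labS_iso])
    show "\<not> representable (Df_sig n) (set_algebra n) (Cm (Mat n ?R))"
      by (rule between_not_representable[OF betw(1) Mat_labS_iso])
    have RA: "RA (Cm (At ?R))"
      by (rule RA_image[OF Cm_hom(1)[OF iso] Cm_hom(3)[OF iso, symmetric] RA_labS])
    \<comment> \<open>The points of \<open>At ?R\<close> are singletons, so the supported sets of
      labels are pulled back along the inverse of the map from \<open>a\<close> to
      \<open>{a}\<close>. The result is a represented relation algebra with this atom
      structure.\<close>
    obtain X where X: "closed_under RA_sig (Cm (At ?R)) X" "{{s} | s. s \<in> points (At ?R)} \<subseteq> X"
      "in_product RA_sig rel_algebra ((Cm (At ?R))\<lparr>elems := X\<rparr>) {()} (\<lambda>_. UNIV :: nat set)"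
      by (rule vimage_subalgebra[OF as_iso_inv[OF iso] lfin_supp_closed _ lfin_supp_representable])
        (use lfin_supp_singleton in auto)
    have "has_atom_structure RA_sig RA (At ?R) ((Cm (At ?R))\<lparr>elems := X\<rparr>)"
      using RA_subalgebra[OF RA X(1)] singleton_subalgebra_atoms(2)[OF X(1,2)]
        as_iso_inv[OF singleton_subalgebra_atoms(3)[OF X(1,2)]]
      unfolding has_atom_structure_def isomorphic_as_iff by blast
    then show "weakly_representable RA_sig RA rel_algebra (At ?R)"
      using representable_rel_algebraI[OF order_refl X(3)] unfolding weakly_representable_def by blast
    have "\<not> representable RA_sig rel_algebra (Cm (At ?R))"
    proof
      assume "representable RA_sig rel_algebra (Cm (At ?R))"
      then obtain I :: "nat set set set" and U :: "nat set set \<Rightarrow> nat set set list set"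
        where "in_product RA_sig rel_algebra (Cm (At ?R)) I U" by (auto simp: representable_def)
      from in_product_embed[OF this Cm_hom(1,2)[OF iso]] closed_under_Cm[of RA_sig labS]
      have "in_product RA_sig rel_algebra ?R I U" by simp
      then show False by (rule Cm_labS_not_representable)
    qed
    then show "\<not> strongly_representable RA_sig RA rel_algebra (At ?R)"
      using has_atom_structure_Cm[where K = RA, OF RA] unfolding strongly_representable_def by blast
  qed
qed

end
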